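(* For any rigid decomposition groupoid $X$, the groupoid $\operatorname{map}(X,U)$ of strict culf maps from $X$ to the pseudo-simplicial groupoid $U$ of subdivided discrete algebraic intervals (with invertible modifications as arrows) is connected. More precisely, for any strict culf map $J:X\to U$ there is an invertible modification $\Gamma:J\Rightarrow I$, where $I:X\to U$ is the interval construction $\lambda\mapsto(\phi_\lambda:\Delta^n\to I_{\operatorname{long}(\lambda)})$.
   Context: **Simplicial conventions.** $\Delta$ is the category of nonempty finite ordinals $[n]=\{0<\dots<n\}$ and monotone maps. A map $g:[m]\to[n]$ is *active* if $g(0)=0$ and $g(m)=n$; it is *inert* if $g(i+1)=g(i)+1$ for all $0\le i<m$. Pushouts in $\Delta$ of active maps along inert maps exist. A simplicial groupoid is a strict functor $\Delta^{\mathrm{op}}\to\mathbf{Grpd}$; sets are regarded as discrete groupoids, and $\Delta^n$ is the standard $n$-simplex. An $n$-simplex of $X$ is an object $\lambda$ of $X_n$, equivalently a simplicial map $\lambda:\Delta^n\to X$. Its long edge $\operatorname{long}(\lambda)\in X_1$ is its image under the unique active map $[1]\to[n]$. Write $d_\bot=d_0$ and $d_\top=d_n$ for the outer face maps. **Rigid decomposition groupoids.** A simplicial groupoid $X$ is a *rigid decomposition groupoid* if (i) $d_1:X_2\to X_1$ is a discrete fibration, (ii) $s_0:X_0\to X_1$ is fully faithful, (iii) $X$ sends every pushout square in $\Delta$ of an active map along an inert map to a strict pullback of groupoids. **Discrete algebraic intervals.** A discrete algebraic interval is a simplicial set $A$ satisfying the strict Segal condition $A_n\cong A_1\times_{A_0}\cdots\times_{A_0}A_1$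 (i.e. isomorphic to the nerve of a category), together with a chosen initial object $\bot\in A_0$ and a chosen terminal object $\top\in A_0$. Each $\Delta^n$ is one, with $\bot=0$, $\top=n$. A simplicial map between discrete algebraic intervals is *stretched* if it preserves the chosen initial and the chosen terminal objects. A simplicial map of simplicial sets is *strict culf* if its naturality square on every active map is a pullback. Every simplicial map between discrete algebraic intervals factors, uniquely up to unique isomorphism, as a stretched map followed by a strict culf map, and stretched maps are orthogonal to strict culf maps. **Intervals of $X$.** For $X$ rigid and $f\in X_1$, $I_f$ is the simplicial groupoid with $(I_f)_n$ the strict fibre over $f$ of the functor $X_{n+2}\to X_1$ induced by the active map $[1]\to[n+2]$, with face maps $d_i:(I_f)_n\to(I_f)_{n-1}$ given by $d_{i+1}$ of $X$ and degeneracies $s_i$ given by $s_{i+1}$ of $X$. It is discrete, and is a discrete algebraic interval with chosen initial object $s_0(f)$ and chosen terminal object $s_1(f)$. The map $M_f:I_f\to X$ sends $\lambda\in(I_f)_n\subset X_{n+2}$ to $d_\top d_\bot\lambda\in X_n$. For $\lambda\in X_n$ with $f=\operatorname{long}(\lambda)$, $\phi_\lambda:\Delta^n\to I_f$ is the unique stretched map with $M_f\circ\phi_\lambda=\lambda$. **The pseudo-simplicial groupoid $U$.** $U:\Delta^{\mathrm{op}}\to\widehat{\mathbf{Grpd}}$ (large groupoids) is the pseudofunctor where $U_n$ has as objects the stretched maps $a:\Delta^n\to A$ with $A$ a discrete algebraic interval, and as arrows $(a:\Delta^n\to A)\to(b:\Delta^n\to B)$ the isomorphisms $F:A\to B$ with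 $Fa=b$. For $p:[m]\to[n]$, the functor $p^*:U_n\to U_m$ sends $a:\Delta^n\to A$ to the stretched part $\Delta^m\to A'$ of a chosen stretched–culf factorisation $\Delta^m\to A'\to A$ of $a\circ p$, and acts on arrows by orthogonality; the coherence isomorphisms are the unique comparison isomorphisms of factorisations. If $p$ is active then $a\circ p$ is already stretched and the choice is $A'=A$ with the identity map to $A$, so $U$ is strict on active maps. **Strict culf maps to $U$.** A strict culf map $J:X\to U$ is a pseudonatural transformation from $X$ to $U$ whose structure isomorphisms are identities on active maps, and such that for every active $p:[m]\to[n]$ the square formed by $p^*:X_n\to X_m$, $p^*:U_n\to U_m$, $J_n$, $J_m$ is a strict pullback. A modification $\Gamma:J\Rightarrow J'$ is a family of natural transformations $\Gamma_n:J_n\Rightarrow J'_n$ compatible with the structure isomorphisms for all maps of $\Delta$. **The interval construction $I:X\to U$.** On objects $I_n(\lambda)=(\phi_\lambda:\Delta^n\to I_{\operatorname{long}(\lambda)})$. An arrow $\alpha:\lambda\to\mu$ in $X_n$ goes to the isomorphism $F_\alpha:I_{\operatorname{long}(\lambda)}\to I_{\operatorname{long}(\mu)}$ given by transporting fibres of the discrete fibrations $X_{k+2}\to X_1$ along $\operatorname{long}(\alpha)$. For $p:[m]\to[n]$ and $\lambda\in X_n$, put $\lambda'=\lambda\circ p$, $f'=\operatorname{long}(\lambda')$, $f=\operatorname{long}(\lambda)$; there is a unique simplicial map $c^p_\lambda:I_{f'}\to I_f$ with $c^p_\lambda\phi_{\lambda'}=\phi_\lambda p$ and $M_f c^p_\lambda=M_{f'}$,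 it is strict culf, and the structure isomorphism of $I$ at $p,\lambda$ is the comparison of this stretched–culf factorisation of $\phi_\lambda p$ with the chosen one. *)

theory Defs
  imports Main "HOL-Library.FuncSet"
begin

section \<open>The simplex category\<close>

text \<open>A value of type \<open>simplex_map\<close> is a monotone map together with its source \<open>[m]\<close> and
  target \<open>[n]\<close>.  The underlying function is extensional, so that equality of values is equality
  of morphisms.\<close>

typedef simplex_map =
  "{(m :: nat, n :: nat, p :: nat \<Rightarrow> nat). p \<in> {..m} \<rightarrow>\<^sub>E {..n} \<and> mono_on {..m} p}"
  by (rule exI[of _ "(0, 0, \<lambda>i\<in>{..0}. 0)"]) (auto simp: mono_on_def)

definition dsrc :: "simplex_map \<Rightarrow> nat" where
  "dsrc p = fst (Rep_simplex_map p)"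

definition dtgt :: "simplex_map \<Rightarrow> nat" where
  "dtgt p = fst (snd (Rep_simplex_map p))"

definition dapp :: "simplex_map \<Rightarrow> nat \<Rightarrow> nat" where
  "dapp p = snd (snd (Rep_simplex_map p))"

text \<open>\<open>dmk m n f\<close> is meaningful only if \<open>f\<close> maps \<open>{0..m}\<close> monotonically to \<open>{0..n}\<close>.
  Likewise \<open>q \<odot> p\<close> is meaningful only if \<open>dtgt p = dsrc q\<close>.\<close>

definition dmk :: "nat \<Rightarrow> nat \<Rightarrow> (nat \<Rightarrow> nat) \<Rightarrow> simplex_map" where
  "dmk m n f = Abs_simplex_map (m, n, restrict f {..m})"

definition dcomp :: "simplex_map \<Rightarrow> simplex_map \<Rightarrow> simplex_map" (infixl "\<odot>" 70) where
  "q \<odot> p = dmk (dsrc p) (dtgt q) (\<lambda>i. dapp q (dapp p i))"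

definition did :: "nat \<Rightarrow> simplex_map" where
  "did n = dmk n n (\<lambda>i. i)"

definition active :: "simplex_map \<Rightarrow> bool" where
  "active p \<longleftrightarrow> dapp p 0 = 0 \<and> dapp p (dsrc p) = dtgt p"

definition inert :: "simplex_map \<Rightarrow> bool" where
  "inert p \<longleftrightarrow> (\<forall>i<dsrc p. dapp p (i + 1) = dapp p i + 1)"

text \<open>\<open>coface n i : [n] \<rightarrow> [n+1]\<close> induces \<open>d\<^sub>i : X\<^sub>n\<^sub>+\<^sub>1 \<rightarrow> X\<^sub>n\<close>, and
  \<open>codegen n i : [n+1] \<rightarrow> [n]\<close> induces \<open>s\<^sub>i : X\<^sub>n \<rightarrow> X\<^sub>n\<^sub>+\<^sub>1\<close>.\<close>

definition coface :: "nat \<Rightarrow> nat \<Rightarrow> simplex_map" where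
  "coface n i = dmk n (n + 1) (\<lambda>j. if j < i then j else j + 1)"

definition codegen :: "nat \<Rightarrow> nat \<Rightarrow> simplex_map" where
  "codegen n i = dmk (n + 1) n (\<lambda>j. if j \<le> i then j else j - 1)"

definition vert :: "nat \<Rightarrow> nat \<Rightarrow> simplex_map" where
  "vert n i = dmk 0 n (\<lambda>_. i)"

definition spine_edge :: "nat \<Rightarrow> nat \<Rightarrow> simplex_map" where
  "spine_edge n i = dmk 1 n (\<lambda>j. i + j)"

definition dlong :: "nat \<Rightarrow> simplex_map" where
  "dlong n = dmk 1 n (\<lambda>j. if j = 0 then 0 else n)"

text \<open>For \<open>p : [m] \<rightarrow> [n]\<close>, \<open>shift p : [m+2] \<rightarrow> [n+2]\<close> adds a new bottom and a new top element
  to source and target.  It is the functor sending the \<open>i\<close>-th coface and codegeneracy maps to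
  the \<open>(i+1)\<close>-st ones (\<open>shift_coface\<close>, \<open>shift_codegen\<close> below).\<close>

definition shift :: "simplex_map \<Rightarrow> simplex_map" where
  "shift p = dmk (dsrc p + 2) (dtgt p + 2)
     (\<lambda>i. if i = 0 then 0 else if i \<le> dsrc p + 1 then dapp p (i - 1) + 1 else dtgt p + 2)"

definition is_pushout ::
    "simplex_map \<Rightarrow> simplex_map \<Rightarrow> simplex_map \<Rightarrow> simplex_map \<Rightarrow> bool" where
  "is_pushout a i a' i' \<longleftrightarrow>
     dsrc a = dsrc i \<and> dsrc a' = dtgt i \<and> dsrc i' = dtgt a \<and> dtgt a' = dtgt i' \<and>
     a' \<odot> i = i' \<odot> a \<and>
     (\<forall>u v. dsrc u = dtgt i \<and> dsrc v = dtgt a \<and> dtgt u = dtgt v \<and> u \<odot> i = v \<odot> a \<longrightarrow>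
        (\<exists>!w. dsrc w = dtgt a' \<and> dtgt w = dtgt u \<and> w \<odot> a' = u \<and> w \<odot> i' = v))"

lemma Rep_dmk:
  assumes "\<And>i. i \<le> m \<Longrightarrow> f i \<le> n" and "\<And>i j. i \<le> j \<Longrightarrow> j \<le> m \<Longrightarrow> f i \<le> f j"
  shows "Rep_simplex_map (dmk m n f) = (m, n, restrict f {..m})"
  unfolding dmk_def
  by (rule Abs_simplex_map_inverse) (use assms in \<open>auto simp: mono_on_def\<close>)

lemma dmk_cong: "(\<And>i. i \<le> m \<Longrightarrow> f i = g i) \<Longrightarrow> dmk m n f = dmk m n g"
  unfolding dmk_def by (metis atMost_iff restrict_ext)

lemma shift_coface:
  assumes "i \<le> n + 1"
  shows "shift (coface n i) = coface (n + 2) (i + 1)"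
proof -
  have "Rep_simplex_map (coface n i)
      = (n, n + 1, restrict (\<lambda>j. if j < i then j else j + 1) {..n})"
    unfolding coface_def by (rule Rep_dmk) auto
  then have *: "dsrc (coface n i) = n" "dtgt (coface n i) = n + 1"
    "dapp (coface n i) = restrict (\<lambda>j. if j < i then j else j + 1) {..n}"
    by (auto simp: dsrc_def dtgt_def dapp_def)
  have "shift (coface n i) = dmk (n + 2) (n + 3) (\<lambda>j. if j < i + 1 then j else j + 1)"
    unfolding shift_def * by (simp add: numeral_3_eq_3) (rule dmk_cong, use assms in auto)
  then show ?thesis
    by (simp add: coface_def numeral_3_eq_3)
qed

lemma shift_codegen:
  assumes "i \<le> n"
  shows "shift (codegen n i) = codegen (n + 2) (i + 1)"
proof -
  have "Rep_simplex_map (codegen n i)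
      = (n + 1, n, restrict (\<lambda>j. if j \<le> i then j else j - 1) {..n + 1})"
    unfolding codegen_def by (rule Rep_dmk) (use assms in auto)
  then have *: "dsrc (codegen n i) = n + 1" "dtgt (codegen n i) = n"
    "dapp (codegen n i) = restrict (\<lambda>j. if j \<le> i then j else j - 1) {..n + 1}"
    by (auto simp: dsrc_def dtgt_def dapp_def)
  have "shift (codegen n i) = dmk (n + 3) (n + 2) (\<lambda>j. if j \<le> i + 1 then j else j - 1)"
    unfolding shift_def * by (simp add: numeral_3_eq_3) (rule dmk_cong, use assms in auto)
  then show ?thesis
    by (simp add: codegen_def numeral_3_eq_3)
qed


section \<open>Groupoids\<close>

text \<open>\<open>cmp G g f\<close> is the composite "first \<open>f\<close>, then \<open>g\<close>".\<close>

record ('o, 'a) gpd =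
  Ob :: "'o set"
  Ar :: "'a set"
  src :: "'a \<Rightarrow> 'o"
  tgt :: "'a \<Rightarrow> 'o"
  idn :: "'o \<Rightarrow> 'a"
  cmp :: "'a \<Rightarrow> 'a \<Rightarrow> 'a"

definition arrow :: "('o, 'a) gpd \<Rightarrow> 'a \<Rightarrow> 'o \<Rightarrow> 'o \<Rightarrow> bool" where
  "arrow G f x y \<longleftrightarrow> f \<in> Ar G \<and> src G f = x \<and> tgt G f = y"

definition groupoid :: "('o, 'a) gpd \<Rightarrow> bool" where
  "groupoid G \<longleftrightarrow>
     (\<forall>f\<in>Ar G. src G f \<in> Ob G \<and> tgt G f \<in> Ob G) \<and>
     (\<forall>x\<in>Ob G. arrow G (idn G x) x x) \<and>
     (\<forall>x y z f g. arrow G f x y \<and> arrow G g y z \<longrightarrow> arrow G (cmp G g f) x z) \<and>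
     (\<forall>x y f. arrow G f x y \<longrightarrow> cmp G f (idn G x) = f \<and> cmp G (idn G y) f = f) \<and>
     (\<forall>w x y z f g h. arrow G f w x \<and> arrow G g x y \<and> arrow G h y z \<longrightarrow>
        cmp G h (cmp G g f) = cmp G (cmp G h g) f) \<and>
     (\<forall>x y f. arrow G f x y \<longrightarrow>
        (\<exists>g. arrow G g y x \<and> cmp G g f = idn G x \<and> cmp G f g = idn G y))"

definition connected_groupoid :: "('o, 'a) gpd \<Rightarrow> bool" where
  "connected_groupoid G \<longleftrightarrow>
     groupoid G \<and> Ob G \<noteq> {} \<and> (\<forall>x\<in>Ob G. \<forall>y\<in>Ob G. \<exists>f. arrow G f x y)"

record ('o, 'a, 'p, 'b) ftr =
  fob :: "'o \<Rightarrow> 'p"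
  far :: "'a \<Rightarrow> 'b"

text \<open>Both components of a functor are extensional, so that strict equality of functors is
  equality of records.\<close>

definition gfunctor ::
    "('o, 'a) gpd \<Rightarrow> ('p, 'b) gpd \<Rightarrow> ('o, 'a, 'p, 'b) ftr \<Rightarrow> bool" where
  "gfunctor G H F \<longleftrightarrow>
     fob F \<in> Ob G \<rightarrow>\<^sub>E Ob H \<and> far F \<in> Ar G \<rightarrow>\<^sub>E Ar H \<and>
     (\<forall>f\<in>Ar G. src H (far F f) = fob F (src G f) \<and> tgt H (far F f) = fob F (tgt G f)) \<and>
     (\<forall>x\<in>Ob G. far F (idn G x) = idn H (fob F x)) \<and>
     (\<forall>f\<in>Ar G. \<forall>g\<in>Ar G. tgt G f = src G g \<longrightarrow>
        far F (cmp G g f) = cmp H (far F g) (far F f))"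

definition id_ftr :: "('o, 'a) gpd \<Rightarrow> ('o, 'a, 'o, 'a) ftr" where
  "id_ftr G = \<lparr>fob = \<lambda>x\<in>Ob G. x, far = \<lambda>f\<in>Ar G. f\<rparr>"

definition comp_ftr ::
    "('o, 'a) gpd \<Rightarrow> ('p, 'b, 'q, 'c) ftr \<Rightarrow> ('o, 'a, 'p, 'b) ftr \<Rightarrow> ('o, 'a, 'q, 'c) ftr" where
  "comp_ftr G K F = \<lparr>fob = compose (Ob G) (fob K) (fob F), far = compose (Ar G) (far K) (far F)\<rparr>"

definition discrete_fibration ::
    "('o, 'a) gpd \<Rightarrow> ('p, 'b) gpd \<Rightarrow> ('o, 'a, 'p, 'b) ftr \<Rightarrow> bool" where
  "discrete_fibration E B P \<longleftrightarrow>
     (\<forall>e\<in>Ob E. \<forall>\<beta>\<in>Ar B. tgt B \<beta> = fob P e \<longrightarrow> (\<exists>!\<epsilon>. \<epsilon> \<in> Ar E \<and> tgt E \<epsilon> = e \<and> far P \<epsilon> = \<beta>))"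

definition fully_faithful ::
    "('o, 'a) gpd \<Rightarrow> ('p, 'b) gpd \<Rightarrow> ('o, 'a, 'p, 'b) ftr \<Rightarrow> bool" where
  "fully_faithful G H F \<longleftrightarrow>
     (\<forall>x\<in>Ob G. \<forall>y\<in>Ob G.
        bij_betw (far F) {f. arrow G f x y} {g. arrow H g (fob F x) (fob F y)})"

text \<open>The square with \<open>F : P \<rightarrow> A\<close>, \<open>G : P \<rightarrow> B\<close>, \<open>H : A \<rightarrow> C\<close>, \<open>K : B \<rightarrow> C\<close> commutes strictly and
  the comparison functor from \<open>P\<close> to the strict fibre product is an isomorphism of groupoids.\<close>

definition strict_pullback ::
    "('o, 'a) gpd \<Rightarrow> ('p, 'b) gpd \<Rightarrow> ('q, 'c) gpd \<Rightarrow>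
     ('o, 'a, 'p, 'b) ftr \<Rightarrow> ('o, 'a, 'q, 'c) ftr \<Rightarrow>
     ('p, 'b, 'r, 'd) ftr \<Rightarrow> ('q, 'c, 'r, 'd) ftr \<Rightarrow> bool" where
  "strict_pullback P A B F G H K \<longleftrightarrow>
     bij_betw (\<lambda>z. (fob F z, fob G z)) (Ob P)
       {(x, y). x \<in> Ob A \<and> y \<in> Ob B \<and> fob H x = fob K y} \<and>
     bij_betw (\<lambda>\<zeta>. (far F \<zeta>, far G \<zeta>)) (Ar P)
       {(\<xi>, \<eta>). \<xi> \<in> Ar A \<and> \<eta> \<in> Ar B \<and> far H \<xi> = far K \<eta>}"


section \<open>Rigid decomposition groupoids\<close>

record ('o, 'a) sgpd =
  lev :: "nat \<Rightarrow> ('o, 'a) gpd"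
  act :: "simplex_map \<Rightarrow> ('o, 'a, 'o, 'a) ftr"

definition simplicial_groupoid :: "('o, 'a) sgpd \<Rightarrow> bool" where
  "simplicial_groupoid X \<longleftrightarrow>
     (\<forall>n. groupoid (lev X n)) \<and>
     (\<forall>p. gfunctor (lev X (dtgt p)) (lev X (dsrc p)) (act X p)) \<and>
     (\<forall>n. act X (did n) = id_ftr (lev X n)) \<and>
     (\<forall>p q. dtgt p = dsrc q \<longrightarrow> act X (q \<odot> p) = comp_ftr (lev X (dtgt q)) (act X p) (act X q))"

definition rigid_decomposition_groupoid :: "('o, 'a) sgpd \<Rightarrow> bool" where
  "rigid_decomposition_groupoid X \<longleftrightarrow>
     simplicial_groupoid X \<and>
     discrete_fibration (lev X 2) (lev X 1) (act X (coface 1 1)) \<and>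
     fully_faithful (lev X 0) (lev X 1) (act X (codegen 0 0)) \<and>
     (\<forall>a i a' i'. active a \<and> inert i \<and> is_pushout a i a' i' \<longrightarrow>
        strict_pullback (lev X (dtgt a')) (lev X (dtgt i)) (lev X (dtgt a))
          (act X a') (act X i') (act X i) (act X a))"

definition long_ob :: "('o, 'a) sgpd \<Rightarrow> nat \<Rightarrow> 'o \<Rightarrow> 'o" where
  "long_ob X n x = fob (act X (dlong n)) x"

definition long_ar :: "('o, 'a) sgpd \<Rightarrow> nat \<Rightarrow> 'a \<Rightarrow> 'a" where
  "long_ar X n \<alpha> = far (act X (dlong n)) \<alpha>"


section \<open>Simplicial sets and discrete algebraic intervals\<close>

record 'x sset =
  cells :: "nat \<Rightarrow> 'x set"
  sact :: "simplex_map \<Rightarrow> 'x \<Rightarrow> 'x"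

definition sset :: "('x, 'z) sset_scheme \<Rightarrow> bool" where
  "sset A \<longleftrightarrow>
     (\<forall>p. sact A p \<in> cells A (dtgt p) \<rightarrow>\<^sub>E cells A (dsrc p)) \<and>
     (\<forall>n. sact A (did n) = (\<lambda>x\<in>cells A n. x)) \<and>
     (\<forall>p q. dtgt p = dsrc q \<longrightarrow> sact A (q \<odot> p) = compose (cells A (dtgt q)) (sact A p) (sact A q))"

definition smap ::
    "('x, 'z) sset_scheme \<Rightarrow> ('y, 'w) sset_scheme \<Rightarrow> (nat \<Rightarrow> 'x \<Rightarrow> 'y) \<Rightarrow> bool" where
  "smap A B F \<longleftrightarrow>
     (\<forall>n. F n \<in> cells A n \<rightarrow>\<^sub>E cells B n) \<and>
     (\<forall>p. \<forall>x\<in>cells A (dtgt p). F (dsrc p) (sact A p x) = sact B p (F (dtgt p) x))"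

definition sid :: "('x, 'z) sset_scheme \<Rightarrow> nat \<Rightarrow> 'x \<Rightarrow> 'x" where
  "sid A n = (\<lambda>x\<in>cells A n. x)"

text \<open>\<open>scomp A G F\<close> is \<open>G \<circ> F\<close> for simplicial maps \<open>F\<close> with domain \<open>A\<close>.\<close>

definition scomp ::
    "('x, 'z) sset_scheme \<Rightarrow> (nat \<Rightarrow> 'y \<Rightarrow> 'w) \<Rightarrow> (nat \<Rightarrow> 'x \<Rightarrow> 'y) \<Rightarrow> nat \<Rightarrow> 'x \<Rightarrow> 'w" where
  "scomp A G F n = compose (cells A n) (G n) (F n)"

definition siso ::
    "('x, 'z) sset_scheme \<Rightarrow> ('y, 'w) sset_scheme \<Rightarrow> (nat \<Rightarrow> 'x \<Rightarrow> 'y) \<Rightarrow> bool" where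
  "siso A B F \<longleftrightarrow>
     smap A B F \<and> (\<exists>G. smap B A G \<and> scomp A G F = sid A \<and> scomp B F G = sid B)"

definition strict_culf ::
    "('x, 'z) sset_scheme \<Rightarrow> ('y, 'w) sset_scheme \<Rightarrow> (nat \<Rightarrow> 'x \<Rightarrow> 'y) \<Rightarrow> bool" where
  "strict_culf A B F \<longleftrightarrow>
     smap A B F \<and>
     (\<forall>p. active p \<longrightarrow>
        bij_betw (\<lambda>x. (sact A p x, F (dtgt p) x)) (cells A (dtgt p))
          {(x, y). x \<in> cells A (dsrc p) \<and> y \<in> cells B (dtgt p) \<and> F (dsrc p) x = sact B p y})"

record 'x interval = "'x sset" +
  ibot :: 'x
  itop :: 'x

text \<open>For \<open>n = 0\<close> the iterated fibre product is by convention \<open>A\<^sub>0\<close>, hence the restriction to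
  \<open>n \<ge> 1\<close>.\<close>

definition strict_segal :: "('x, 'z) sset_scheme \<Rightarrow> bool" where
  "strict_segal A \<longleftrightarrow>
     (\<forall>n\<ge>1. bij_betw (\<lambda>x. \<lambda>i\<in>{..<n}. sact A (spine_edge n i) x) (cells A n)
        {e \<in> {..<n} \<rightarrow>\<^sub>E cells A 1.
           \<forall>i. i + 1 < n \<longrightarrow> sact A (vert 1 1) (e i) = sact A (vert 1 0) (e (i + 1))})"

definition discrete_algebraic_interval :: "'x interval \<Rightarrow> bool" where
  "discrete_algebraic_interval A \<longleftrightarrow>
     sset A \<and> strict_segal A \<and>
     ibot A \<in> cells A 0 \<and> itop A \<in> cells A 0 \<and>
     (\<forall>x\<in>cells A 0.
        (\<exists>!e. e \<in> cells A 1 \<and> sact A (vert 1 0) e = ibot A \<and> sact A (vert 1 1) e = x)) \<and>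
     (\<forall>x\<in>cells A 0.
        (\<exists>!e. e \<in> cells A 1 \<and> sact A (vert 1 0) e = x \<and> sact A (vert 1 1) e = itop A))"

definition stretched :: "'x interval \<Rightarrow> 'y interval \<Rightarrow> (nat \<Rightarrow> 'x \<Rightarrow> 'y) \<Rightarrow> bool" where
  "stretched A B F \<longleftrightarrow> smap A B F \<and> F 0 (ibot A) = ibot B \<and> F 0 (itop A) = itop B"

definition std_simplex :: "nat \<Rightarrow> simplex_map interval" where
  "std_simplex n =
     \<lparr>cells = \<lambda>k. {\<sigma>. dsrc \<sigma> = k \<and> dtgt \<sigma> = n},
      sact = \<lambda>p. \<lambda>\<sigma>\<in>{\<sigma>. dsrc \<sigma> = dtgt p \<and> dtgt \<sigma> = n}. \<sigma> \<odot> p,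
      ibot = vert n 0,
      itop = vert n n\<rparr>"

definition std_map :: "simplex_map \<Rightarrow> nat \<Rightarrow> simplex_map \<Rightarrow> simplex_map" where
  "std_map p k = (\<lambda>\<sigma>\<in>cells (std_simplex (dsrc p)) k. p \<odot> \<sigma>)"


section \<open>The pseudo-simplicial groupoid of subdivided discrete algebraic intervals\<close>

text \<open>Pseudofunctors from the opposite of the simplex category to groupoids which are strict on
  identities: \<open>pcoh U q p x\<close> is the coherence isomorphism
  \<open>p\<^sup>* (q\<^sup>* x) \<rightarrow> (q \<odot> p)\<^sup>* x\<close>.\<close>

record ('p, 'b) psgpd =
  plev :: "nat \<Rightarrow> ('p, 'b) gpd"
  pact :: "simplex_map \<Rightarrow> ('p, 'b, 'p, 'b) ftr"
  pcoh :: "simplex_map \<Rightarrow> simplex_map \<Rightarrow> 'p \<Rightarrow> 'b"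

text \<open>The simplices of all intervals are elements of one type \<open>'u\<close>, which plays the role of the
  universe of small sets.  An object \<open>(A, a)\<close> of \<open>U\<^sub>n\<close> is a stretched map
  \<open>a : \<Delta>\<^sup>n \<rightarrow> A\<close>; an arrow carries its source and target.\<close>

type_synonym 'u subdiv = "'u interval \<times> (nat \<Rightarrow> simplex_map \<Rightarrow> 'u)"
type_synonym 'u subdiv_arrow = "'u subdiv \<times> 'u subdiv \<times> (nat \<Rightarrow> 'u \<Rightarrow> 'u)"

definition U_ob :: "nat \<Rightarrow> 'u subdiv set" where
  "U_ob n = {(A, a). discrete_algebraic_interval A \<and> stretched (std_simplex n) A a}"

definition U_ar :: "nat \<Rightarrow> 'u subdiv_arrow set" where
  "U_ar n = {((A, a), (B, b), F).
     (A, a) \<in> U_ob n \<and> (B, b) \<in> U_ob n \<and> siso A B F \<and> scomp (std_simplex n) F a = b}"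

definition U_lev :: "nat \<Rightarrow> ('u subdiv, 'u subdiv_arrow) gpd" where
  "U_lev n =
     \<lparr>Ob = U_ob n,
      Ar = U_ar n,
      src = \<lambda>(x, y, F). x,
      tgt = \<lambda>(x, y, F). y,
      idn = \<lambda>x. (x, x, sid (fst x)),
      cmp = \<lambda>(y', z, G) (x, y, F). (x, z, scomp (fst x) G F)\<rparr>"

text \<open>\<open>ch p (A, a) = ((A', a'), i)\<close> is the chosen stretched-culf factorisation
  \<open>\<Delta>\<^sup>m \<rightarrow> A' \<rightarrow> A\<close> of \<open>a \<circ> p\<close>.\<close>

type_synonym 'u factorisations = "simplex_map \<Rightarrow> 'u subdiv \<Rightarrow> 'u subdiv \<times> (nat \<Rightarrow> 'u \<Rightarrow> 'u)"

definition factorisation_choice :: "'u factorisations \<Rightarrow> bool" where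
  "factorisation_choice ch \<longleftrightarrow>
     (\<forall>p A a A' a' i. (A, a) \<in> U_ob (dtgt p) \<and> ch p (A, a) = ((A', a'), i) \<longrightarrow>
        (A', a') \<in> U_ob (dsrc p) \<and>
        strict_culf A' A i \<and>
        scomp (std_simplex (dsrc p)) i a' = scomp (std_simplex (dsrc p)) a (std_map p) \<and>
        (active p \<longrightarrow>
           A' = A \<and> a' = scomp (std_simplex (dsrc p)) a (std_map p) \<and> i = sid A))"

text \<open>The comparison isomorphism between two stretched-culf factorisations
  \<open>\<Delta>\<^sup>m \<rightarrow> A' \<rightarrow> B\<close> and \<open>\<Delta>\<^sup>m \<rightarrow> A'' \<rightarrow> B\<close> of one and the same map, as an arrow of \<open>U\<^sub>m\<close>.\<close>

definition comparison ::
    "nat \<Rightarrow> 'u subdiv \<Rightarrow> (nat \<Rightarrow> 'u \<Rightarrow> 'u) \<Rightarrow> 'u subdiv \<Rightarrow> (nat \<Rightarrow> 'u \<Rightarrow> 'u) \<Rightarrow> 'u subdiv_arrow" where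
  "comparison m x i y j =
     (x, y, THE G. siso (fst x) (fst y) G \<and>
        scomp (std_simplex m) G (snd x) = snd y \<and> scomp (fst x) j G = i)"

text \<open>On an arrow \<open>F : (A, a) \<rightarrow> (B, b)\<close>: with \<open>A' \<rightarrow> A\<close> and \<open>B' \<rightarrow> B\<close> the chosen culf parts, both
  \<open>\<Delta>\<^sup>m \<rightarrow> A' \<rightarrow> A \<rightarrow> B\<close> and \<open>\<Delta>\<^sup>m \<rightarrow> B' \<rightarrow> B\<close> are stretched-culf factorisations of \<open>b \<circ> p\<close>.\<close>

definition U_act ::
    "'u factorisations \<Rightarrow> simplex_map \<Rightarrow>
     ('u subdiv, 'u subdiv_arrow, 'u subdiv, 'u subdiv_arrow) ftr" where
  "U_act ch p =
     \<lparr>fob = \<lambda>x\<in>U_ob (dtgt p). fst (ch p x),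
      far = \<lambda>(x, y, F)\<in>U_ar (dtgt p).
        comparison (dsrc p)
          (fst (ch p x)) (scomp (fst (fst (ch p x))) F (snd (ch p x)))
          (fst (ch p y)) (snd (ch p y))\<rparr>"

definition U_coh ::
    "'u factorisations \<Rightarrow> simplex_map \<Rightarrow> simplex_map \<Rightarrow> 'u subdiv \<Rightarrow> 'u subdiv_arrow" where
  "U_coh ch q p x =
     (let (y, j) = ch q x; (z, i) = ch p y; (w, k) = ch (q \<odot> p) x
      in comparison (dsrc p) z (scomp (fst z) j i) w k)"

definition UU :: "'u factorisations \<Rightarrow> ('u subdiv, 'u subdiv_arrow) psgpd" where
  "UU ch = \<lparr>plev = U_lev, pact = U_act ch, pcoh = U_coh ch\<rparr>"


section \<open>Strict culf maps and modifications\<close>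

text \<open>\<open>cpt J n\<close> is the functor \<open>J\<^sub>n : X\<^sub>n \<rightarrow> U\<^sub>n\<close>, and for \<open>p : [m] \<rightarrow> [n]\<close> and \<open>x\<close> in \<open>X\<^sub>n\<close>,
  \<open>str J p x\<close> is the structure isomorphism \<open>p\<^sup>* (J\<^sub>n x) \<rightarrow> J\<^sub>m (p\<^sup>* x)\<close>.\<close>

record ('o, 'a, 'p, 'b) pnt =
  cpt :: "nat \<Rightarrow> ('o, 'a, 'p, 'b) ftr"
  str :: "simplex_map \<Rightarrow> 'o \<Rightarrow> 'b"

definition pseudonatural ::
    "('o, 'a) sgpd \<Rightarrow> ('p, 'b) psgpd \<Rightarrow> ('o, 'a, 'p, 'b) pnt \<Rightarrow> bool" where
  "pseudonatural X U J \<longleftrightarrow>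
     (\<forall>n. gfunctor (lev X n) (plev U n) (cpt J n)) \<and>
     (\<forall>p. str J p \<in> extensional (Ob (lev X (dtgt p)))) \<and>
     (\<forall>p. \<forall>x\<in>Ob (lev X (dtgt p)).
        arrow (plev U (dsrc p)) (str J p x)
          (fob (pact U p) (fob (cpt J (dtgt p)) x))
          (fob (cpt J (dsrc p)) (fob (act X p) x))) \<and>
     (\<forall>p. \<forall>\<alpha>\<in>Ar (lev X (dtgt p)).
        cmp (plev U (dsrc p)) (far (cpt J (dsrc p)) (far (act X p) \<alpha>))
          (str J p (src (lev X (dtgt p)) \<alpha>)) =
        cmp (plev U (dsrc p)) (str J p (tgt (lev X (dtgt p)) \<alpha>))
          (far (pact U p) (far (cpt J (dtgt p)) \<alpha>))) \<and>
     (\<forall>n. \<forall>x\<in>Ob (lev X n). str J (did n) x = idn (plev U n) (fob (cpt J n) x)) \<and>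
     (\<forall>p q. dtgt p = dsrc q \<longrightarrow> (\<forall>x\<in>Ob (lev X (dtgt q)).
        cmp (plev U (dsrc p)) (str J (q \<odot> p) x) (pcoh U q p (fob (cpt J (dtgt q)) x)) =
        cmp (plev U (dsrc p)) (str J p (fob (act X q) x)) (far (pact U p) (str J q x))))"

definition strict_culf_map ::
    "('o, 'a) sgpd \<Rightarrow> ('p, 'b) psgpd \<Rightarrow> ('o, 'a, 'p, 'b) pnt \<Rightarrow> bool" where
  "strict_culf_map X U J \<longleftrightarrow>
     pseudonatural X U J \<and>
     (\<forall>p. active p \<longrightarrow>
        (\<forall>x\<in>Ob (lev X (dtgt p)).
           str J p x = idn (plev U (dsrc p)) (fob (cpt J (dsrc p)) (fob (act X p) x))) \<and>
        strict_pullback (lev X (dtgt p)) (lev X (dsrc p)) (plev U (dtgt p))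
          (act X p) (cpt J (dtgt p)) (cpt J (dsrc p)) (pact U p))"

definition modification ::
    "('o, 'a) sgpd \<Rightarrow> ('p, 'b) psgpd \<Rightarrow> ('o, 'a, 'p, 'b) pnt \<Rightarrow> ('o, 'a, 'p, 'b) pnt \<Rightarrow>
     (nat \<Rightarrow> 'o \<Rightarrow> 'b) \<Rightarrow> bool" where
  "modification X U J J' \<Gamma> \<longleftrightarrow>
     (\<forall>n. \<Gamma> n \<in> extensional (Ob (lev X n))) \<and>
     (\<forall>n. \<forall>x\<in>Ob (lev X n). arrow (plev U n) (\<Gamma> n x) (fob (cpt J n) x) (fob (cpt J' n) x)) \<and>
     (\<forall>n. \<forall>\<alpha>\<in>Ar (lev X n).
        cmp (plev U n) (far (cpt J' n) \<alpha>) (\<Gamma> n (src (lev X n) \<alpha>)) =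
        cmp (plev U n) (\<Gamma> n (tgt (lev X n) \<alpha>)) (far (cpt J n) \<alpha>)) \<and>
     (\<forall>p. \<forall>x\<in>Ob (lev X (dtgt p)).
        cmp (plev U (dsrc p)) (\<Gamma> (dsrc p) (fob (act X p) x)) (str J p x) =
        cmp (plev U (dsrc p)) (str J' p x) (far (pact U p) (\<Gamma> (dtgt p) x)))"

definition id_mod ::
    "('o, 'a) sgpd \<Rightarrow> ('p, 'b) psgpd \<Rightarrow> ('o, 'a, 'p, 'b) pnt \<Rightarrow> nat \<Rightarrow> 'o \<Rightarrow> 'b" where
  "id_mod X U J n = (\<lambda>x\<in>Ob (lev X n). idn (plev U n) (fob (cpt J n) x))"

definition comp_mod ::
    "('o, 'a) sgpd \<Rightarrow> ('p, 'b) psgpd \<Rightarrow> (nat \<Rightarrow> 'o \<Rightarrow> 'b) \<Rightarrow> (nat \<Rightarrow> 'o \<Rightarrow> 'b) \<Rightarrow> nat \<Rightarrow> 'o \<Rightarrow> 'b" where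
  "comp_mod X U \<Delta> \<Gamma> n = (\<lambda>x\<in>Ob (lev X n). cmp (plev U n) (\<Delta> n x) (\<Gamma> n x))"

definition invertible_modification ::
    "('o, 'a) sgpd \<Rightarrow> ('p, 'b) psgpd \<Rightarrow> ('o, 'a, 'p, 'b) pnt \<Rightarrow> ('o, 'a, 'p, 'b) pnt \<Rightarrow>
     (nat \<Rightarrow> 'o \<Rightarrow> 'b) \<Rightarrow> bool" where
  "invertible_modification X U J J' \<Gamma> \<longleftrightarrow>
     modification X U J J' \<Gamma> \<and>
     (\<exists>\<Delta>. modification X U J' J \<Delta> \<and>
        comp_mod X U \<Delta> \<Gamma> = id_mod X U J \<and> comp_mod X U \<Gamma> \<Delta> = id_mod X U J')"

definition map_gpd ::
    "('o, 'a) sgpd \<Rightarrow> ('p, 'b) psgpd \<Rightarrow>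
     (('o, 'a, 'p, 'b) pnt,
      ('o, 'a, 'p, 'b) pnt \<times> ('o, 'a, 'p, 'b) pnt \<times> (nat \<Rightarrow> 'o \<Rightarrow> 'b)) gpd" where
  "map_gpd X U =
     \<lparr>Ob = {J. strict_culf_map X U J},
      Ar = {(J, J', \<Gamma>). strict_culf_map X U J \<and> strict_culf_map X U J' \<and>
              invertible_modification X U J J' \<Gamma>},
      src = \<lambda>(J, J', \<Gamma>). J,
      tgt = \<lambda>(J, J', \<Gamma>). J',
      idn = \<lambda>J. (J, J, id_mod X U J),
      cmp = \<lambda>(J', J'', \<Delta>) (J, K, \<Gamma>). (J, J'', comp_mod X U \<Delta> \<Gamma>)\<rparr>"


section \<open>The interval construction\<close>

text \<open>The strict fibre of \<open>X\<^sub>n\<^sub>+\<^sub>2 \<rightarrow> X\<^sub>1\<close> over \<open>f\<close> is a discrete groupoid for rigid \<open>X\<close>, so only its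
  set of objects is recorded.\<close>

definition I_cells :: "('u, 'a) sgpd \<Rightarrow> 'u \<Rightarrow> nat \<Rightarrow> 'u set" where
  "I_cells X f n = {x \<in> Ob (lev X (n + 2)). long_ob X (n + 2) x = f}"

definition I_int :: "('u, 'a) sgpd \<Rightarrow> 'u \<Rightarrow> 'u interval" where
  "I_int X f =
     \<lparr>cells = I_cells X f,
      sact = \<lambda>p. \<lambda>x\<in>I_cells X f (dtgt p). fob (act X (shift p)) x,
      ibot = fob (act X (codegen 1 0)) f,
      itop = fob (act X (codegen 1 1)) f\<rparr>"

text \<open>Simplicial maps from simplicial sets to \<open>X\<close> take values in objects; the map
  \<open>\<Delta>\<^sup>n \<rightarrow> X\<close> corresponding to an \<open>n\<close>-simplex \<open>x\<close> is \<open>simplex_as_map X n x\<close>.\<close>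

definition simplex_as_map :: "('u, 'a) sgpd \<Rightarrow> nat \<Rightarrow> 'u \<Rightarrow> nat \<Rightarrow> simplex_map \<Rightarrow> 'u" where
  "simplex_as_map X n x k = (\<lambda>\<sigma>\<in>cells (std_simplex n) k. fob (act X \<sigma>) x)"

definition M_map :: "('u, 'a) sgpd \<Rightarrow> 'u \<Rightarrow> nat \<Rightarrow> 'u \<Rightarrow> 'u" where
  "M_map X f n =
     (\<lambda>x\<in>I_cells X f n. fob (act X (coface n (n + 1))) (fob (act X (coface (n + 1) 0)) x))"

definition phi :: "('u, 'a) sgpd \<Rightarrow> nat \<Rightarrow> 'u \<Rightarrow> nat \<Rightarrow> simplex_map \<Rightarrow> 'u" where
  "phi X n x =
     (THE \<phi>. stretched (std_simplex n) (I_int X (long_ob X n x)) \<phi> \<and>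
        scomp (std_simplex n) (M_map X (long_ob X n x)) \<phi> = simplex_as_map X n x)"

definition I_ob :: "('u, 'a) sgpd \<Rightarrow> nat \<Rightarrow> 'u \<Rightarrow> 'u subdiv" where
  "I_ob X n x = (I_int X (long_ob X n x), phi X n x)"

text \<open>For an arrow \<open>\<beta> : f \<rightarrow> g\<close> of \<open>X\<^sub>1\<close>, a simplex \<open>y\<close> in the fibre over \<open>f\<close> is transported to the
  target of the unique lift of \<open>\<beta>\<close> with source \<open>y\<close>.\<close>

definition transport :: "('u, 'a) sgpd \<Rightarrow> 'a \<Rightarrow> nat \<Rightarrow> 'u \<Rightarrow> 'u" where
  "transport X \<beta> k =
     (\<lambda>y\<in>I_cells X (src (lev X 1) \<beta>) k.
        tgt (lev X (k + 2))
          (THE \<epsilon>. \<epsilon> \<in> Ar (lev X (k + 2)) \<and> src (lev X (k + 2)) \<epsilon> = y \<and>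
             long_ar X (k + 2) \<epsilon> = \<beta>))"

definition I_culf :: "('u, 'a) sgpd \<Rightarrow> simplex_map \<Rightarrow> 'u \<Rightarrow> nat \<Rightarrow> 'u \<Rightarrow> 'u" where
  "I_culf X p x =
     (let x' = fob (act X p) x; f' = long_ob X (dsrc p) x'; f = long_ob X (dtgt p) x
      in THE c. smap (I_int X f') (I_int X f) c \<and>
           scomp (std_simplex (dsrc p)) c (phi X (dsrc p) x') =
             scomp (std_simplex (dsrc p)) (phi X (dtgt p) x) (std_map p) \<and>
           scomp (I_int X f') (M_map X f) c = M_map X f')"

definition interval_construction ::
    "'u factorisations \<Rightarrow> ('u, 'a) sgpd \<Rightarrow> ('u, 'a, 'u subdiv, 'u subdiv_arrow) pnt" where
  "interval_construction ch X =
     \<lparr>cpt = \<lambda>n.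
        \<lparr>fob = \<lambda>x\<in>Ob (lev X n). I_ob X n x,
         far = \<lambda>\<alpha>\<in>Ar (lev X n).
           (I_ob X n (src (lev X n) \<alpha>), I_ob X n (tgt (lev X n) \<alpha>),
            transport X (long_ar X n \<alpha>))\<rparr>,
      str = \<lambda>p. \<lambda>x\<in>Ob (lev X (dtgt p)).
        (let (y, i) = ch p (I_ob X (dtgt p) x)
         in comparison (dsrc p) y i (I_ob X (dsrc p) (fob (act X p) x)) (I_culf X p x))\<rparr>"

end

theory Submission
  imports Defs
begin

text \<open>Let \<open>J : X \<rightarrow> U\<close> be strict culf and \<open>f \<in> X\<^sub>1\<close>, and let \<open>A\<close> be the interval underlying \<open>J f\<close>.
  As \<open>J\<close> is strict on active maps, every \<open>x \<in> X\<^sub>n\<close> with long edge \<open>f\<close> is sent to a subdivision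
  \<open>\<Delta>\<^sup>n \<rightarrow> A\<close> of the same \<open>A\<close>, and by the pullback condition for \<open>[1] \<rightarrow> [n]\<close> this is a bijection onto
  all stretched maps \<open>\<Delta>\<^sup>n \<rightarrow> A\<close>.  An \<open>n\<close>-simplex of \<open>I\<^sub>f\<close> is an \<open>(n+2)\<close>-simplex of \<open>X\<close> over \<open>f\<close>, hence a
  stretched map \<open>\<Delta>\<^sup>n\<^sup>+\<^sup>2 \<rightarrow> A\<close>; as \<open>\<bottom>\<close> is initial and \<open>\<top>\<close> is terminal, this is the same as its inner
  part, an arbitrary \<open>n\<close>-simplex of \<open>A\<close>.  So \<open>I\<^sub>f \<cong> A\<close>, compatibly with subdivisions and arrows.

  For compatibility with the structure isomorphisms one compares two culf maps \<open>I\<^sub>f\<^sub>' \<rightarrow> I\<^sub>f\<close>.  By the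
  decomposition property, a simplex of \<open>I\<^sub>f\<^sub>'\<close> over an edge \<open>f'\<close> of \<open>x\<close> extends uniquely to a simplex \<open>w\<close> of
  \<open>X\<close> that also records the parts of \<open>f\<close> before and after \<open>f'\<close>, and both maps are computed from \<open>w\<close>.\<close>

section \<open>Computing in the simplex category\<close>

text \<open>The obstacle is that \<open>J\<close> is rigid only on active maps: at an inert map its
  structure isomorphism is tied down by pseudonaturality alone, and the intervals of
  \<open>J\<close> come without maps to \<open>X\<close> that could single out a culf map. Hence the
  structure isomorphism at an arbitrary \<open>p\<close> is moved along active maps, where it is an
  identity, to an inert map at which its value on the simplex in question is known. Lifting against
  culf maps is done with cones: every simplex of an interval is the inner part of a unique simplex
  from bottom to top, and a culf lift of the latter is fixed by its long edge. So orthogonality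
  comes down to the choice of one edge. Unique lifts of arrows of \<open>X_1\<close> are used in all
  dimensions but assumed only for \<open>d_1\<close>; they are obtained by pasting. Objects and
  arrows of \<open>X\<close> are treated as two simplicial sets with the same pullback property, so
  that a construction made for simplices also applies to arrows between them. The isomorphism is
  constructed from \<open>I\<close> to \<open>J\<close> and then inverted.\<close>

lemma dmk_simps:
  assumes "\<And>i. i \<le> m \<Longrightarrow> f i \<le> n" and "\<And>i j. i \<le> j \<Longrightarrow> j \<le> m \<Longrightarrow> f i \<le> f j"
  shows "dsrc (dmk m n f) = m" "dtgt (dmk m n f) = n"
    "\<And>i. i \<le> m \<Longrightarrow> dapp (dmk m n f) i = f i"
  using Rep_dmk[OF assms] by (auto simp: dsrc_def dtgt_def dapp_def)

lemma Rep_simplex_map_eq: "Rep_simplex_map p = (dsrc p, dtgt p, dapp p)"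
  by (simp add: dsrc_def dtgt_def dapp_def)

lemma simplex_map_props: "dapp p \<in> {..dsrc p} \<rightarrow>\<^sub>E {..dtgt p}" "mono_on {..dsrc p} (dapp p)"
  using Rep_simplex_map[of p] by (auto simp: Rep_simplex_map_eq)

lemma dapp_le [simp]: "i \<le> dsrc p \<Longrightarrow> dapp p i \<le> dtgt p"
  using simplex_map_props(1)[of p] by auto

lemma dapp_le_trans [simp]: "i \<le> dsrc p \<Longrightarrow> dtgt p \<le> n \<Longrightarrow> dapp p i \<le> n"
  using dapp_le le_trans by blast

lemma dapp_mono: "i \<le> j \<Longrightarrow> j \<le> dsrc p \<Longrightarrow> dapp p i \<le> dapp p j"
  using simplex_map_props(2)[of p] by (auto simp: mono_on_def)

lemma simplex_map_eqI:
  assumes "dsrc p = dsrc q" "dtgt p = dtgt q" "\<And>i. i \<le> dsrc p \<Longrightarrow> dapp p i = dapp q i"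
  shows "p = q"
proof -
  have "dapp p = dapp q"
    by (rule extensionalityI[of _ "{..dsrc p}"])
      (use assms simplex_map_props(1)[of p] simplex_map_props(1)[of q] in \<open>auto simp: PiE_def\<close>)
  with assms show ?thesis
    by (metis Rep_simplex_map_eq Rep_simplex_map_inject)
qed

lemma dcomp_simps [simp]:
  assumes "dtgt p = dsrc q"
  shows "dsrc (q \<odot> p) = dsrc p" "dtgt (q \<odot> p) = dtgt q"
    "i \<le> dsrc p \<Longrightarrow> dapp (q \<odot> p) i = dapp q (dapp p i)"
proof -
  have 1: "\<And>i. i \<le> dsrc p \<Longrightarrow> dapp q (dapp p i) \<le> dtgt q"
    "\<And>i j. i \<le> j \<Longrightarrow> j \<le> dsrc p \<Longrightarrow> dapp q (dapp p i) \<le> dapp q (dapp p j)"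
    using assms dapp_le dapp_mono by metis+
  show "dsrc (q \<odot> p) = dsrc p" "dtgt (q \<odot> p) = dtgt q"
    "i \<le> dsrc p \<Longrightarrow> dapp (q \<odot> p) i = dapp q (dapp p i)"
    unfolding dcomp_def using dmk_simps[of "dsrc p" "\<lambda>i. dapp q (dapp p i)" "dtgt q", OF 1] by auto
qed

lemma did_simps [simp]: "dsrc (did n) = n" "dtgt (did n) = n" "i \<le> n \<Longrightarrow> dapp (did n) i = i"
  unfolding did_def by (rule dmk_simps; simp)+

lemma vert_simps [simp]:
  assumes "i \<le> n"
  shows "dsrc (vert n i) = 0" "dtgt (vert n i) = n" "dapp (vert n i) 0 = i"
  unfolding vert_def by (rule dmk_simps; use assms in simp)+

lemma spine_edge_simps [simp]:
  assumes "i + 1 \<le> n"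
  shows "dsrc (spine_edge n i) = 1" "dtgt (spine_edge n i) = n"
    "j \<le> 1 \<Longrightarrow> dapp (spine_edge n i) j = i + j"
  unfolding spine_edge_def by (rule dmk_simps; use assms in auto)+

lemma dlong_simps [simp]:
  "dsrc (dlong n) = 1" "dtgt (dlong n) = n"
  "dapp (dlong n) 0 = 0" "j = 1 \<Longrightarrow> dapp (dlong n) j = n"
  unfolding dlong_def by (subst dmk_simps; auto)+

lemma coface_simps [simp]:
  assumes "i \<le> n + 1"
  shows "dsrc (coface n i) = n" "dtgt (coface n i) = n + 1"
    "j \<le> n \<Longrightarrow> dapp (coface n i) j = (if j < i then j else j + 1)"
  unfolding coface_def by (rule dmk_simps; use assms in auto)+

lemma codegen_simps [simp]:
  assumes "i \<le> n"
  shows "dsrc (codegen n i) = n + 1" "dtgt (codegen n i) = n"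
    "j \<le> n + 1 \<Longrightarrow> dapp (codegen n i) j = (if j \<le> i then j else j - 1)"
  unfolding codegen_def by (rule dmk_simps; use assms in auto)+

lemma shift_simps [simp]:
  "dsrc (shift p) = dsrc p + 2" "dtgt (shift p) = dtgt p + 2"
  "i \<le> dsrc p + 2 \<Longrightarrow> dapp (shift p) i =
     (if i = 0 then 0 else if i \<le> dsrc p + 1 then dapp p (i - 1) + 1 else dtgt p + 2)"
proof -
  let ?f = "\<lambda>i. if i = 0 then 0 else if i \<le> dsrc p + 1 then dapp p (i - 1) + 1 else dtgt p + 2"
  have 1: "?f i \<le> dtgt p + 2" if "i \<le> dsrc p + 2" for i
    using dapp_le[of "i - 1" p] that by auto
  have 2: "?f i \<le> ?f j" if "i \<le> j" "j \<le> dsrc p + 2" for i j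
    using dapp_mono[of "i - 1" "j - 1" p] dapp_le[of "i - 1" p] that by auto
  show "dsrc (shift p) = dsrc p + 2" "dtgt (shift p) = dtgt p + 2"
    "i \<le> dsrc p + 2 \<Longrightarrow> dapp (shift p) i = ?f i"
    unfolding shift_def
    using dmk_simps[of "dsrc p + 2" ?f "dtgt p + 2", OF 1 2] by auto
qed

section \<open>Inert inclusions and maps extended by outer points\<close>

definition incl :: "nat \<Rightarrow> nat \<Rightarrow> nat \<Rightarrow> simplex_map" where
  "incl l n s = dmk n (l + n + s) (\<lambda>i. l + i)"

lemma incl_simps [simp]:
  "dsrc (incl l n s) = n" "dtgt (incl l n s) = l + n + s" "i \<le> n \<Longrightarrow> dapp (incl l n s) i = l + i"
  unfolding incl_def by (rule dmk_simps; auto)+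

text \<open>A natural transformation from the identity to \<open>shift\<close>. Restriction along it
  is \<open>d_top d_bot\<close>, the formula for the projection from an interval to
  \<open>X\<close>.\<close>

definition iota :: "nat \<Rightarrow> simplex_map" where
  "iota n = dmk n (n + 2) (\<lambda>i. i + 1)"

lemma iota_simps [simp]:
  "dsrc (iota n) = n" "dtgt (iota n) = n + 2" "i \<le> n \<Longrightarrow> dapp (iota n) i = i + 1"
  unfolding iota_def by (rule dmk_simps; auto)+

text \<open>The pushout of an active \<open>a\<close> along \<open>incl l (dsrc a) s\<close>: only
  the middle block is changed by \<open>a\<close>, the \<open>l\<close> points below and the
  \<open>s\<close> points above it are kept. For \<open>l = s = 1\<close> it is
  \<open>shift a\<close>.\<close>

definition glue :: "nat \<Rightarrow> nat \<Rightarrow> simplex_map \<Rightarrow> simplex_map" where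
  "glue l s a = dmk (l + dsrc a + s) (l + dtgt a + s)
     (\<lambda>i. if i < l then i else if i \<le> l + dsrc a then l + dapp a (i - l) else i - dsrc a + dtgt a)"

lemma glue_simps [simp]:
  "dsrc (glue l s a) = l + dsrc a + s" "dtgt (glue l s a) = l + dtgt a + s"
  "i \<le> l + dsrc a + s \<Longrightarrow> dapp (glue l s a) i =
     (if i < l then i else if i \<le> l + dsrc a then l + dapp a (i - l) else i - dsrc a + dtgt a)"
proof -
  let ?f = "\<lambda>i. if i < l then i else if i \<le> l + dsrc a then l + dapp a (i - l)
    else i - dsrc a + dtgt a"
  have 1: "?f i \<le> l + dtgt a + s" if "i \<le> l + dsrc a + s" for i
    using dapp_le[of "i - l" a] that by auto
  have 2: "?f i \<le> ?f j" if "i \<le> j" "j \<le> l + dsrc a + s" for i j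
  proof -
    have 1: "dapp a (i - l) \<le> dapp a (j - l)" if "j \<le> l + dsrc a"
      using that \<open>i \<le> j\<close> by (intro dapp_mono) auto
    have 2: "l + dapp a (i - l) \<le> j - dsrc a + dtgt a" if "i \<le> l + dsrc a" "l + dsrc a < j"
    proof -
      have "dapp a (i - l) \<le> dtgt a" using that by simp
      moreover have "l \<le> j - dsrc a" using that by simp
      ultimately show ?thesis by simp
    qed
    show ?thesis
    proof (cases "j \<le> l + dsrc a")
      case True
      then show ?thesis using 1 \<open>i \<le> j\<close> by auto
    next
      case False
      then show ?thesis using 2 \<open>i \<le> j\<close> by auto
    qed
  qed
  show "dsrc (glue l s a) = l + dsrc a + s" "dtgt (glue l s a) = l + dtgt a + s"
    "i \<le> l + dsrc a + s \<Longrightarrow> dapp (glue l s a) i = ?f i"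
    unfolding glue_def
    using dmk_simps[of "l + dsrc a + s" ?f "l + dtgt a + s", OF 1 2] by auto
qed

text \<open>An active replacement of \<sigma>. In the standard simplex it is the cone over \<sigma>;
  restricting a simplex \<open>x\<close> along it gives the value at \<sigma> of the stretched map
  from the standard simplex to the interval of the long edge of \<open>x\<close>.\<close>

definition extend :: "simplex_map \<Rightarrow> simplex_map" where
  "extend \<sigma> = dmk (dsrc \<sigma> + 2) (dtgt \<sigma>)
     (\<lambda>i. if i = 0 then 0 else if i \<le> dsrc \<sigma> + 1 then dapp \<sigma> (i - 1) else dtgt \<sigma>)"

lemma extend_simps [simp]:
  "dsrc (extend \<sigma>) = dsrc \<sigma> + 2" "dtgt (extend \<sigma>) = dtgt \<sigma>"
  "i \<le> dsrc \<sigma> + 2 \<Longrightarrow> dapp (extend \<sigma>) i =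
     (if i = 0 then 0 else if i \<le> dsrc \<sigma> + 1 then dapp \<sigma> (i - 1) else dtgt \<sigma>)"
proof -
  let ?f = "\<lambda>i. if i = 0 then 0 else if i \<le> dsrc \<sigma> + 1 then dapp \<sigma> (i - 1) else dtgt \<sigma>"
  have 1: "?f i \<le> dtgt \<sigma>" if "i \<le> dsrc \<sigma> + 2" for i
    using dapp_le[of "i - 1" \<sigma>] that by auto
  have 2: "?f i \<le> ?f j" if "i \<le> j" "j \<le> dsrc \<sigma> + 2" for i j
    using dapp_mono[of "i - 1" "j - 1" \<sigma>] dapp_le[of "i - 1" \<sigma>] that by auto
  show "dsrc (extend \<sigma>) = dsrc \<sigma> + 2" "dtgt (extend \<sigma>) = dtgt \<sigma>"
    "i \<le> dsrc \<sigma> + 2 \<Longrightarrow> dapp (extend \<sigma>) i = ?f i"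
    unfolding extend_def
    using dmk_simps[of "dsrc \<sigma> + 2" ?f "dtgt \<sigma>", OF 1 2] by auto
qed

lemma active_simps [simp]: "active (did n)" "active (dlong n)" "active (shift p)" "active (extend p)"
  by (auto simp: active_def)

lemma active_dcomp [simp]: "dtgt p = dsrc q \<Longrightarrow> active p \<Longrightarrow> active q \<Longrightarrow> active (q \<odot> p)"
  by (simp add: active_def)

lemma active_glue: "active a \<Longrightarrow> active (glue l s a)"
  by (auto simp: active_def)

section \<open>Composition identities\<close>

lemma dcomp_assoc:
  "dtgt p = dsrc q \<Longrightarrow> dtgt q = dsrc r \<Longrightarrow> (r \<odot> q) \<odot> p = r \<odot> (q \<odot> p)"
  by (rule simplex_map_eqI) auto

lemma did_dcomp [simp]: "dtgt p = n \<Longrightarrow> did n \<odot> p = p" "dsrc p = n \<Longrightarrow> p \<odot> did n = p"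
  by (rule simplex_map_eqI; auto)+

lemma active_dlong: "active p \<Longrightarrow> p \<odot> dlong (dsrc p) = dlong (dtgt p)"
  by (rule simplex_map_eqI) (auto simp: active_def le_Suc_eq)

lemma dlong_1: "dlong 1 = did 1"
  by (rule simplex_map_eqI) (auto simp: le_Suc_eq)

lemma ext_iota: "extend \<sigma> \<odot> iota (dsrc \<sigma>) = \<sigma>"
  by (rule simplex_map_eqI) auto

lemma ext_shift: "dtgt r = dsrc \<sigma> \<Longrightarrow> extend \<sigma> \<odot> shift r = extend (\<sigma> \<odot> r)"
  by (rule simplex_map_eqI) auto

lemma active_dcomp_ext: "active p \<Longrightarrow> dtgt \<sigma> = dsrc p \<Longrightarrow> p \<odot> extend \<sigma> = extend (p \<odot> \<sigma>)"
  by (rule simplex_map_eqI) (auto simp: active_def)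

lemma shift_iota: "shift r \<odot> iota (dsrc r) = iota (dtgt r) \<odot> r"
  by (rule simplex_map_eqI) auto

lemma shift_dcomp: "dtgt p = dsrc q \<Longrightarrow> shift (q \<odot> p) = shift q \<odot> shift p"
  by (rule simplex_map_eqI) auto

lemma shift_did: "shift (did n) = did (n + 2)"
  by (rule simplex_map_eqI) auto

lemma iota_eq_coface: "iota n = coface (n + 1) 0 \<odot> coface n (n + 1)"
  by (rule simplex_map_eqI) auto

lemma glue_1_1: "glue 1 1 a = shift a"
  by (rule simplex_map_eqI) (auto simp: le_Suc_eq)

lemma incl_1_1: "incl 1 n 1 = iota n"
  by (rule simplex_map_eqI) auto

lemma inert_incl: "inert (incl l n s)"
  by (simp add: inert_def)

text \<open>Since \<open>a\<close> keeps both end points, \<open>u\<close> and \<open>v\<close>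
  agree at the two ends of the middle block and paste to one monotone map. It is unique because the
  images of \<open>glue\<close> and \<open>incl\<close> together exhaust the target.\<close>

lemma is_pushout_glue:
  assumes "active a"
  shows "is_pushout a (incl l (dsrc a) s) (glue l s a) (incl l (dtgt a) s)"
  unfolding is_pushout_def
proof (intro conjI allI impI)
  let ?m = "dsrc a" and ?n = "dtgt a"
  have a0: "dapp a 0 = 0" and a1: "dapp a ?m = ?n"
    using assms by (auto simp: active_def)
  show "dsrc a = dsrc (incl l ?m s)" "dsrc (glue l s a) = dtgt (incl l ?m s)"
    "dsrc (incl l ?n s) = dtgt a" "dtgt (glue l s a) = dtgt (incl l ?n s)" by auto
  show "glue l s a \<odot> incl l ?m s = incl l ?n s \<odot> a"
    by (rule simplex_map_eqI) auto
  fix u v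
  assume *: "dsrc u = dtgt (incl l ?m s) \<and> dsrc v = dtgt a \<and> dtgt u = dtgt v
    \<and> u \<odot> incl l ?m s = v \<odot> a"
  let ?N = "dtgt u"
  have su: "dsrc u = l + ?m + s" and sv: "dsrc v = ?n" and tv: "dtgt v = ?N" using * by auto
  have uv: "dapp u (l + i) = dapp v (dapp a i)" if "i \<le> ?m" for i
  proof -
    have "dapp u (l + i) = dapp (u \<odot> incl l ?m s) i" using that su by simp
    also have "\<dots> = dapp (v \<odot> a) i" using * by metis
    also have "\<dots> = dapp v (dapp a i)" using that sv by simp
    finally show ?thesis .
  qed
  \<comment> \<open>Inside the middle block the values come from \<open>v\<close>, outside from
    \<open>u\<close>; above the block the index moves back by the change of its length from
    \<open>?m\<close> to \<open>?n\<close>.\<close>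
  define g where "g i = (if i < l then dapp u i else if i \<le> l + ?n then dapp v (i - l)
      else dapp u (i - ?n + ?m))" for i
  have uvl: "dapp u l = dapp v 0" using uv[of 0] a0 by simp
  have uvr: "dapp u (l + ?m) = dapp v ?n" using uv[of ?m] a1 by simp
  have g1: "g i \<le> ?N" if "i \<le> l + ?n + s" for i
    using dapp_le[of i u] dapp_le[of "i - l" v] dapp_le[of "i - ?n + ?m" u] that
    by (auto simp: g_def su sv tv)
  have g2: "g i \<le> g j" if "i \<le> j" "j \<le> l + ?n + s" for i j
  proof -
    have ll: "dapp u i \<le> dapp v 0" if "i < l" for i
      using dapp_mono[of i l u] that su uvl by simp
    have rr: "dapp v ?n \<le> dapp u (j - ?n + ?m)" if "l + ?n < j" "j \<le> l + ?n + s" for j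
      using dapp_mono[of "l + ?m" "j - ?n + ?m" u] that su uvr by simp
    have vm: "dapp v 0 \<le> dapp v k" "dapp v k \<le> dapp v ?n" if "k \<le> ?n" for k
      using dapp_mono[of 0 k v] dapp_mono[of k ?n v] that sv by auto
    consider "j < l" | "i < l" "l \<le> j" "j \<le> l + ?n" | "i < l" "l + ?n < j"
      | "l \<le> i" "j \<le> l + ?n" | "l \<le> i" "i \<le> l + ?n" "l + ?n < j" | "l + ?n < i" by linarith
    then show ?thesis
    proof cases
      case 1 then show ?thesis using that dapp_mono[of i j u] su by (auto simp: g_def)
    next
      case 2 then have "dapp u i \<le> dapp v 0" "dapp v 0 \<le> dapp v (j - l)"
        using ll vm(1)[of "j - l"] by auto
      with 2 show ?thesis by (simp add: g_def)
    next
      case 3 then show ?thesis using ll[of i] vm(2)[of 0] rr[of j] that by (auto simp: g_def)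
    next
      case 4 then show ?thesis using dapp_mono[of "i - l" "j - l" v] that sv by (auto simp: g_def)
    next
      case 5 then have "dapp v (i - l) \<le> dapp v ?n" "dapp v ?n \<le> dapp u (j - ?n + ?m)"
        using rr vm(2)[of "i - l"] that by auto
      with 5 show ?thesis by (simp add: g_def)
    next
      case 6 then show ?thesis using dapp_mono[of "i - ?n + ?m" "j - ?n + ?m" u] that su
        by (auto simp: g_def)
    qed
  qed
  define w where "w = dmk (l + ?n + s) ?N g"
  have w: "dsrc w = l + ?n + s" "dtgt w = ?N" "\<And>i. i \<le> l + ?n + s \<Longrightarrow> dapp w i = g i"
    unfolding w_def using dmk_simps[of "l + ?n + s" g ?N, OF g1 g2] by auto
  have wu: "w \<odot> glue l s a = u"
  proof (rule simplex_map_eqI)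
    show "dsrc (w \<odot> glue l s a) = dsrc u" "dtgt (w \<odot> glue l s a) = dtgt u" using w su by auto
    fix i assume "i \<le> dsrc (w \<odot> glue l s a)"
    then have i: "i \<le> l + ?m + s" using w by simp
    consider "i < l" | "l \<le> i" "i \<le> l + ?m" | "l + ?m < i" by linarith
    then show "dapp (w \<odot> glue l s a) i = dapp u i"
    proof cases
      case 1 then show ?thesis using w i by (simp add: g_def)
    next
      case 2
      have "dapp a (i - l) \<le> ?n" using 2 by simp
      then show ?thesis using 2 w i uv[of "i - l"] by (simp add: g_def)
    next
      case 3
      then have "\<not> i - ?m + ?n < l" "\<not> i - ?m + ?n \<le> l + ?n" "i - ?m + ?n - ?n + ?m = i" by auto
      then show ?thesis using 3 w i by (simp add: g_def)
    qed
  qed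
  have wv: "w \<odot> incl l ?n s = v"
    by (rule simplex_map_eqI) (use w sv tv in \<open>auto simp: g_def\<close>)
  show "\<exists>!w. dsrc w = dtgt (glue l s a) \<and> dtgt w = dtgt u \<and> w \<odot> glue l s a = u \<and> w \<odot> incl l ?n s = v"
  proof (rule ex1I[of _ w], intro conjI)
    show "dsrc w = dtgt (glue l s a)" "dtgt w = dtgt u" using w by auto
    show "w \<odot> glue l s a = u" "w \<odot> incl l ?n s = v" by fact+
    fix z assume z: "dsrc z = dtgt (glue l s a) \<and> dtgt z = dtgt u \<and> z \<odot> glue l s a = u
      \<and> z \<odot> incl l ?n s = v"
    show "z = w"
    proof (rule simplex_map_eqI)
      show "dsrc z = dsrc w" "dtgt z = dtgt w" using z w by auto
      fix i assume "i \<le> dsrc z"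
      then have i: "i \<le> l + ?n + s" using z by simp
      have zu: "dapp z (dapp (glue l s a) k) = dapp u k" if "k \<le> l + ?m + s" for k
        using dcomp_simps(3)[of "glue l s a" z k] z that by simp
      have zv: "dapp z (l + k) = dapp v k" if "k \<le> ?n" for k
        using dcomp_simps(3)[of "incl l ?n s" z k] z that by simp
      consider "i < l" | "l \<le> i" "i \<le> l + ?n" | "l + ?n < i" by linarith
      then show "dapp z i = dapp w i"
      proof cases
        case 1 then show ?thesis using w i zu[of i] by (simp add: g_def)
      next
        case 2 then show ?thesis using w i zv[of "i - l"] by (simp add: g_def)
      next
        case 3
        then have "dapp (glue l s a) (i - ?n + ?m) = i" using i by auto
        then show ?thesis using 3 w i zu[of "i - ?n + ?m"] by (simp add: g_def)
      qed
    qed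
  qed
qed

section \<open>Simplicial sets\<close>

lemma sact_in:
  "sset A \<Longrightarrow> x \<in> cells A n \<Longrightarrow> dtgt p = n \<Longrightarrow> m = dsrc p \<Longrightarrow> sact A p x \<in> cells A m"
  unfolding sset_def by blast

lemma sact_did: "sset A \<Longrightarrow> x \<in> cells A n \<Longrightarrow> sact A (did n) x = x"
  unfolding sset_def by simp

lemma sact_sact:
  "sset A \<Longrightarrow> x \<in> cells A (dtgt q) \<Longrightarrow> dtgt p = dsrc q \<Longrightarrow> sact A p (sact A q x) = sact A (q \<odot> p) x"
  unfolding sset_def by (simp add: compose_def)

lemma smap_in: "smap A B F \<Longrightarrow> x \<in> cells A n \<Longrightarrow> F n x \<in> cells B n"
  unfolding smap_def by blast

lemma smap_sact:
  "smap A B F \<Longrightarrow> x \<in> cells A n \<Longrightarrow> dtgt p = n \<Longrightarrow> dsrc p = m \<Longrightarrow> F m (sact A p x) = sact B p (F n x)"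
  unfolding smap_def by blast

lemma smap_ext: "smap A B F \<Longrightarrow> F n \<in> extensional (cells A n)"
  unfolding smap_def by (auto simp: PiE_def)

lemma smap_eqI:
  assumes "smap A B F" "smap A C G" "\<And>n x. x \<in> cells A n \<Longrightarrow> F n x = G n x"
  shows "F = G"
proof
  fix n show "F n = G n"
    by (rule extensionalityI[of _ "cells A n"]) (use assms smap_ext in auto)
qed

lemma smapI:
  assumes "\<And>n. F n \<in> extensional (cells A n)" "\<And>n x. x \<in> cells A n \<Longrightarrow> F n x \<in> cells B n"
    "\<And>p x. x \<in> cells A (dtgt p) \<Longrightarrow> F (dsrc p) (sact A p x) = sact B p (F (dtgt p) x)"
  shows "smap A B F"
  using assms unfolding smap_def by (auto simp: PiE_def)

lemma scomp_app [simp]: "x \<in> cells A n \<Longrightarrow> scomp A G F n x = G n (F n x)"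
  by (simp add: scomp_def compose_def)

lemma sid_app [simp]: "x \<in> cells A n \<Longrightarrow> sid A n x = x"
  by (simp add: sid_def)

lemma scomp_ext: "scomp A G F n \<in> extensional (cells A n)"
  by (simp add: scomp_def compose_def)

lemma smap_sid: "sset A \<Longrightarrow> smap A A (sid A)"
  by (rule smapI) (auto simp: sid_def sact_in)

lemma smap_scomp: "sset A \<Longrightarrow> smap A B F \<Longrightarrow> smap B C G \<Longrightarrow> smap A C (scomp A G F)"
  by (rule smapI) (auto simp: scomp_ext smap_in smap_sact sact_in)

lemma scomp_assoc: "smap A B F \<Longrightarrow> scomp A H (scomp A G F) = scomp A (scomp B H G) F"
  by (rule ext, rule extensionalityI[OF scomp_ext scomp_ext]) (simp add: smap_in)

lemma scomp_sid_left: "smap A B F \<Longrightarrow> scomp A (sid B) F = F"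
  by (rule ext, rule extensionalityI[OF scomp_ext]) (auto simp: smap_in smap_ext)

lemma scomp_sid_right: "smap A B F \<Longrightarrow> scomp A F (sid A) = F"
  by (rule ext, rule extensionalityI[OF scomp_ext]) (auto simp: smap_in smap_ext)

lemma scomp_cong_app: "scomp A G F = scomp A H K \<Longrightarrow> x \<in> cells A n \<Longrightarrow> G n (F n x) = H n (K n x)"
  by (metis scomp_app)

lemma scomp_eq_app: "scomp A G F = K \<Longrightarrow> x \<in> cells A n \<Longrightarrow> G n (F n x) = K n x"
  by (metis scomp_app)

lemma sisoD: "siso A B F \<Longrightarrow> smap A B F" by (simp add: siso_def)

lemma siso_sid: "sset A \<Longrightarrow> siso A A (sid A)"
  unfolding siso_def using smap_sid scomp_sid_left by blast

lemma siso_scomp: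
  assumes "sset A" "sset B" "sset C" "siso A B F" "siso B C G"
  shows "siso A C (scomp A G F)"
proof -
  obtain F' G' where F: "smap A B F" "smap B A F'" "scomp A F' F = sid A" "scomp B F F' = sid B"
    and G: "smap B C G" "smap C B G'" "scomp B G' G = sid B" "scomp C G G' = sid C"
    using assms(4,5) unfolding siso_def by metis
  have *: "scomp A (scomp C F' G') (scomp A G F) = sid A"
  proof (rule smap_eqI)
    show "smap A A (scomp A (scomp C F' G') (scomp A G F))" "smap A A (sid A)"
      using F G assms by (auto intro!: smap_scomp smap_sid)
    fix n x assume x: "x \<in> cells A n"
    have "F n x \<in> cells B n" using F x by (simp add: smap_in)
    then show "scomp A (scomp C F' G') (scomp A G F) n x = sid A n x"
      using scomp_eq_app[OF F(3) x] scomp_eq_app[OF G(3), of "F n x" n] x F G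
      by (simp add: smap_in)
  qed
  have **: "scomp C (scomp A G F) (scomp C F' G') = sid C"
  proof (rule smap_eqI)
    show "smap C C (scomp C (scomp A G F) (scomp C F' G'))" "smap C C (sid C)"
      using F G assms by (auto intro!: smap_scomp smap_sid)
    fix n x assume x: "x \<in> cells C n"
    have "G' n x \<in> cells B n" using G x by (simp add: smap_in)
    then show "scomp C (scomp A G F) (scomp C F' G') n x = sid C n x"
      using scomp_eq_app[OF G(4) x] scomp_eq_app[OF F(4), of "G' n x" n] x F G
      by (simp add: smap_in)
  qed
  have "smap A C (scomp A G F)" "smap C A (scomp C F' G')"
    using F G assms smap_scomp by blast+
  then show ?thesis unfolding siso_def using * ** by blast
qed

lemma siso_bijI:
  assumes A: "sset A" and B: "sset B" and F: "smap A B F"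
    and bij: "\<And>n. bij_betw (F n) (cells A n) (cells B n)"
  shows "siso A B F"
proof -
  define G where "G n = (\<lambda>y\<in>cells B n. inv_into (cells A n) (F n) y)" for n
  have GF: "G n (F n x) = x" if "x \<in> cells A n" for n x
    using that bij[of n] smap_in[OF F that] by (simp add: G_def bij_betw_def)
  have FG: "F n (G n y) = y" "G n y \<in> cells A n" if "y \<in> cells B n" for n y
    using that bij[of n] by (auto simp: G_def bij_betw_def f_inv_into_f inv_into_into)
  have G: "smap B A G"
  proof (rule smapI)
    show "G n \<in> extensional (cells B n)" for n by (simp add: G_def)
    show "G n y \<in> cells A n" if "y \<in> cells B n" for n y using FG that by simp
    fix p y assume y: "y \<in> cells B (dtgt p)"
    have "sact B p y = F (dsrc p) (sact A p (G (dtgt p) y))"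
      using smap_sact[OF F FG(2)[OF y] refl refl] FG(1)[OF y] by simp
    then show "G (dsrc p) (sact B p y) = sact A p (G (dtgt p) y)"
      using GF sact_in[OF A FG(2)[OF y] refl refl] by simp
  qed
  have "scomp A G F = sid A"
    by (rule ext, rule extensionalityI[OF scomp_ext]) (auto simp: GF sid_def)
  moreover have "scomp B F G = sid B"
    by (rule ext, rule extensionalityI[OF scomp_ext]) (auto simp: FG sid_def)
  ultimately show ?thesis using F G unfolding siso_def by blast
qed

lemma siso_inv:
  assumes "siso A B F"
  obtains G where "siso B A G" "scomp A G F = sid A" "scomp B F G = sid B"
proof -
  obtain G where "smap A B F" "smap B A G" "scomp A G F = sid A" "scomp B F G = sid B"
    using assms unfolding siso_def by auto
  then show ?thesis using that unfolding siso_def by auto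
qed

lemma siso_bij:
  assumes "siso A B F"
  shows "bij_betw (F n) (cells A n) (cells B n)"
proof -
  obtain G where G: "siso B A G" "scomp A G F = sid A" "scomp B F G = sid B"
    using siso_inv[OF assms] by blast
  have GF: "G n (F n x) = x" if "x \<in> cells A n" for x
    using scomp_eq_app[OF G(2) that] that by simp
  have FG: "F n (G n y) = y" if "y \<in> cells B n" for y
    using scomp_eq_app[OF G(3) that] that by simp
  show ?thesis
    by (rule bij_betw_byWitness[where f' = "G n"])
      (use GF FG smap_in[OF sisoD[OF G(1)], of _ n] smap_in[OF sisoD[OF assms], of _ n]
       in \<open>blast+\<close>)
qed

lemma siso_culf:
  assumes A: "sset A" and F: "siso A B F"
  shows "strict_culf A B F"
  unfolding strict_culf_def
proof (intro conjI allI impI)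
  show sm: "smap A B F" using F by (rule sisoD)
  fix p
  let ?f = "\<lambda>x. (sact A p x, F (dtgt p) x)"
  let ?T = "{(x, y). x \<in> cells A (dsrc p) \<and> y \<in> cells B (dtgt p) \<and> F (dsrc p) x = sact B p y}"
  have inj: "inj_on (F n) (cells A n)" for n using siso_bij[OF F] by (auto simp: bij_betw_def)
  have "inj_on ?f (cells A (dtgt p))"
    using inj[of "dtgt p"] by (auto simp: inj_on_def)
  moreover have "?f ` cells A (dtgt p) = ?T"
  proof (intro equalityI subsetI)
    fix z assume "z \<in> ?f ` cells A (dtgt p)"
    then obtain x where x: "x \<in> cells A (dtgt p)" "z = ?f x" by blast
    then show "z \<in> ?T"
      using sact_in[OF A x(1) refl refl] smap_in[OF sm x(1)] smap_sact[OF sm x(1) refl refl] by simp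
  next
    fix z assume "z \<in> ?T"
    then obtain x y where z: "z = (x, y)" "x \<in> cells A (dsrc p)" "y \<in> cells B (dtgt p)"
      "F (dsrc p) x = sact B p y" by auto
    obtain w where w: "w \<in> cells A (dtgt p)" "F (dtgt p) w = y"
      using bij_betw_imp_surj_on[OF siso_bij[OF F, of "dtgt p"]] z(3) by (metis imageE)
    have "F (dsrc p) (sact A p w) = F (dsrc p) x" using smap_sact[OF sm w(1) refl refl] w z by simp
    then have "sact A p w = x"
      by (rule inj_onD[OF inj[of "dsrc p"]]) (use sact_in[OF A w(1) refl refl] z in auto)
    then show "z \<in> ?f ` cells A (dtgt p)" using w z by auto
  qed
  ultimately show "bij_betw ?f (cells A (dtgt p)) ?T" by (simp add: bij_betw_def)
qed

section \<open>Culf maps: criterion, composition and cancellation\<close>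

lemma culfD: "strict_culf A B F \<Longrightarrow> smap A B F" by (simp add: strict_culf_def)

lemma culf_inj:
  assumes "strict_culf A B F" "active p" "x \<in> cells A (dtgt p)" "y \<in> cells A (dtgt p)"
    "sact A p x = sact A p y" "F (dtgt p) x = F (dtgt p) y"
  shows "x = y"
proof -
  have "inj_on (\<lambda>x. (sact A p x, F (dtgt p) x)) (cells A (dtgt p))"
    using assms(1,2) unfolding strict_culf_def bij_betw_def by blast
  then show ?thesis using assms by (auto simp: inj_on_def)
qed

lemma culf_surj:
  assumes "strict_culf A B F" "active p" "x \<in> cells A (dsrc p)" "y \<in> cells B (dtgt p)"
    "F (dsrc p) x = sact B p y"
  shows "\<exists>z\<in>cells A (dtgt p). sact A p z = x \<and> F (dtgt p) z = y"
proof -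
  have "(x, y) \<in> (\<lambda>x. (sact A p x, F (dtgt p) x)) ` cells A (dtgt p)"
    using assms unfolding strict_culf_def bij_betw_def by blast
  then show ?thesis by auto
qed

lemma culfI:
  assumes A: "sset A" and F: "smap A B F"
    and inj: "\<And>p x y. active p \<Longrightarrow> x \<in> cells A (dtgt p) \<Longrightarrow> y \<in> cells A (dtgt p) \<Longrightarrow>
      sact A p x = sact A p y \<Longrightarrow> F (dtgt p) x = F (dtgt p) y \<Longrightarrow> x = y"
    and surj: "\<And>p x y. active p \<Longrightarrow> x \<in> cells A (dsrc p) \<Longrightarrow> y \<in> cells B (dtgt p) \<Longrightarrow>
      F (dsrc p) x = sact B p y \<Longrightarrow> \<exists>z\<in>cells A (dtgt p). sact A p z = x \<and> F (dtgt p) z = y"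
  shows "strict_culf A B F"
  unfolding strict_culf_def
proof (intro conjI allI impI)
  fix p assume p: "active p"
  show "bij_betw (\<lambda>x. (sact A p x, F (dtgt p) x)) (cells A (dtgt p))
          {(x, y). x \<in> cells A (dsrc p) \<and> y \<in> cells B (dtgt p) \<and> F (dsrc p) x = sact B p y}"
    (is "bij_betw ?f _ ?T") unfolding bij_betw_def
  proof
    show "inj_on (\<lambda>x. (sact A p x, F (dtgt p) x)) (cells A (dtgt p))"
      using inj[OF p] by (auto simp: inj_on_def)
    show "?f ` cells A (dtgt p) = ?T"
    proof (intro equalityI subsetI)
      fix z assume "z \<in> ?f ` cells A (dtgt p)"
      then obtain x where x: "x \<in> cells A (dtgt p)" "z = ?f x" by blast
      then show "z \<in> ?T"
        using sact_in[OF A x(1) refl refl] smap_in[OF F x(1)] smap_sact[OF F x(1) refl refl] by simp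
    next
      fix z assume "z \<in> ?T"
      then show "z \<in> ?f ` cells A (dtgt p)" using surj[OF p] by blast
    qed
  qed
qed fact

lemma culf_scomp:
  assumes A: "sset A" and F: "strict_culf A B F" and G: "strict_culf B C G"
  shows "strict_culf A C (scomp A G F)"
proof (rule culfI[OF A smap_scomp[OF A culfD[OF F] culfD[OF G]]])
  fix p x y assume *: "active p" "x \<in> cells A (dtgt p)" "y \<in> cells A (dtgt p)"
    "sact A p x = sact A p y" "scomp A G F (dtgt p) x = scomp A G F (dtgt p) y"
  have "sact B p (F (dtgt p) x) = sact B p (F (dtgt p) y)"
    using * smap_sact[OF culfD[OF F] *(2) refl refl] smap_sact[OF culfD[OF F] *(3) refl refl] by simp
  then have "F (dtgt p) x = F (dtgt p) y"
    using culf_inj[OF G *(1), of "F (dtgt p) x" "F (dtgt p) y"] * smap_in[OF culfD[OF F]] by simp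
  then show "x = y" using culf_inj[OF F] * by blast
next
  fix p x y assume *: "active p" "x \<in> cells A (dsrc p)" "y \<in> cells C (dtgt p)"
    "scomp A G F (dsrc p) x = sact C p y"
  obtain z where z: "z \<in> cells B (dtgt p)" "sact B p z = F (dsrc p) x" "G (dtgt p) z = y"
    using culf_surj[OF G *(1), of "F (dsrc p) x" y] * smap_in[OF culfD[OF F]] by auto
  obtain u where u: "u \<in> cells A (dtgt p)" "sact A p u = x" "F (dtgt p) u = z"
    using culf_surj[OF F *(1), of x z] * z by auto
  then show "\<exists>z\<in>cells A (dtgt p). sact A p z = x \<and> scomp A G F (dtgt p) z = y"
    using z by auto
qed

text \<open>A compatible pair for \<open>F\<close> becomes one for the composite after
  \<open>G\<close> is applied. The simplex found for the composite is also right in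
  \<open>B\<close>: its image and the given simplex have the same restriction along \<open>p\<close>
  and the same image under \<open>G\<close>, and \<open>G\<close> is culf.\<close>

lemma culf_cancel:
  assumes A: "sset A" and F: "smap A B F" and G: "strict_culf B C G"
    and GF: "strict_culf A C (scomp A G F)"
  shows "strict_culf A B F"
proof (rule culfI[OF A F])
  fix p x y assume *: "active p" "x \<in> cells A (dtgt p)" "y \<in> cells A (dtgt p)"
    "sact A p x = sact A p y" "F (dtgt p) x = F (dtgt p) y"
  then show "x = y" using culf_inj[OF GF *(1-4)] by simp
next
  fix p x y assume *: "active p" "x \<in> cells A (dsrc p)" "y \<in> cells B (dtgt p)"
    "F (dsrc p) x = sact B p y"
  have "scomp A G F (dsrc p) x = sact C p (G (dtgt p) y)"
    using * smap_sact[OF culfD[OF G] *(3) refl refl] by simp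
  then obtain z where z: "z \<in> cells A (dtgt p)" "sact A p z = x" "scomp A G F (dtgt p) z = G (dtgt p) y"
    using culf_surj[OF GF *(1,2)] smap_in[OF culfD[OF G] *(3)] by blast
  have "F (dtgt p) z = y"
  proof (rule culf_inj[OF G *(1)])
    show "F (dtgt p) z \<in> cells B (dtgt p)" using smap_in[OF F z(1)] .
    show "sact B p (F (dtgt p) z) = sact B p y" using smap_sact[OF F z(1) refl refl] z(2) * by simp
    show "G (dtgt p) (F (dtgt p) z) = G (dtgt p) y" using z by simp
  qed fact
  then show "\<exists>z\<in>cells A (dtgt p). sact A p z = x \<and> F (dtgt p) z = y" using z by auto
qed

declare One_nat_def [simp del] add_2_eq_Suc' [simp del]

section \<open>Cones and orthogonality\<close>

definition long_edge :: "'x interval \<Rightarrow> 'x \<Rightarrow> bool" where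
  "long_edge D e \<longleftrightarrow> e \<in> cells D 1 \<and> sact D (vert 1 0) e = ibot D \<and> sact D (vert 1 1) e = itop D"

text \<open>Replaces an arbitrary simplex \<open>y\<close> by one whose long edge is a long edge of
  \<open>D\<close>, so that a culf map gives control over it.\<close>

definition cone :: "'x interval \<Rightarrow> nat \<Rightarrow> 'x \<Rightarrow> 'x \<Rightarrow> bool" where
  "cone D k y t \<longleftrightarrow> t \<in> cells D (k + 2) \<and> sact D (iota k) t = y \<and>
     sact D (vert (k + 2) 0) t = ibot D \<and> sact D (vert (k + 2) (k + 2)) t = itop D"

text \<open>The property of the source on which lifting against culf maps rests. It is shared by
  discrete algebraic intervals and standard simplices.\<close>

definition has_cones :: "'x interval \<Rightarrow> bool" where
  "has_cones D \<longleftrightarrow> sset D \<and> (\<forall>k. \<forall>y\<in>cells D k. \<exists>!t. cone D k y t)"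

lemma vert_dcomp: "i \<le> dsrc p \<Longrightarrow> p \<odot> vert (dsrc p) i = vert (dtgt p) (dapp p i)"
  by (rule simplex_map_eqI) auto

lemma has_conesD: "has_cones D \<Longrightarrow> y \<in> cells D k \<Longrightarrow> \<exists>!t. cone D k y t"
  by (simp add: has_cones_def)

lemma cone_long_edge:
  assumes D: "sset D" and t: "cone D k y t"
  shows "long_edge D (sact D (dlong (k + 2)) t)"
proof -
  have t': "t \<in> cells D (k + 2)" using t by (simp add: cone_def)
  have v: "dlong (k + 2) \<odot> vert 1 0 = vert (k + 2) 0" "dlong (k + 2) \<odot> vert 1 1 = vert (k + 2) (k + 2)"
    using vert_dcomp[of 0 "dlong (k + 2)"] vert_dcomp[of 1 "dlong (k + 2)"] by auto
  show ?thesis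
    using t t' D unfolding long_edge_def cone_def
    by (auto simp: sact_sact v intro!: sact_in)
qed

text \<open>Every simplex is the inner part of its cone, and the lift of a cone along a culf map is
  determined by its image and its long edge. Two lifts of one map therefore coincide once they
  coincide on long edges.\<close>

lemma culf_unique:
  assumes D: "has_cones D" and F: "strict_culf A B F" and c: "smap D A c" "smap D A c'"
    and Fc: "\<And>n x. x \<in> cells D n \<Longrightarrow> F n (c n x) = F n (c' n x)"
    and e: "\<And>e. long_edge D e \<Longrightarrow> c 1 e = c' 1 e"
  shows "c = c'"
proof (rule smap_eqI[OF c])
  fix k y assume y: "y \<in> cells D k"
  have sD: "sset D" using D by (simp add: has_cones_def)
  obtain t where t: "cone D k y t" using has_conesD[OF D y] by auto
  then have t': "t \<in> cells D (k + 2)" by (simp add: cone_def)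
  have "c (k + 2) t = c' (k + 2) t"
  proof (rule culf_inj[OF F, of "dlong (k + 2)", unfolded dlong_simps])
    show "sact A (dlong (k + 2)) (c (k + 2) t) = sact A (dlong (k + 2)) (c' (k + 2) t)"
      using e[OF cone_long_edge[OF sD t]] smap_sact[OF c(1) t', of "dlong (k + 2)" 1]
        smap_sact[OF c(2) t', of "dlong (k + 2)" 1] by simp
  qed (use t' smap_in[OF c(1)] smap_in[OF c(2)] Fc in auto)
  moreover have "c k y = sact A (iota k) (c (k + 2) t)" "c' k y = sact A (iota k) (c' (k + 2) t)"
    using t smap_sact[OF c(1) t', of "iota k" k] smap_sact[OF c(2) t', of "iota k" k]
    by (auto simp: cone_def)
  ultimately show "c k y = c' k y" by simp
qed

lemma cone_shift:
  assumes D: "sset D" and t: "cone D k y t" and p: "dtgt p = k"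
  shows "cone D (dsrc p) (sact D p y) (sact D (shift p) t)"
proof -
  have t': "t \<in> cells D (k + 2)" and y: "y = sact D (iota k) t" using t by (auto simp: cone_def)
  have "shift p \<odot> vert (dsrc p + 2) 0 = vert (k + 2) 0"
    "shift p \<odot> vert (dsrc p + 2) (dsrc p + 2) = vert (k + 2) (k + 2)"
    using vert_dcomp[of 0 "shift p"] vert_dcomp[of "dsrc p + 2" "shift p"] p
    by (auto)
  moreover have "shift p \<odot> iota (dsrc p) = iota k \<odot> p" using shift_iota[of p] p by simp
  ultimately show ?thesis
    using t t' D p unfolding cone_def y
    by (auto simp: sact_sact intro!: sact_in)
qed

lemma cone_of_long_edge:
  assumes D: "sset D" and e: "long_edge D e"
  shows "cone D 1 e (sact D (extend (did 1)) e)"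
proof -
  have "extend (did 1) \<odot> iota 1 = did 1" using ext_iota[of "did 1"] by simp
  moreover have "extend (did 1) \<odot> vert (1 + 2) 0 = vert 1 0"
    "extend (did 1) \<odot> vert (1 + 2) (1 + 2) = vert 1 1"
    by (rule simplex_map_eqI; simp)+
  ultimately show ?thesis
    using e D unfolding cone_def long_edge_def by (auto simp: sact_sact sact_did intro!: sact_in)
qed

text \<open>The cone over \<open>y\<close> is lifted instead of \<open>y\<close>. Once \<epsilon> is
  prescribed as the lifted long edge, the image of the cone has exactly one lift
  \<open>L k y\<close>, and its inner part serves as the value at \<open>y\<close>. Uniqueness of
  \<open>L k y\<close> makes the result simplicial.\<close>

lemma culf_lift:
  assumes D: "has_cones D" and A: "sset A" and F: "strict_culf A B F" and g: "smap D B g"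
    and eps: "\<epsilon> \<in> cells A 1" "\<And>e. long_edge D e \<Longrightarrow> F 1 \<epsilon> = g 1 e"
  obtains c where "smap D A c" "scomp D F c = g" "\<And>e. long_edge D e \<Longrightarrow> c 1 e = \<epsilon>"
proof -
  have sD: "sset D" using D by (simp add: has_cones_def)
  have sF: "smap A B F" using F by (rule culfD)
  define T where "T k y = (THE t. cone D k y t)" for k y
  have T: "cone D k y (T k y)" if "y \<in> cells D k" for k y
    unfolding T_def by (rule theI'[OF has_conesD[OF D that]])
  have T': "T k y \<in> cells D (k + 2)" "sact D (iota k) (T k y) = y" if "y \<in> cells D k" for k y
    using T[OF that] by (auto simp: cone_def)
  have T_eq: "t = T k y" if "y \<in> cells D k" "cone D k y t" for k y t
    using has_conesD[OF D that(1)] T[OF that(1)] that(2) by blast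
  define P where "P k y z \<longleftrightarrow> z \<in> cells A (k + 2) \<and> sact A (dlong (k + 2)) z = \<epsilon> \<and>
    F (k + 2) z = g (k + 2) (T k y)" for k y z
  have P1: "z = z'" if "P k y z" "P k y z'" for k y z z'
    by (rule culf_inj[OF F, of "dlong (k + 2)", unfolded dlong_simps])
      (use that in \<open>auto simp: P_def\<close>)
  have P_ex: "\<exists>z. P k y z" if y: "y \<in> cells D k" for k y
  proof -
    have "F 1 \<epsilon> = sact B (dlong (k + 2)) (g (k + 2) (T k y))"
      using eps(2)[OF cone_long_edge[OF sD T[OF y]]]
        smap_sact[OF g T'(1)[OF y], of "dlong (k + 2)" 1] by simp
    then show ?thesis
      using culf_surj[OF F, of "dlong (k + 2)" \<epsilon> "g (k + 2) (T k y)"] eps(1)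
        smap_in[OF g T'(1)[OF y]] by (auto simp: P_def)
  qed
  define L where "L k y = (SOME z. P k y z)" for k y
  have L: "P k y (L k y)" if "y \<in> cells D k" for k y
    unfolding L_def using P_ex[OF that] by (rule someI_ex)
  have L': "L k y \<in> cells A (k + 2)" if "y \<in> cells D k" for k y
    using L[OF that] by (simp add: P_def)
  \<comment> \<open>Both sides lift the image of the cone over \<open>sact D p y\<close>, because
    restricting a cone along \<open>shift p\<close> gives a cone again.\<close>
  have L_shift: "L (dsrc p) (sact D p y) = sact A (shift p) (L k y)"
    if y: "y \<in> cells D k" and p: "dtgt p = k" for k y p
  proof -
    have py: "sact D p y \<in> cells D (dsrc p)" by (rule sact_in[OF sD y p refl])
    have "T (dsrc p) (sact D p y) = sact D (shift p) (T k y)"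
      using T_eq[OF py cone_shift[OF sD T[OF y] p]] by simp
    moreover have "shift p \<odot> dlong (dsrc p + 2) = dlong (k + 2)"
      using active_dlong[of "shift p"] p by simp
    ultimately have "P (dsrc p) (sact D p y) (sact A (shift p) (L k y))"
      using L[OF y] smap_sact[OF g T'(1)[OF y], of "shift p" "dsrc p + 2"]
        smap_sact[OF sF L'[OF y], of "shift p" "dsrc p + 2"] A p
      unfolding P_def by (auto simp: sact_sact intro!: sact_in)
    then show ?thesis using P1 L[OF py] by blast
  qed
  define c where "c k = (\<lambda>y\<in>cells D k. sact A (iota k) (L k y))" for k
  have smc: "smap D A c"
  proof (rule smapI)
    show "c n \<in> extensional (cells D n)" for n by (simp add: c_def)
    show "c n x \<in> cells A n" if "x \<in> cells D n" for n x
      using that sact_in[OF A L'[OF that], of "iota n" n] by (simp add: c_def)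
    fix p x assume x: "x \<in> cells D (dtgt p)"
    have "sact A (iota (dsrc p)) (sact A (shift p) (L (dtgt p) x))
      = sact A p (sact A (iota (dtgt p)) (L (dtgt p) x))"
      using L'[OF x] A by (simp add: sact_sact shift_iota)
    then show "c (dsrc p) (sact D p x) = sact A p (c (dtgt p) x)"
      using x L_shift[OF x refl] sact_in[OF sD x refl refl] by (simp add: c_def)
  qed
  have Fc: "scomp D F c = g"
  proof (rule smap_eqI[OF smap_scomp[OF sD smc sF] g])
    fix n x assume x: "x \<in> cells D n"
    have "F n (sact A (iota n) (L n x)) = sact B (iota n) (F (n + 2) (L n x))"
      by (rule smap_sact[OF sF L'[OF x]]) auto
    also have "\<dots> = sact B (iota n) (g (n + 2) (T n x))"
      using L[OF x] by (simp add: P_def)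
    also have "\<dots> = g n x"
      using smap_sact[OF g T'(1)[OF x], of "iota n" n] T'(2)[OF x] by simp
    finally show "scomp D F c n x = g n x" using x by (simp add: c_def)
  qed
  have "c 1 e = \<epsilon>" if e: "long_edge D e" for e
  proof -
    have e1: "e \<in> cells D 1" using e by (simp add: long_edge_def)
    \<comment> \<open>The cone over a long edge is degenerate, so its lift is the same degeneracy of
      \<epsilon>, whose inner part is \<epsilon>.\<close>
    have "T 1 e = sact D (extend (did 1)) e"
      using T_eq[OF e1 cone_of_long_edge[OF sD e]] by simp
    moreover have "extend (did 1) \<odot> dlong 3 = did 1"
      using active_dlong[of "extend (did 1)"] by (simp add: dlong_1[symmetric])
    ultimately have "P 1 e (sact A (extend (did 1)) \<epsilon>)"
      using eps(1) eps(2)[OF e] smap_sact[OF g e1, of "extend (did 1)" 3]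
        smap_sact[OF sF eps(1), of "extend (did 1)" 3] A
      unfolding P_def by (auto simp: sact_sact sact_did intro!: sact_in)
    then have "L 1 e = sact A (extend (did 1)) \<epsilon>" using P1 L[OF e1] by blast
    moreover have "sact A (iota 1) (sact A (extend (did 1)) \<epsilon>) = \<epsilon>"
      using eps(1) A ext_iota[of "did 1"] by (simp add: sact_sact sact_did)
    ultimately show ?thesis using e1 by (simp add: c_def)
  qed
  with smc Fc show thesis by (rule that)
qed

section \<open>Discrete algebraic intervals\<close>

lemma daiD:
  assumes "discrete_algebraic_interval A"
  shows "sset A" "strict_segal A" "ibot A \<in> cells A 0" "itop A \<in> cells A 0"
    "\<And>x. x \<in> cells A 0 \<Longrightarrow>
        (\<exists>!e. e \<in> cells A 1 \<and> sact A (vert 1 0) e = ibot A \<and> sact A (vert 1 1) e = x)"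
    "\<And>x. x \<in> cells A 0 \<Longrightarrow>
        (\<exists>!e. e \<in> cells A 1 \<and> sact A (vert 1 0) e = x \<and> sact A (vert 1 1) e = itop A)"
  using assms unfolding discrete_algebraic_interval_def by blast+

lemma dai_long_edge: "discrete_algebraic_interval A \<Longrightarrow> \<exists>!e. long_edge A e"
  unfolding long_edge_def by (rule daiD(5)[OF _ daiD(4)])

lemma segal_inj:
  assumes "strict_segal A" "n \<ge> 1" "x \<in> cells A n" "y \<in> cells A n"
    "\<And>i. i < n \<Longrightarrow> sact A (spine_edge n i) x = sact A (spine_edge n i) y"
  shows "x = y"
proof -
  have "inj_on (\<lambda>x. \<lambda>i\<in>{..<n}. sact A (spine_edge n i) x) (cells A n)"
    using assms(1,2) unfolding strict_segal_def bij_betw_def by blast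
  moreover have "(\<lambda>i\<in>{..<n}. sact A (spine_edge n i) x) = (\<lambda>i\<in>{..<n}. sact A (spine_edge n i) y)"
    using assms(5) by (auto intro: restrict_ext)
  ultimately show ?thesis using assms(3,4) by (auto dest: inj_onD)
qed

lemma segal_surj:
  assumes "strict_segal A" "n \<ge> 1" "\<And>i. i < n \<Longrightarrow> e i \<in> cells A 1"
    "\<And>i. i + 1 < n \<Longrightarrow> sact A (vert 1 1) (e i) = sact A (vert 1 0) (e (i + 1))"
  obtains x where "x \<in> cells A n" "\<And>i. i < n \<Longrightarrow> sact A (spine_edge n i) x = e i"
proof -
  let ?e = "\<lambda>i\<in>{..<n}. e i"
  have "?e \<in> {e \<in> {..<n} \<rightarrow>\<^sub>E cells A 1.
           \<forall>i. i + 1 < n \<longrightarrow> sact A (vert 1 1) (e i) = sact A (vert 1 0) (e (i + 1))}"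
    using assms(3,4) by auto
  then have "?e \<in> (\<lambda>x. \<lambda>i\<in>{..<n}. sact A (spine_edge n i) x) ` cells A n"
    using assms(1,2) unfolding strict_segal_def bij_betw_def by blast
  then obtain x where x: "x \<in> cells A n" "?e = (\<lambda>i\<in>{..<n}. sact A (spine_edge n i) x)" by blast
  have "sact A (spine_edge n i) x = e i" if "i < n" for i
    using fun_cong[OF x(2), of i] that by simp
  then show thesis using x(1) that by blast
qed

lemma iota_spine: "i < k \<Longrightarrow> iota k \<odot> spine_edge k i = spine_edge (k + 2) (i + 1)"
  by (rule simplex_map_eqI) auto

lemma spine_vert:
  "i < n \<Longrightarrow> spine_edge n i \<odot> vert 1 0 = vert n i"
  "i < n \<Longrightarrow> spine_edge n i \<odot> vert 1 1 = vert n (i + 1)"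
  by (rule simplex_map_eqI; simp)+

text \<open>The spine of the cone is the spine of \<open>y\<close>, preceded by the edge from bottom
  to its first vertex and followed by the edge from its last vertex to top. These two edges exist
  uniquely, and by the Segal condition the spine has exactly one filler.\<close>

lemma dai_has_cones:
  assumes "discrete_algebraic_interval A"
  shows "has_cones A"
  unfolding has_cones_def
proof (intro conjI allI ballI)
  show sA: "sset A" by (rule daiD[OF assms])
  note seg = daiD(2)[OF assms]
  fix k y assume y: "y \<in> cells A k"
  have v: "sact A (vert k i) y \<in> cells A 0" if "i \<le> k" for i
    using that by (intro sact_in[OF sA y]) auto
  obtain e0 where e0: "e0 \<in> cells A 1" "sact A (vert 1 0) e0 = ibot A"
    "sact A (vert 1 1) e0 = sact A (vert k 0) y" using daiD(5)[OF assms v[of 0]] by auto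
  obtain e1 where e1: "e1 \<in> cells A 1" "sact A (vert 1 1) e1 = itop A"
    "sact A (vert 1 0) e1 = sact A (vert k k) y" using daiD(6)[OF assms v[of k]] by auto
  define e where "e i = (if i = 0 then e0 else if i \<le> k then sact A (spine_edge k (i - 1)) y else e1)" for i
  have sp_in: "sact A (spine_edge k i) y \<in> cells A 1" if "i < k" for i
    using that by (intro sact_in[OF sA y]) auto
  have spv: "sact A (vert 1 0) (sact A (spine_edge k i) y) = sact A (vert k i) y"
    "sact A (vert 1 1) (sact A (spine_edge k i) y) = sact A (vert k (i + 1)) y" if "i < k" for i
    using that y sA spine_vert[OF that] by (auto simp: sact_sact)
  have e_in: "e i \<in> cells A 1" for i using e0 e1 sp_in by (auto simp: e_def)
  have e_src: "sact A (vert 1 0) (e (i + 1)) = sact A (vert k i) y" if "i \<le> k" for i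
    using that spv(1)[of i] e1 by (cases "i = k") (auto simp: e_def)
  have e_tgt: "sact A (vert 1 1) (e i) = sact A (vert k i) y" if "i \<le> k" for i
    using that spv(2)[of "i - 1"] e0 by (auto simp: e_def)
  have "sact A (vert 1 1) (e i) = sact A (vert 1 0) (e (i + 1))" if "i + 1 < k + 2" for i
    using e_src[of i] e_tgt[of i] that by simp
  then obtain t where t: "t \<in> cells A (k + 2)"
    "\<And>i. i < k + 2 \<Longrightarrow> sact A (spine_edge (k + 2) i) t = e i"
    using segal_surj[OF seg, of "k + 2" e] e_in by (metis le_add2 one_le_numeral order_trans)
  have tv: "sact A (vert 1 0) (sact A (spine_edge (k + 2) i) x) = sact A (vert (k + 2) i) x"
    "sact A (vert 1 1) (sact A (spine_edge (k + 2) i) x) = sact A (vert (k + 2) (i + 1)) x"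
    if "i < k + 2" "x \<in> cells A (k + 2)" for i x
    using that sA spine_vert[OF that(1)] by (auto simp: sact_sact)
  have tsp: "sact A (spine_edge k i) (sact A (iota k) x) = sact A (spine_edge (k + 2) (i + 1)) x"
    if "i < k" "x \<in> cells A (k + 2)" for i x
    using that sA iota_spine[OF that(1)] by (simp add: sact_sact)
  show "\<exists>!t. cone A k y t"
  proof (rule ex1I[of _ t])
    have "sact A (iota k) t = y"
    \<comment> \<open>The Segal bijection starts in dimension 1. For \<open>k = 0\<close> the inner
      part is the middle vertex of a 2-simplex, read off as the target of its first edge.\<close>
    proof (cases "k = 0")
      case True
      have *: "iota 0 = vert 2 1" "vert 0 0 = did 0" by (rule simplex_map_eqI; simp)+
      have "sact A (vert 2 1) t = sact A (vert 1 1) (e 0)"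
        using tv(2)[of 0 t] t True by simp
      then show ?thesis using True * e_tgt[of 0] y sact_did[OF sA] by simp
    next
      case False
      show ?thesis
      proof (rule segal_inj[OF seg _ _ y])
        show "1 \<le> k" using False by simp
        show "sact A (iota k) t \<in> cells A k" by (intro sact_in[OF sA t(1)]) auto
        fix i assume i: "i < k"
        show "sact A (spine_edge k i) (sact A (iota k) t) = sact A (spine_edge k i) y"
          using tsp[OF i t(1)] t(2)[of "i + 1"] i by (simp add: e_def)
      qed
    qed
    moreover have "sact A (vert (k + 2) 0) t = ibot A"
      using tv(1)[of 0 t] t e0 by (simp add: e_def)
    moreover have "sact A (vert (k + 2) (k + 2)) t = itop A"
      using tv(2)[of "k + 1" t] t e1 by (simp add: e_def add.assoc)
    ultimately show "cone A k y t" using t(1) unfolding cone_def by simp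
    fix x assume "cone A k y x"
    then have x: "x \<in> cells A (k + 2)" "sact A (iota k) x = y"
      "sact A (vert (k + 2) 0) x = ibot A" "sact A (vert (k + 2) (k + 2)) x = itop A"
      by (auto simp: cone_def)
    have xin: "sact A (spine_edge (k + 2) i) x \<in> cells A 1" if "i < k + 2" for i
      using that by (intro sact_in[OF sA x(1)]) auto
    show "x = t"
    proof (rule segal_inj[OF seg _ x(1) t(1)])
      show "1 \<le> k + 2" by simp
      fix i assume i: "i < k + 2"
      have xv: "sact A (vert (k + 2) (j + 1)) x = sact A (vert k j) y" if "j \<le> k" for j
        using that x sA vert_dcomp[of j "iota k"] by (auto simp: sact_sact)
      consider "i = 0" | "1 \<le> i" "i \<le> k" | "i = k + 1" using i by linarith
      then show "sact A (spine_edge (k + 2) i) x = sact A (spine_edge (k + 2) i) t"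
      proof cases
        case 1
        have "sact A (spine_edge (k + 2) 0) x = e0"
          using daiD(5)[OF assms v[of 0]] e0 xin[of 0] tv(1)[of 0 x] tv(2)[of 0 x] xv[of 0] x
          by (metis add.left_neutral le0 zero_less_numeral add_gr_0)
        then show ?thesis using t(2)[OF i] 1 by (simp add: e_def)
      next
        case 2
        then show ?thesis using tsp[of "i - 1" x] x t(2)[OF i] by (auto simp: e_def)
      next
        case 3
        have "sact A (spine_edge (k + 2) (k + 1)) x = e1"
          using daiD(6)[OF assms v[of k]] e1 xin[of "k + 1"] tv(1)[of "k + 1" x] tv(2)[of "k + 1" x]
            xv[of k] x by (auto simp: add.assoc)
        then show ?thesis using t(2)[OF i] 3 by (simp add: e_def)
      qed
    qed
  qed
qed

section \<open>Maps out of standard simplices\<close>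

lemma std_simplex_cells [simp]: "\<sigma> \<in> cells (std_simplex n) k \<longleftrightarrow> dsrc \<sigma> = k \<and> dtgt \<sigma> = n"
  by (simp add: std_simplex_def)

lemma std_simplex_sact: "dsrc \<sigma> = dtgt p \<Longrightarrow> dtgt \<sigma> = n \<Longrightarrow> sact (std_simplex n) p \<sigma> = \<sigma> \<odot> p"
  by (simp add: std_simplex_def)

lemma std_simplex_ends: "ibot (std_simplex n) = vert n 0" "itop (std_simplex n) = vert n n"
  by (simp_all add: std_simplex_def)

lemma sset_std_simplex: "sset (std_simplex n)"
  unfolding sset_def
proof (intro conjI allI impI)
  fix p show "sact (std_simplex n) p
      \<in> cells (std_simplex n) (dtgt p) \<rightarrow>\<^sub>E cells (std_simplex n) (dsrc p)"
    by (auto simp: std_simplex_def)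
next
  fix m show "sact (std_simplex n) (did m) = (\<lambda>x\<in>cells (std_simplex n) m. x)"
    by (auto simp: std_simplex_def fun_eq_iff)
next
  fix p q :: simplex_map assume "dtgt p = dsrc q"
  then show "sact (std_simplex n) (q \<odot> p) =
    compose (cells (std_simplex n) (dtgt q)) (sact (std_simplex n) p) (sact (std_simplex n) q)"
    by (auto simp: std_simplex_def fun_eq_iff compose_def dcomp_assoc)
qed

lemma std_simplex_long_edge: "long_edge (std_simplex n) e \<longleftrightarrow> e = dlong n"
proof
  assume "long_edge (std_simplex n) e"
  then have e: "dsrc e = 1" "dtgt e = n" "e \<odot> vert 1 0 = vert n 0" "e \<odot> vert 1 1 = vert n n"
    by (auto simp: long_edge_def std_simplex_sact std_simplex_ends)
  have "dapp e 0 = 0" "dapp e 1 = n"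
    using vert_dcomp[of 0 e] vert_dcomp[of 1 e] e by (metis dapp_le dcomp_simps(3) le0 vert_simps order_refl One_nat_def)+
  then show "e = dlong n" by (intro simplex_map_eqI) (use e in \<open>auto simp: le_Suc_eq One_nat_def\<close>)
next
  assume "e = dlong n"
  then show "long_edge (std_simplex n) e"
    using vert_dcomp[of 0 "dlong n"] vert_dcomp[of 1 "dlong n"]
    by (auto simp: long_edge_def std_simplex_sact std_simplex_ends)
qed

text \<open>The cone over \<sigma> is \<open>extend \<sigma>\<close>: the end points fix the two
  outer values, the inner part all others.\<close>

lemma has_cones_std_simplex: "has_cones (std_simplex n)"
  unfolding has_cones_def
proof (intro conjI allI ballI sset_std_simplex)
  fix k \<sigma> assume "\<sigma> \<in> cells (std_simplex n) k"
  then have s: "dsrc \<sigma> = k" "dtgt \<sigma> = n" by auto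
  show "\<exists>!t. cone (std_simplex n) k \<sigma> t"
  proof (rule ex1I[of _ "extend \<sigma>"])
    show "cone (std_simplex n) k \<sigma> (extend \<sigma>)"
      using s ext_iota[of \<sigma>] vert_dcomp[of 0 "extend \<sigma>"] vert_dcomp[of "k + 2" "extend \<sigma>"]
      by (auto simp: cone_def std_simplex_sact std_simplex_ends)
    fix t assume "cone (std_simplex n) k \<sigma> t"
    then have t: "dsrc t = k + 2" "dtgt t = n" "t \<odot> iota k = \<sigma>" "t \<odot> vert (k + 2) 0 = vert n 0"
      "t \<odot> vert (k + 2) (k + 2) = vert n n"
      by (auto simp: cone_def std_simplex_sact std_simplex_ends)
    have t0: "dapp t 0 = 0" using arg_cong[OF t(4), of "\<lambda>p. dapp p 0"] t(1,2) by simp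
    have t2: "dapp t (k + 2) = n" using arg_cong[OF t(5), of "\<lambda>p. dapp p 0"] t(1,2) by simp
    have t1: "dapp t (i + 1) = dapp \<sigma> i" if "i \<le> k" for i
      using arg_cong[OF t(3), of "\<lambda>p. dapp p i"] t(1,2) that by simp
    show "t = extend \<sigma>"
    proof (rule simplex_map_eqI)
      show "dsrc t = dsrc (extend \<sigma>)" "dtgt t = dtgt (extend \<sigma>)" using s t by auto
      fix i assume "i \<le> dsrc t"
      then consider "i = 0" | "1 \<le> i" "i \<le> k + 1" | "i = k + 2" using t(1) by linarith
      then show "dapp t i = dapp (extend \<sigma>) i"
        using t0 t1[of "i - 1"] t2 s by cases auto
    qed
  qed
qed

section \<open>The Yoneda correspondence for simplices\<close>

definition yoneda :: "('x, 'z) sset_scheme \<Rightarrow> nat \<Rightarrow> 'x \<Rightarrow> nat \<Rightarrow> simplex_map \<Rightarrow> 'x" where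
  "yoneda A n x k = (\<lambda>\<sigma>\<in>cells (std_simplex n) k. sact A \<sigma> x)"

lemma yoneda_app [simp]: "dsrc \<sigma> = k \<Longrightarrow> dtgt \<sigma> = n \<Longrightarrow> yoneda A n x k \<sigma> = sact A \<sigma> x"
  by (simp add: yoneda_def)

lemma smap_yoneda: "sset A \<Longrightarrow> x \<in> cells A n \<Longrightarrow> smap (std_simplex n) A (yoneda A n x)"
  by (rule smapI) (auto simp: yoneda_def std_simplex_sact sact_sact intro: sact_in)

lemma yoneda_did: "sset A \<Longrightarrow> x \<in> cells A n \<Longrightarrow> yoneda A n x n (did n) = x"
  by (simp add: sact_did)

lemma yoneda_inject: "sset A \<Longrightarrow> x \<in> cells A n \<Longrightarrow> y \<in> cells A n \<Longrightarrow> yoneda A n x = yoneda A n y \<longleftrightarrow> x = y"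
  using yoneda_did by metis

lemma yoneda_unique:
  assumes "sset A" "smap (std_simplex n) A a"
  shows "a = yoneda A n (a n (did n))"
proof (rule smap_eqI[OF assms(2) smap_yoneda])
  show "a n (did n) \<in> cells A n" by (rule smap_in[OF assms(2)]) simp
  fix k \<sigma> assume "\<sigma> \<in> cells (std_simplex n) k"
  then have s: "dsrc \<sigma> = k" "dtgt \<sigma> = n" by auto
  have "a k (sact (std_simplex n) \<sigma> (did n)) = sact A \<sigma> (a n (did n))"
    by (rule smap_sact[OF assms(2)]) (use s in auto)
  then show "a k \<sigma> = yoneda A n (a n (did n)) k \<sigma>" using s by (simp add: std_simplex_sact)
qed fact

lemma scomp_yoneda:
  assumes "sset A" "smap A B F" "x \<in> cells A n"
  shows "scomp (std_simplex n) F (yoneda A n x) = yoneda B n (F n x)"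
  by (rule ext, rule extensionalityI[OF scomp_ext])
    (use assms in \<open>auto simp: yoneda_def smap_sact\<close>)

lemma scomp_yoneda_std_map:
  assumes "sset A" "x \<in> cells A (dtgt p)"
  shows "scomp (std_simplex (dsrc p)) (yoneda A (dtgt p) x) (std_map p) = yoneda A (dsrc p) (sact A p x)"
  by (rule ext, rule extensionalityI[OF scomp_ext])
    (use assms in \<open>auto simp: yoneda_def std_map_def sact_sact\<close>)

lemma stretched_yoneda:
  assumes "sset A" "x \<in> cells A n"
  shows "stretched (std_simplex n) A (yoneda A n x) \<longleftrightarrow>
    sact A (vert n 0) x = ibot A \<and> sact A (vert n n) x = itop A"
  using assms by (simp add: stretched_def smap_yoneda std_simplex_ends)

section \<open>Decomposition sets and their intervals\<close>

text \<open>The pullback condition of a decomposition groupoid for sets, at the explicit pushouts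
  \<open>glue\<close>. In this form it applies to the objects and to the arrows of \<open>X\<close>
  alike.\<close>

definition decomposition_set :: "('x, 'z) sset_scheme \<Rightarrow> bool" where
  "decomposition_set A \<longleftrightarrow> sset A \<and>
     (\<forall>a l s x y. active a \<and> x \<in> cells A (l + dsrc a + s) \<and> y \<in> cells A (dtgt a) \<and>
        sact A (incl l (dsrc a) s) x = sact A a y \<longrightarrow>
        (\<exists>!w. w \<in> cells A (l + dtgt a + s) \<and> sact A (glue l s a) w = x \<and>
           sact A (incl l (dtgt a) s) w = y))"

lemma decomp_sset: "decomposition_set A \<Longrightarrow> sset A" by (simp add: decomposition_set_def)

lemma decomp_ex:
  assumes "decomposition_set A" "active a" "x \<in> cells A (l + dsrc a + s)" "y \<in> cells A (dtgt a)"
    "sact A (incl l (dsrc a) s) x = sact A a y"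
  shows "\<exists>w. w \<in> cells A (l + dtgt a + s) \<and> sact A (glue l s a) w = x \<and>
     sact A (incl l (dtgt a) s) w = y"
proof -
  have "\<exists>!w. w \<in> cells A (l + dtgt a + s) \<and> sact A (glue l s a) w = x \<and>
     sact A (incl l (dtgt a) s) w = y"
    using assms unfolding decomposition_set_def by simp
  then show ?thesis by (rule ex1_implies_ex)
qed

lemma decomp_unique:
  assumes A: "decomposition_set A" "active a" "v \<in> cells A (l + dtgt a + s)" "w \<in> cells A (l + dtgt a + s)"
    "sact A (glue l s a) v = sact A (glue l s a) w"
    "sact A (incl l (dtgt a) s) v = sact A (incl l (dtgt a) s) w"
  shows "v = w"
proof -
  let ?x = "sact A (glue l s a) w" and ?y = "sact A (incl l (dtgt a) s) w"
  have e: "glue l s a \<odot> incl l (dsrc a) s = incl l (dtgt a) s \<odot> a"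
    by (rule simplex_map_eqI) auto
  have "?x \<in> cells A (l + dsrc a + s)" "?y \<in> cells A (dtgt a)"
    using A(1,4) by (auto intro!: sact_in simp: decomposition_set_def)
  moreover have "sact A (incl l (dsrc a) s) ?x = sact A a ?y"
    using A(4) decomp_sset[OF A(1)] by (simp add: sact_sact e)
  ultimately have "\<exists>!w. w \<in> cells A (l + dtgt a + s) \<and> sact A (glue l s a) w = ?x \<and>
     sact A (incl l (dtgt a) s) w = ?y"
    using A(1,2) unfolding decomposition_set_def by simp
  then show ?thesis using A by blast
qed

text \<open>The interval \<open>I_f\<close> for an arbitrary simplicial set. For the objects of
  \<open>X\<close> it is \<open>I_int\<close>; for the arrows of \<open>X\<close> its simplices are
  the arrows lying over a fixed arrow of \<open>X_1\<close>.\<close>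

definition fib :: "('x, 'z) sset_scheme \<Rightarrow> 'x \<Rightarrow> 'x interval" where
  "fib A f =
     \<lparr>cells = \<lambda>n. {x \<in> cells A (n + 2). sact A (dlong (n + 2)) x = f},
      sact = \<lambda>p. \<lambda>x\<in>{x \<in> cells A (dtgt p + 2). sact A (dlong (dtgt p + 2)) x = f}. sact A (shift p) x,
      ibot = sact A (codegen 1 0) f,
      itop = sact A (codegen 1 1) f\<rparr>"

lemma fib_cells: "x \<in> cells (fib A f) n \<longleftrightarrow> x \<in> cells A (n + 2) \<and> sact A (dlong (n + 2)) x = f"
  by (simp add: fib_def)

lemma fib_sact: "x \<in> cells (fib A f) (dtgt p) \<Longrightarrow> sact (fib A f) p x = sact A (shift p) x"
  by (simp add: fib_def)

lemma codegen_ext: "codegen 1 0 = extend (vert 1 0)" "codegen 1 1 = extend (vert 1 1)"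
  by (rule simplex_map_eqI; auto)+

lemma fib_ends: "ibot (fib A f) = sact A (extend (vert 1 0)) f" "itop (fib A f) = sact A (extend (vert 1 1)) f"
  by (simp_all add: fib_def codegen_ext)

lemma fib_sact_in:
  assumes A: "sset A" and x: "x \<in> cells (fib A f) (dtgt p)"
  shows "sact A (shift p) x \<in> cells (fib A f) (dsrc p)"
proof -
  have "shift p \<odot> dlong (dsrc p + 2) = dlong (dtgt p + 2)" using active_dlong[of "shift p"] by simp
  then show ?thesis using x A by (auto simp: fib_cells sact_sact intro!: sact_in)
qed

lemma sset_fib:
  assumes A: "sset A"
  shows "sset (fib A f)"
  unfolding sset_def
proof (intro conjI allI impI)
  fix p
  show "sact (fib A f) p \<in> cells (fib A f) (dtgt p) \<rightarrow>\<^sub>E cells (fib A f) (dsrc p)"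
  proof
    show "sact (fib A f) p x \<in> cells (fib A f) (dsrc p)" if "x \<in> cells (fib A f) (dtgt p)" for x
      using that fib_sact_in[OF A that] by (simp add: fib_sact)
    show "sact (fib A f) p x = undefined" if "x \<notin> cells (fib A f) (dtgt p)" for x
      using that by (auto simp: fib_def)
  qed
next
  fix n show "sact (fib A f) (did n) = (\<lambda>x\<in>cells (fib A f) n. x)"
    by (rule extensionalityI[of _ "cells (fib A f) n"])
      (use sact_did[OF A, of _ "n + 2"] in \<open>auto simp: fib_def shift_did extensional_def\<close>)
next
  fix p q :: simplex_map assume pq: "dtgt p = dsrc q"
  show "sact (fib A f) (q \<odot> p) = compose (cells (fib A f) (dtgt q)) (sact (fib A f) p) (sact (fib A f) q)"
  proof (rule extensionalityI[of _ "cells (fib A f) (dtgt q)"])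
    show "sact (fib A f) (q \<odot> p) \<in> extensional (cells (fib A f) (dtgt q))"
      using pq by (simp add: fib_def extensional_def)
    fix x assume x: "x \<in> cells (fib A f) (dtgt q)"
    have "sact A (shift q) x \<in> cells (fib A f) (dtgt p)" using fib_sact_in[OF A x] pq by simp
    then show "sact (fib A f) (q \<odot> p) x =
      compose (cells (fib A f) (dtgt q)) (sact (fib A f) p) (sact (fib A f) q) x"
      using x pq A by (simp add: compose_eq fib_sact shift_dcomp sact_sact fib_cells)
  qed simp
qed

lemma one_add_add_one: "1 + k + 1 = k + (2 :: nat)" by simp

text \<open>A spine can be filled edge by edge, so induction on its length reduces the Segal
  condition to adding one edge at the last vertex.\<close>

lemma strict_segalI:
  assumes A: "sset A"
    and uniq: "\<And>n x y. n \<ge> 1 \<Longrightarrow> x \<in> cells A (n + 1) \<Longrightarrow> y \<in> cells A (n + 1) \<Longrightarrow>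
      sact A (incl 0 n 1) x = sact A (incl 0 n 1) y \<Longrightarrow>
      sact A (spine_edge (n + 1) n) x = sact A (spine_edge (n + 1) n) y \<Longrightarrow> x = y"
    and exist: "\<And>n x e. n \<ge> 1 \<Longrightarrow> x \<in> cells A n \<Longrightarrow> e \<in> cells A 1 \<Longrightarrow>
      sact A (vert n n) x = sact A (vert 1 0) e \<Longrightarrow>
      \<exists>w\<in>cells A (n + 1). sact A (incl 0 n 1) w = x \<and> sact A (spine_edge (n + 1) n) w = e"
  shows "strict_segal A"
  unfolding strict_segal_def
proof (intro allI impI)
  fix n :: nat assume n: "1 \<le> n"
  have incl_spine: "incl 0 n 1 \<odot> spine_edge n i = spine_edge (n + 1) i" if "i < n" for n i
    by (rule simplex_map_eqI) (use that in auto)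
  have spine1: "spine_edge 1 0 = did 1" by (rule simplex_map_eqI) auto
  have sp_in: "sact A (spine_edge n i) x \<in> cells A 1" if "x \<in> cells A n" "i < n" for n i x
    by (intro sact_in[OF A that(1)]) (use that in auto)
  have inj: "x = y" if "x \<in> cells A n" "y \<in> cells A n"
    "\<And>i. i < n \<Longrightarrow> sact A (spine_edge n i) x = sact A (spine_edge n i) y" for x y
    using n that
  proof (induction n arbitrary: x y rule: dec_induct)
    case base
    then show ?case using base(3)[of 0] sact_did[OF A] by (simp add: spine1)
  next
    case (step n)
    then have xy: "x \<in> cells A (n + 1)" "y \<in> cells A (n + 1)" by (simp_all add: Suc_eq_plus1)
    have *: "sact A (spine_edge (n + 1) i) x = sact A (spine_edge (n + 1) i) y" if "i < n + 1" for i
      using step.prems(3)[of i] that by (simp add: Suc_eq_plus1)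
    have "sact A (incl 0 n 1) x = sact A (incl 0 n 1) y"
    proof (rule step.IH)
      show "sact A (incl 0 n 1) x \<in> cells A n" "sact A (incl 0 n 1) y \<in> cells A n"
        by (intro sact_in[OF A xy(1)] sact_in[OF A xy(2)]; simp)+
      show "sact A (spine_edge n i) (sact A (incl 0 n 1) x) = sact A (spine_edge n i) (sact A (incl 0 n 1) y)"
        if "i < n" for i
        using that A xy *[of i] by (simp add: sact_sact incl_spine)
    qed
    then show ?case using uniq[OF step.hyps(1) xy] *[of n] by simp
  qed
  have surj: "\<exists>x\<in>cells A n. \<forall>i<n. sact A (spine_edge n i) x = e i"
    if "\<And>i. i < n \<Longrightarrow> e i \<in> cells A 1"
      "\<And>i. i + 1 < n \<Longrightarrow> sact A (vert 1 1) (e i) = sact A (vert 1 0) (e (i + 1))" for e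
    using n that
  proof (induction n rule: dec_induct)
    case base
    then show ?case using sact_did[OF A base(1)[of 0]] by (auto simp: spine1)
  next
    case (step n)
    then obtain x where x: "x \<in> cells A n" "\<forall>i<n. sact A (spine_edge n i) x = e i" by auto
    have "sact A (vert n n) x = sact A (vert 1 1) (sact A (spine_edge n (n - 1)) x)"
      using x(1) A step.hyps(1) spine_vert(2)[of "n - 1" n] by (simp add: sact_sact)
    also have "\<dots> = sact A (vert 1 0) (e n)"
      using x(2) step.hyps(1) step.prems(2)[of "n - 1"] by simp
    finally obtain w where w: "w \<in> cells A (n + 1)" "sact A (incl 0 n 1) w = x"
      "sact A (spine_edge (n + 1) n) w = e n"
      using exist[OF step.hyps(1) x(1), of "e n"] step.prems(1)[of n] by auto
    have "sact A (spine_edge (n + 1) i) w = e i" if "i < n + 1" for i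
    proof (cases "i = n")
      case True then show ?thesis using w by simp
    next
      case False
      then have "i < n" using that by simp
      then have "sact A (spine_edge (n + 1) i) w = sact A (spine_edge n i) x"
        using w A by (simp add: sact_sact incl_spine flip: w(2))
      then show ?thesis using x \<open>i < n\<close> by simp
    qed
    then show ?case using w(1) by (auto simp: Suc_eq_plus1)
  qed
  let ?f = "\<lambda>x. \<lambda>i\<in>{..<n}. sact A (spine_edge n i) x"
  let ?T = "{e \<in> {..<n} \<rightarrow>\<^sub>E cells A 1.
           \<forall>i. i + 1 < n \<longrightarrow> sact A (vert 1 1) (e i) = sact A (vert 1 0) (e (i + 1))}"
  show "bij_betw ?f (cells A n) ?T"
    unfolding bij_betw_def
  proof
    show "inj_on ?f (cells A n)"
    proof (rule inj_onI)
      fix x y assume xy: "x \<in> cells A n" "y \<in> cells A n" "?f x = ?f y"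
      have "sact A (spine_edge n i) x = sact A (spine_edge n i) y" if "i < n" for i
        using fun_cong[OF xy(3), of i] that by simp
      then show "x = y" using inj xy by blast
    qed
    show "?f ` cells A n = ?T"
    proof (intro equalityI subsetI)
      fix e assume "e \<in> ?f ` cells A n"
      then obtain x where x: "x \<in> cells A n" "e = ?f x" by blast
      have "sact A (vert 1 1) (sact A (spine_edge n i) x) = sact A (vert 1 0) (sact A (spine_edge n (i + 1)) x)"
        if "i + 1 < n" for i
        using that x A spine_vert(2)[of i n] spine_vert(1)[of "i + 1" n] by (simp add: sact_sact)
      then show "e \<in> ?T" using x sp_in by auto
    next
      fix e assume e: "e \<in> ?T"
      then obtain x where x: "x \<in> cells A n" "\<forall>i<n. sact A (spine_edge n i) x = e i"
        using surj[of e] by auto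
      have "e = ?f x"
        by (rule extensionalityI[of _ "{..<n}"]) (use e x in \<open>auto simp: PiE_def\<close>)
      then show "e \<in> ?f ` cells A n" using x by blast
    qed
  qed
qed

text \<open>The edge \<open>e\<close> to be added is a 3-simplex of \<open>A\<close> whose first
  edge runs from the start of \<open>f\<close> to the source of \<open>e\<close>. The simplex
  \<open>x\<close> without its last vertex, called \<open>z\<close>, subdivides that edge, and
  subdividing the first edge is a pushout of type \<open>glue 0 2\<close>.\<close>

lemma segal_fib:
  assumes A: "decomposition_set A"
  shows "strict_segal (fib A f)"
proof (rule strict_segalI)
  have sA: "sset A" using A by (rule decomp_sset)
  then show "sset (fib A f)" by (rule sset_fib)
  have g2: "shift (spine_edge (n + 1) n) = glue 0 2 (dlong (n + 1))" for n
    by (rule simplex_map_eqI) auto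
  have i2: "incl 0 (n + 1) 2 = shift (incl 0 n 1) \<odot> incl 0 (n + 1) 1" for n
    by (rule simplex_map_eqI) auto
  {
    fix n x y
    assume n: "1 \<le> n" and x: "x \<in> cells (fib A f) (n + 1)" and y: "y \<in> cells (fib A f) (n + 1)"
      and e1: "sact (fib A f) (incl 0 n 1) x = sact (fib A f) (incl 0 n 1) y"
      and e2: "sact (fib A f) (spine_edge (n + 1) n) x = sact (fib A f) (spine_edge (n + 1) n) y"
    have xA: "x \<in> cells A (n + 1 + 2)" and yA: "y \<in> cells A (n + 1 + 2)"
      using x y by (auto simp: fib_cells)
    show "x = y"
    proof (rule decomp_unique[OF A, of "dlong (n + 1)" _ 0 2])
      show "sact A (glue 0 2 (dlong (n + 1))) x = sact A (glue 0 2 (dlong (n + 1))) y"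
        using e2 x y by (simp add: fib_sact g2)
      have "sact A (shift (incl 0 n 1)) x = sact A (shift (incl 0 n 1)) y"
        using e1 x y by (simp add: fib_sact)
      then show "sact A (incl 0 (dtgt (dlong (n + 1))) 2) x = sact A (incl 0 (dtgt (dlong (n + 1))) 2) y"
        using sact_sact[OF sA, of x "shift (incl 0 n 1)" "incl 0 (n + 1) 1"]
          sact_sact[OF sA, of y "shift (incl 0 n 1)" "incl 0 (n + 1) 1"] xA yA
        by (simp add: i2)
    qed (use xA yA in \<open>auto simp: add.assoc\<close>)
  next
    fix n x e
    assume n: "1 \<le> n" and x: "x \<in> cells (fib A f) n" and e: "e \<in> cells (fib A f) 1"
      and xe: "sact (fib A f) (vert n n) x = sact (fib A f) (vert 1 0) e"
    have xA: "x \<in> cells A (n + 2)" and eA: "e \<in> cells A 3" and el: "sact A (dlong 3) e = f"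
      using x e by (auto simp: fib_cells)
    have xe': "sact A (shift (vert n n)) x = sact A (shift (vert 1 0)) e"
      using xe x e by (simp add: fib_sact)
    define z where "z = sact A (incl 0 (n + 1) 1) x"
    have zA: "z \<in> cells A (n + 1)" unfolding z_def by (intro sact_in[OF sA xA]) auto
    have "incl 0 1 2 = shift (vert 1 0) \<odot> incl 0 1 1"
      "incl 0 (n + 1) 1 \<odot> dlong (n + 1) = shift (vert n n) \<odot> incl 0 1 1"
      by (rule simplex_map_eqI; auto simp: le_Suc_eq One_nat_def)+
    then have "sact A (incl 0 1 2) e = sact A (dlong (n + 1)) z"
      using xA eA sA xe' sact_sact[OF sA, of x "shift (vert n n)" "incl 0 1 1"]
        sact_sact[OF sA, of e "shift (vert 1 0)" "incl 0 1 1"]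
        sact_sact[OF sA, of x "incl 0 (n + 1) 1" "dlong (n + 1)"] by (simp add: z_def add.assoc)
    then obtain w where w: "w \<in> cells A (n + 3)" "sact A (glue 0 2 (dlong (n + 1))) w = e"
      "sact A (incl 0 (n + 1) 2) w = z"
      using decomp_ex[OF A, of "dlong (n + 1)" e 0 2 z] eA zA by (auto simp: add.commute add.left_commute)
    have "glue 0 2 (dlong (n + 1)) \<odot> dlong 3 = dlong (n + 3)"
      using active_dlong[OF active_glue[of "dlong (n + 1)" 0 2]] by (simp add: add.assoc)
    then have wl: "sact A (dlong (n + 3)) w = f"
      using w(1) sA el sact_sact[OF sA, of w "glue 0 2 (dlong (n + 1))" "dlong 3"] w(2)
      by (simp add: add.assoc)
    have wf: "w \<in> cells (fib A f) (n + 1)" using w(1) wl by (simp add: fib_cells add.assoc)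
    \<comment> \<open>Both sides have the same initial part \<open>z\<close>, and omitting the inner
      vertices of that part leaves in both cases the 2-simplex that \<open>x\<close> and
      \<open>e\<close> share. Decomposition at \<open>glue 0 1\<close> identifies them.\<close>
    have "sact A (shift (incl 0 n 1)) w = x"
    proof (rule decomp_unique[OF A, of "dlong (n + 1)" _ 0 1])
      show "sact A (shift (incl 0 n 1)) w \<in> cells A (0 + dtgt (dlong (n + 1)) + 1)"
        by (intro sact_in[OF sA w(1)]) auto
      have "shift (incl 0 n 1) \<odot> glue 0 1 (dlong (n + 1)) = glue 0 2 (dlong (n + 1)) \<odot> shift (vert 1 0)"
        "glue 0 1 (dlong (n + 1)) = shift (vert n n)"
        by (rule simplex_map_eqI; auto simp: le_Suc_eq One_nat_def)+
      then show "sact A (glue 0 1 (dlong (n + 1))) (sact A (shift (incl 0 n 1)) w) =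
          sact A (glue 0 1 (dlong (n + 1))) x"
        using w xe' sact_sact[OF sA, of w "glue 0 2 (dlong (n + 1))" "shift (vert 1 0)"]
          sact_sact[OF sA, of w "shift (incl 0 n 1)" "glue 0 1 (dlong (n + 1))"] by (simp add: add.assoc)
      show "sact A (incl 0 (dtgt (dlong (n + 1))) 1) (sact A (shift (incl 0 n 1)) w) =
          sact A (incl 0 (dtgt (dlong (n + 1))) 1) x"
        using w sact_sact[OF sA, of w "shift (incl 0 n 1)" "incl 0 (n + 1) 1"]
        by (simp add: i2[symmetric] z_def add.assoc)
    qed (use xA in \<open>auto simp: add.assoc\<close>)
    then show "\<exists>w\<in>cells (fib A f) (n + 1). sact (fib A f) (incl 0 n 1) w = x \<and>
        sact (fib A f) (spine_edge (n + 1) n) w = e"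
      using w(2) wf by (intro bexI[of _ w]) (auto simp: fib_sact g2)
  }
qed

text \<open>The edge from bottom to \<open>x\<close> is the degeneracy of the 2-simplex
  \<open>x\<close> at its first vertex. No other edge is possible: if the source is bottom, the
  first edge of the 3-simplex is degenerate, and the decomposition property at the active map from
  \<open>[1]\<close> to \<open>[0]\<close> makes the 3-simplex degenerate there. Dually for
  top.\<close>

lemma dai_fib:
  assumes A: "decomposition_set A" and f: "f \<in> cells A 1"
  shows "discrete_algebraic_interval (fib A f)"
proof -
  have sA: "sset A" using A by (rule decomp_sset)
  have ends: "sact A (extend \<sigma>) f \<in> cells (fib A f) 0" if "dsrc \<sigma> = 0" "dtgt \<sigma> = 1" for \<sigma>
  proof -
    have "extend \<sigma> \<odot> dlong 2 = did 1" using active_dlong[of "extend \<sigma>"] that dlong_1 by simp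
    then show ?thesis
      using that f sA by (auto simp: fib_cells sact_sact sact_did intro!: sact_in)
  qed
  let ?a = "codegen 0 0"
  have act: "active ?a" by (simp add: active_def)
  have fv: "sact (fib A f) (vert 1 i) e = sact A (shift (vert 1 i)) e"
    if "e \<in> cells (fib A f) 1" "i \<le> 1" for e i
    using that by (simp add: fib_sact)
  have bot: "\<exists>!e. e \<in> cells (fib A f) 1 \<and> sact (fib A f) (vert 1 0) e = ibot (fib A f) \<and>
      sact (fib A f) (vert 1 1) e = x" if x: "x \<in> cells (fib A f) 0" for x
  proof -
    have xA: "x \<in> cells A 2" and xl: "sact A (dlong 2) x = f" using x by (auto simp: fib_cells)
    \<comment> \<open>The codegeneracy that repeats vertex 0, written as a \<open>glue\<close> to
      exhibit it as a pushout of the active map \<open>?a\<close>.\<close>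
    let ?g = "glue 0 2 ?a"
    let ?e = "sact A ?g x"
    have eqs: "?g \<odot> dlong 3 = dlong 2" "?g \<odot> shift (vert 1 1) = did 2"
        "?g \<odot> shift (vert 1 0) = dlong 2 \<odot> extend (vert 1 0)"
        "shift (vert 1 0) \<odot> incl 0 1 1 = incl 0 1 2"
        "extend (vert 1 0) \<odot> incl 0 1 1 = vert 1 0 \<odot> ?a"
      by (rule simplex_map_eqI; auto simp: le_Suc_eq One_nat_def numeral_eq_Suc)+
    have eA: "?e \<in> cells A 3" by (intro sact_in[OF sA xA]) auto
    have e: "?e \<in> cells (fib A f) 1"
      using eA xA xl sact_sact[OF sA, of x ?g "dlong 3"] by (simp add: fib_cells eqs)
    show ?thesis
    proof (rule ex1I[of _ ?e], intro conjI)
      show "?e \<in> cells (fib A f) 1" by fact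
      show "sact (fib A f) (vert 1 0) ?e = ibot (fib A f)"
        using e xA xl sact_sact[OF sA, of x ?g "shift (vert 1 0)"]
          sact_sact[OF sA, of x "dlong 2" "extend (vert 1 0)"] by (simp add: fv fib_ends eqs)
      show "sact (fib A f) (vert 1 1) ?e = x"
        using e xA sact_sact[OF sA, of x ?g "shift (vert 1 1)"] sact_did[OF sA xA]
        by (simp add: fv eqs)
      fix e' assume "e' \<in> cells (fib A f) 1 \<and> sact (fib A f) (vert 1 0) e' = ibot (fib A f) \<and>
        sact (fib A f) (vert 1 1) e' = x"
      then have e': "e' \<in> cells A 3" "sact A (shift (vert 1 0)) e' = sact A (extend (vert 1 0)) f"
        "sact A (shift (vert 1 1)) e' = x" by (auto simp: fv fib_ends) (simp add: fib_cells)
      have "sact A (incl 0 1 2) e' = sact A ?a (sact A (vert 1 0) f)"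
        using e' f sact_sact[OF sA, of e' "shift (vert 1 0)" "incl 0 1 1"]
          sact_sact[OF sA, of f "extend (vert 1 0)" "incl 0 1 1"]
          sact_sact[OF sA, of f "vert 1 0" ?a] by (simp add: eqs)
      then obtain w where w: "w \<in> cells A 2" "sact A ?g w = e'"
        using decomp_ex[OF A act, of e' 0 2 "sact A (vert 1 0) f"] e'(1)
          sact_in[OF sA f, of "vert 1 0" 0] by auto
      have "w = x"
        using e'(3) w sact_sact[OF sA, of w ?g "shift (vert 1 1)"] sact_did[OF sA w(1)]
        by (simp add: eqs)
      then show "e' = ?e" using w by simp
    qed
  qed
  have top: "\<exists>!e. e \<in> cells (fib A f) 1 \<and> sact (fib A f) (vert 1 0) e = x \<and>
      sact (fib A f) (vert 1 1) e = itop (fib A f)" if x: "x \<in> cells (fib A f) 0" for x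
  proof -
    have xA: "x \<in> cells A 2" and xl: "sact A (dlong 2) x = f" using x by (auto simp: fib_cells)
    let ?g = "glue 2 0 ?a"
    let ?e = "sact A ?g x"
    have eqs: "?g \<odot> dlong 3 = dlong 2" "?g \<odot> shift (vert 1 0) = did 2"
        "?g \<odot> shift (vert 1 1) = dlong 2 \<odot> extend (vert 1 1)"
        "shift (vert 1 1) \<odot> incl 1 1 0 = incl 2 1 0"
        "extend (vert 1 1) \<odot> incl 1 1 0 = vert 1 1 \<odot> ?a"
      by (rule simplex_map_eqI; auto simp: le_Suc_eq One_nat_def numeral_eq_Suc)+
    have eA: "?e \<in> cells A 3" by (intro sact_in[OF sA xA]) auto
    have e: "?e \<in> cells (fib A f) 1"
      using eA xA xl sact_sact[OF sA, of x ?g "dlong 3"] by (simp add: fib_cells eqs)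
    show ?thesis
    proof (rule ex1I[of _ ?e], intro conjI)
      show "?e \<in> cells (fib A f) 1" by fact
      show "sact (fib A f) (vert 1 1) ?e = itop (fib A f)"
        using e xA xl sact_sact[OF sA, of x ?g "shift (vert 1 1)"]
          sact_sact[OF sA, of x "dlong 2" "extend (vert 1 1)"] by (simp add: fv fib_ends eqs)
      show "sact (fib A f) (vert 1 0) ?e = x"
        using e xA sact_sact[OF sA, of x ?g "shift (vert 1 0)"] sact_did[OF sA xA]
        by (simp add: fv eqs)
      fix e' assume "e' \<in> cells (fib A f) 1 \<and> sact (fib A f) (vert 1 0) e' = x \<and>
        sact (fib A f) (vert 1 1) e' = itop (fib A f)"
      then have e': "e' \<in> cells A 3" "sact A (shift (vert 1 1)) e' = sact A (extend (vert 1 1)) f"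
        "sact A (shift (vert 1 0)) e' = x" by (auto simp: fv fib_ends) (simp add: fib_cells)
      have "sact A (incl 2 1 0) e' = sact A ?a (sact A (vert 1 1) f)"
        using e' f sact_sact[OF sA, of e' "shift (vert 1 1)" "incl 1 1 0"]
          sact_sact[OF sA, of f "extend (vert 1 1)" "incl 1 1 0"]
          sact_sact[OF sA, of f "vert 1 1" ?a] by (simp add: eqs)
      then obtain w where w: "w \<in> cells A 2" "sact A ?g w = e'"
        using decomp_ex[OF A act, of e' 2 0 "sact A (vert 1 1) f"] e'(1)
          sact_in[OF sA f, of "vert 1 1" 0] by auto
      have "w = x"
        using e'(3) w sact_sact[OF sA, of w ?g "shift (vert 1 0)"] sact_did[OF sA w(1)]
        by (simp add: eqs)
      then show "e' = ?e" using w by simp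
    qed
  qed
  show ?thesis
    unfolding discrete_algebraic_interval_def
    using sset_fib[OF sA] segal_fib[OF A] ends[of "vert 1 0"] ends[of "vert 1 1"] bot top
    by (simp add: fib_ends)
qed

section \<open>The culf projection and maps between intervals\<close>

definition fib_proj :: "('x, 'z) sset_scheme \<Rightarrow> 'x \<Rightarrow> nat \<Rightarrow> 'x \<Rightarrow> 'x" where
  "fib_proj A f n = (\<lambda>x\<in>cells (fib A f) n. sact A (iota n) x)"

lemma fib_proj_app [simp]: "x \<in> cells (fib A f) n \<Longrightarrow> fib_proj A f n x = sact A (iota n) x"
  by (simp add: fib_proj_def)

lemma smap_fib_proj: "sset A \<Longrightarrow> smap (fib A f) A (fib_proj A f)"
proof (rule smapI)
  assume A: "sset A"
  show "fib_proj A f n \<in> extensional (cells (fib A f) n)" for n by (simp add: fib_proj_def)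
  show "fib_proj A f n x \<in> cells A n" if "x \<in> cells (fib A f) n" for n x
    using that A by (auto simp: fib_cells fib_proj_def intro!: sact_in)
  show "fib_proj A f (dsrc p) (sact (fib A f) p x) = sact A p (fib_proj A f (dtgt p) x)"
    if "x \<in> cells (fib A f) (dtgt p)" for p x
    using that A fib_sact_in[OF A that] by (simp add: fib_sact sact_sact fib_cells shift_iota)
qed

text \<open>For \<open>l = s = 1\<close> the maps \<open>glue\<close> and \<open>incl\<close> are
  \<open>shift\<close> and \<open>iota\<close>, so the pullback squares of the projection are
  instances of the decomposition property.\<close>

lemma culf_fib_proj:
  assumes A: "decomposition_set A"
  shows "strict_culf (fib A f) A (fib_proj A f)"
proof (rule culfI)
  have sA: "sset A" using A by (rule decomp_sset)
  show "sset (fib A f)" "smap (fib A f) A (fib_proj A f)"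
    using sA by (simp_all add: sset_fib smap_fib_proj)
  {
    fix p x y
    assume *: "active p" "x \<in> cells (fib A f) (dtgt p)" "y \<in> cells (fib A f) (dtgt p)"
      "sact (fib A f) p x = sact (fib A f) p y" "fib_proj A f (dtgt p) x = fib_proj A f (dtgt p) y"
    show "x = y"
      by (rule decomp_unique[OF A *(1), of _ 1 1])
        (use * in \<open>auto simp: fib_sact glue_1_1 incl_1_1 fib_cells one_add_add_one\<close>)
  next
    fix p x y
    assume *: "active p" "x \<in> cells (fib A f) (dsrc p)" "y \<in> cells A (dtgt p)"
      "fib_proj A f (dsrc p) x = sact A p y"
    obtain w where w: "w \<in> cells A (dtgt p + 2)" "sact A (shift p) w = x" "sact A (iota (dtgt p)) w = y"
      using decomp_ex[OF A *(1), of x 1 1 y] * by (auto simp: glue_1_1 incl_1_1 fib_cells one_add_add_one)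
    have "sact A (dlong (dtgt p + 2)) w = f"
      using w *(2) sact_sact[OF sA, of w "shift p" "dlong (dsrc p + 2)"] active_dlong[of "shift p"]
      by (simp add: fib_cells)
    then show "\<exists>z\<in>cells (fib A f) (dtgt p). sact (fib A f) p z = x \<and> fib_proj A f (dtgt p) z = y"
      using w by (intro bexI[of _ w]) (auto simp: fib_sact fib_cells)
  }
qed

text \<open>As a function of \<sigma> this simplex is the stretched map belonging to
  \<open>x\<close>. The lemmas \<open>fib_sact_ext\<close>, \<open>fib_proj_ext\<close> and
  \<open>stretched_fib\<close> give its naturality, its image in \<open>A\<close> and its end
  points.\<close>

lemma fib_ext:
  assumes A: "sset A" and x: "x \<in> cells A n" and s: "dtgt \<sigma> = n"
  shows "sact A (extend \<sigma>) x \<in> cells (fib A (sact A (dlong n) x)) (dsrc \<sigma>)"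
proof -
  have "extend \<sigma> \<odot> dlong (dsrc \<sigma> + 2) = dlong n" using active_dlong[of "extend \<sigma>"] s by simp
  then show ?thesis using A x s by (auto simp: fib_cells sact_sact intro!: sact_in)
qed

lemma fib_sact_ext:
  assumes A: "sset A" and x: "x \<in> cells A n" and s: "dtgt \<sigma> = n" and r: "dtgt r = dsrc \<sigma>"
  shows "sact (fib A (sact A (dlong n) x)) r (sact A (extend \<sigma>) x) = sact A (extend (\<sigma> \<odot> r)) x"
  using fib_ext[OF A x s] r A x s by (simp add: fib_sact sact_sact ext_shift)

lemma fib_long_edge:
  assumes A: "decomposition_set A" and f: "f \<in> cells A 1"
  shows "long_edge (fib A f) e \<longleftrightarrow> e = sact A (extend (did 1)) f"
proof -
  have sA: "sset A" using A by (rule decomp_sset)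
  have fl: "sact A (dlong 1) f = f" using sact_did[OF sA f] by (simp add: dlong_1)
  have "long_edge (fib A f) (sact A (extend (did 1)) f)"
    using fib_ext[OF sA f, of "did 1"] fib_sact_ext[OF sA f, of "did 1" "vert 1 0"]
      fib_sact_ext[OF sA f, of "did 1" "vert 1 1"]
    by (simp add: long_edge_def fl fib_ends)
  then show ?thesis using dai_long_edge[OF dai_fib[OF A f]] by blast
qed

lemma fib_proj_ext:
  assumes A: "sset A" and x: "x \<in> cells A n" and s: "dtgt \<sigma> = n" "dsrc \<sigma> = k"
  shows "fib_proj A (sact A (dlong n) x) k (sact A (extend \<sigma>) x) = sact A \<sigma> x"
  using fib_ext[OF A x s(1)] A x s ext_iota[of \<sigma>] by (simp add: sact_sact)

lemma stretched_fib:
  assumes A: "sset A" and x: "x \<in> cells A n"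
  shows "stretched (std_simplex n) (fib A (sact A (dlong n) x))
    (yoneda (fib A (sact A (dlong n) x)) n (sact A (extend (did n)) x))"
proof -
  let ?f = "sact A (dlong n) x"
  have "sact A (extend (vert 1 i)) ?f = sact A (extend (vert n (dapp (dlong n) i))) x" if "i \<le> 1" for i
    using A x that vert_dcomp[of i "dlong n"] active_dcomp_ext[of "dlong n" "vert 1 i"]
    by (simp add: sact_sact)
  from this[of 0] this[of 1] show ?thesis
    using fib_ext[OF A x, of "did n"] fib_sact_ext[OF A x, of "did n" "vert n 0"]
      fib_sact_ext[OF A x, of "did n" "vert n n"]
    by (subst stretched_yoneda[OF sset_fib[OF A]]) (auto simp: fib_ends)
qed

text \<open>The projection of the interval of \<open>f'\<close> is lifted along the culf projection
  of the interval of \<open>f\<close>. The value prescribed at the long edge is the edge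
  \<open>f'\<close> of \<open>x\<close>, seen inside the interval of \<open>f\<close>.\<close>

lemma fib_map_ex:
  assumes A: "decomposition_set A" and x: "x \<in> cells A n" and p: "dtgt p = n" "dsrc p = m"
    and x': "x' = sact A p x" and f: "f = sact A (dlong n) x" and f': "f' = sact A (dlong m) x'"
  shows "\<exists>c. smap (fib A f') (fib A f) c \<and> c m (sact A (extend (did m)) x') = sact A (extend p) x \<and>
    scomp (fib A f') (fib_proj A f) c = fib_proj A f'"
proof -
  have sA: "sset A" using A by (rule decomp_sset)
  have x'A: "x' \<in> cells A m" unfolding x' using sact_in[OF sA x, of p m] p by simp
  have fA: "f \<in> cells A 1" unfolding f using sact_in[OF sA x, of "dlong n" 1] by simp
  have f'A: "f' \<in> cells A 1" unfolding f' using sact_in[OF sA x'A, of "dlong m" 1] by simp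
  have f'x: "f' = sact A (p \<odot> dlong m) x" unfolding f' x' using x p sA by (simp add: sact_sact)
  note proj = culf_fib_proj[OF A, of f]
  let ?e = "sact A (extend (p \<odot> dlong m)) x"
  have e: "?e \<in> cells (fib A f) 1" unfolding f using fib_ext[OF sA x, of "p \<odot> dlong m"] p by simp
  \<comment> \<open>The long edge of the interval of \<open>f'\<close> projects to
    \<open>f'\<close>, and so does \<open>?e\<close>.\<close>
  have "fib_proj A f 1 ?e = fib_proj A f' 1 e" if "long_edge (fib A f') e" for e
    using that fib_proj_ext[OF sA x, of "p \<odot> dlong m" 1] p
      fib_proj_ext[OF sA f'A, of "did 1" 1] sact_did[OF sA f'A]
    by (simp add: fib_long_edge[OF A f'A] f[symmetric] dlong_1 f'x[symmetric])
  then obtain c where c: "smap (fib A f') (fib A f) c" "scomp (fib A f') (fib_proj A f) c = fib_proj A f'"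
    "\<And>e. long_edge (fib A f') e \<Longrightarrow> c 1 e = ?e"
    using culf_lift[OF dai_has_cones[OF dai_fib[OF A f'A]] sset_fib[OF sA] proj smap_fib_proj[OF sA] e]
    by metis
  have h: "sact A (extend (did m)) x' \<in> cells (fib A f') m"
    unfolding f' using fib_ext[OF sA x'A, of "did m"] by simp
  have xp: "sact A (extend p) x \<in> cells (fib A f) m"
    unfolding f using fib_ext[OF sA x, of p] p by simp
  \<comment> \<open>Both sides have the same projection and the same long edge, and the projection
    is culf.\<close>
  have "c m (sact A (extend (did m)) x') = sact A (extend p) x"
  proof (rule culf_inj[OF proj, of "dlong m", unfolded dlong_simps])
    show "c m (sact A (extend (did m)) x') \<in> cells (fib A f) m" by (rule smap_in[OF c(1) h])
    have "sact (fib A f') (dlong m) (sact A (extend (did m)) x') = sact A (extend (did 1)) f'"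
      unfolding f' using fib_sact_ext[OF sA x'A, of "did m" "dlong m"]
        active_dcomp_ext[of "dlong m" "did 1"] sact_sact[OF sA, of x' "dlong m" "extend (did 1)"] x'A by simp
    then have "c 1 (sact (fib A f') (dlong m) (sact A (extend (did m)) x')) = ?e"
      using c(3) fib_long_edge[OF A f'A] by simp
    then show "sact (fib A f) (dlong m) (c m (sact A (extend (did m)) x')) =
        sact (fib A f) (dlong m) (sact A (extend p) x)"
      using smap_sact[OF c(1) h, of "dlong m" 1] fib_sact_ext[OF sA x, of p "dlong m"] p
      by (simp add: f)
    show "fib_proj A f m (c m (sact A (extend (did m)) x')) = fib_proj A f m (sact A (extend p) x)"
      using scomp_eq_app[OF c(2) h] fib_proj_ext[OF sA x'A, of "did m" m] sact_did[OF sA x'A]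
        fib_proj_ext[OF sA x, of p m] p by (simp add: f f' x')
  qed (use xp in auto)
  then show ?thesis using c by blast
qed

text \<open>The 3-simplex \<open>extend (p \<odot> dlong m)\<close> of \<open>x\<close> has as
  middle edge the long edge of \<open>y\<close>. Subdividing that edge by \<open>y\<close> is a
  pushout of type \<open>glue 1 1\<close>; hence the dimension \<open>1 + (k + 2) + 1\<close> of
  \<open>w\<close>.\<close>

lemma fib_pull_ex:
  assumes A: "decomposition_set A" and x: "x \<in> cells A n" and p: "dtgt p = n" "dsrc p = m"
    and y: "y \<in> cells (fib A (sact A (dlong m) (sact A p x))) k"
  shows "\<exists>w\<in>cells A (k + 4). sact A (shift (dlong (k + 2))) w = sact A (extend (p \<odot> dlong m)) x \<and>
    sact A (iota (k + 2)) w = y"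
proof -
  have sA: "sset A" using A by (rule decomp_sset)
  let ?e = "sact A (extend (p \<odot> dlong m)) x"
  have "extend (p \<odot> dlong m) \<odot> iota 1 = p \<odot> dlong m" using ext_iota[of "p \<odot> dlong m"] p by simp
  then have "sact A (incl 1 1 1) ?e = sact A (dlong (k + 2)) y"
    using y x p sA by (simp add: incl_1_1 fib_cells sact_sact)
  moreover have "?e \<in> cells A 3" using p by (intro sact_in[OF sA x]) auto
  ultimately show ?thesis
    using decomp_ex[OF A, of "dlong (k + 2)" ?e 1 1 y] y
    by (auto simp: glue_1_1 incl_1_1 fib_cells one_add_add_one add.commute[of k 4])
qed

text \<open>The lift of the cone over \<open>y\<close> along the projection is \<open>w\<close>, which makes \<open>c\<close> explicit.\<close>

lemma fib_map_char:
  assumes A: "decomposition_set A" and x: "x \<in> cells A n" and p: "dtgt p = n" "dsrc p = m"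
    and x': "x' = sact A p x" and f: "f = sact A (dlong n) x" and f': "f' = sact A (dlong m) x'"
    and c: "smap (fib A f') (fib A f) c" "c m (sact A (extend (did m)) x') = sact A (extend p) x"
      "scomp (fib A f') (fib_proj A f) c = fib_proj A f'"
    and y: "y \<in> cells (fib A f') k"
    and w: "w \<in> cells A (k + 4)" "sact A (shift (dlong (k + 2))) w = sact A (extend (p \<odot> dlong m)) x"
      "sact A (iota (k + 2)) w = y"
  shows "c k y = sact A (shift (iota k)) w"
proof -
  have sA: "sset A" using A by (rule decomp_sset)
  have x'A: "x' \<in> cells A m" unfolding x' using sact_in[OF sA x, of p m] p by simp
  have f'A: "f' \<in> cells A 1" unfolding f' using sact_in[OF sA x'A, of "dlong m" 1] by simp
  have yA: "y \<in> cells A (k + 2)" and yl: "f' = sact A (dlong (k + 2)) y" using y by (auto simp: fib_cells)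
  \<comment> \<open>The cone over \<open>y\<close> in its own interval; as a simplex of
    \<open>A\<close> it repeats the two end vertices of \<open>y\<close>.\<close>
  let ?t = "sact A (extend (did (k + 2))) y"
  have t: "?t \<in> cells (fib A f') (k + 2)" using fib_ext[OF sA yA, of "did (k + 2)"] by (simp add: yl)
  have "extend (iota k) = did (k + 2)" by (rule simplex_map_eqI) auto
  then have ty: "sact (fib A f') (iota k) ?t = y"
    using fib_sact_ext[OF sA yA, of "did (k + 2)" "iota k"] sact_did[OF sA yA] by (simp add: yl)
  have h: "sact A (extend (did m)) x' \<in> cells (fib A f') m"
    unfolding f' using fib_ext[OF sA x'A, of "did m"] by simp
  have hl: "sact (fib A f') (dlong m) (sact A (extend (did m)) x') = sact A (extend (did 1)) f'"
    unfolding f' using fib_sact_ext[OF sA x'A, of "did m" "dlong m"]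
      active_dcomp_ext[of "dlong m" "did 1"] sact_sact[OF sA, of x' "dlong m" "extend (did 1)"] x'A by simp
  have tl: "sact (fib A f') (dlong (k + 2)) ?t = sact A (extend (did 1)) f'"
    unfolding yl using fib_sact_ext[OF sA yA, of "did (k + 2)" "dlong (k + 2)"]
      active_dcomp_ext[of "dlong (k + 2)" "did 1"] sact_sact[OF sA, of y "dlong (k + 2)" "extend (did 1)"] yA
    by simp
  have ce: "c 1 (sact A (extend (did 1)) f') = sact A (extend (p \<odot> dlong m)) x"
    using smap_sact[OF c(1) h, of "dlong m" 1] c(2) fib_sact_ext[OF sA x, of p "dlong m"] p
    by (simp add: hl f)
  have "shift (dlong (k + 2)) \<odot> dlong 3 = dlong (k + 4)"
    using active_dlong[of "shift (dlong (k + 2))"] by (simp add: add.assoc)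
  then have "sact A (dlong (k + 4)) w = sact A (dlong 3) (sact A (shift (dlong (k + 2))) w)"
    using w(1) sA by (simp add: sact_sact add.assoc)
  also have "\<dots> = f"
    using fib_ext[OF sA x, of "p \<odot> dlong m"] p w(2) by (simp add: fib_cells f)
  finally have wf: "w \<in> cells (fib A f) (k + 2)" using w(1) by (simp add: fib_cells add.assoc)
  have "c (k + 2) ?t = w"
  proof (rule culf_inj[OF culf_fib_proj[OF A], of "dlong (k + 2)" _ f, unfolded dlong_simps])
    show "c (k + 2) ?t \<in> cells (fib A f) (k + 2)" by (rule smap_in[OF c(1) t])
    show "sact (fib A f) (dlong (k + 2)) (c (k + 2) ?t) = sact (fib A f) (dlong (k + 2)) w"
      using smap_sact[OF c(1) t, of "dlong (k + 2)" 1] wf w(2) by (simp add: fib_sact tl ce)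
    show "fib_proj A f (k + 2) (c (k + 2) ?t) = fib_proj A f (k + 2) w"
      using scomp_eq_app[OF c(3) t] fib_proj_ext[OF sA yA, of "did (k + 2)" "k + 2"] wf w(3)
        sact_did[OF sA yA] by (simp add: yl)
  qed (use wf in auto)
  then show ?thesis
    using smap_sact[OF c(1) t, of "iota k" k] ty wf by (simp add: fib_sact)
qed

text \<open>The simplex \<open>w\<close> is found from \<open>x\<close>, \<open>p\<close> and
  \<open>y\<close> only, so both maps have the same value at \<open>y\<close>.\<close>

lemma fib_map_unique:
  assumes A: "decomposition_set A" and x: "x \<in> cells A n" and p: "dtgt p = n" "dsrc p = m"
    and x': "x' = sact A p x" and f: "f = sact A (dlong n) x" and f': "f' = sact A (dlong m) x'"
    and c: "smap (fib A f') (fib A f) c" "c m (sact A (extend (did m)) x') = sact A (extend p) x"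
      "scomp (fib A f') (fib_proj A f) c = fib_proj A f'"
    and d: "smap (fib A f') (fib A f) d" "d m (sact A (extend (did m)) x') = sact A (extend p) x"
      "scomp (fib A f') (fib_proj A f) d = fib_proj A f'"
  shows "c = d"
proof (rule smap_eqI[OF c(1) d(1)])
  fix k y assume y: "y \<in> cells (fib A f') k"
  obtain w where w: "w\<in>cells A (k + 4)" "sact A (shift (dlong (k + 2))) w = sact A (extend (p \<odot> dlong m)) x"
    "sact A (iota (k + 2)) w = y"
    using fib_pull_ex[OF A x p, of y k] y unfolding f' x' by blast
  show "c k y = d k y"
    using fib_map_char[OF A x p x' f f' c y w] fib_map_char[OF A x p x' f f' d y w] by simp
qed

text \<open>By cancellation, since the composite with the culf projection of \<open>f\<close> is the
  culf projection of \<open>f'\<close>.\<close>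

lemma culf_fib_map:
  assumes A: "decomposition_set A" and c: "smap (fib A f') (fib A f) c"
      "scomp (fib A f') (fib_proj A f) c = fib_proj A f'"
  shows "strict_culf (fib A f') (fib A f) c"
  by (rule culf_cancel[OF sset_fib[OF decomp_sset[OF A]] c(1) culf_fib_proj[OF A]])
    (simp add: c(2) culf_fib_proj[OF A])

section \<open>The pseudo-simplicial groupoid of subdivided intervals\<close>

lemma U_ob_iff: "x \<in> U_ob n \<longleftrightarrow>
    discrete_algebraic_interval (fst x) \<and> stretched (std_simplex n) (fst x) (snd x)"
  by (cases x) (simp add: U_ob_def)

lemma U_ar_iff: "(x, y, F) \<in> U_ar n \<longleftrightarrow> x \<in> U_ob n \<and> y \<in> U_ob n \<and> siso (fst x) (fst y) F \<and>
    scomp (std_simplex n) F (snd x) = snd y"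
  by (cases x; cases y) (simp add: U_ar_def)

lemma U_arD:
  assumes "(x, y, F) \<in> U_ar n"
  shows "x \<in> U_ob n" "y \<in> U_ob n" "siso (fst x) (fst y) F" "smap (fst x) (fst y) F"
    "scomp (std_simplex n) F (snd x) = snd y"
  using assms by (auto simp: U_ar_iff dest: sisoD)

lemma U_obD:
  assumes "x \<in> U_ob n"
  shows "discrete_algebraic_interval (fst x)" "sset (fst x)" "smap (std_simplex n) (fst x) (snd x)"
    "has_cones (fst x)"
  using assms by (auto simp: U_ob_iff stretched_def daiD dai_has_cones)

section \<open>Long edges and orthogonality\<close>

lemma U_ob_long_edge:
  assumes "x \<in> U_ob n"
  shows "long_edge (fst x) (snd x 1 (dlong n))"
proof -
  have a: "smap (std_simplex n) (fst x) (snd x)" "snd x 0 (vert n 0) = ibot (fst x)"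
    "snd x 0 (vert n n) = itop (fst x)"
    using assms by (auto simp: U_ob_iff stretched_def std_simplex_ends)
  have "dlong n \<odot> vert 1 0 = vert n 0" "dlong n \<odot> vert 1 1 = vert n n"
    using vert_dcomp[of 0 "dlong n"] vert_dcomp[of 1 "dlong n"] by auto
  then show ?thesis
    using smap_sact[OF a(1), of "dlong n" 1 "vert 1 0" 0] smap_sact[OF a(1), of "dlong n" 1 "vert 1 1" 0]
      smap_in[OF a(1), of "dlong n" 1] a(2,3)
    by (simp add: long_edge_def std_simplex_sact)
qed

lemma U_ob_long_edge_eq:
  assumes "x \<in> U_ob n" "long_edge (fst x) e"
  shows "e = snd x 1 (dlong n)"
  using dai_long_edge[OF U_obD(1)[OF assms(1)]] U_ob_long_edge[OF assms(1)] assms(2) by blast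

text \<open>A subdivision reaches the only long edge of its interval, so maps that agree on the
  subdivision agree on long edges.\<close>

lemma U_map_unique:
  assumes x: "x \<in> U_ob n" and j: "strict_culf B C j" and G: "smap (fst x) B G" "smap (fst x) B G'"
    and jG: "\<And>k u. u \<in> cells (fst x) k \<Longrightarrow> j k (G k u) = j k (G' k u)"
    and a: "scomp (std_simplex n) G (snd x) = scomp (std_simplex n) G' (snd x)"
  shows "G = G'"
proof (rule culf_unique[OF U_obD(4)[OF x] j G jG])
  fix e assume "long_edge (fst x) e"
  then have "e = snd x 1 (dlong n)" by (rule U_ob_long_edge_eq[OF x])
  then show "G 1 e = G' 1 e" using scomp_cong_app[OF a, of "dlong n" 1] by simp
qed

text \<open>The value prescribed at the long edge is the long edge of the subdivision
  \<open>snd y\<close>. That the whole subdivision is respected follows from uniqueness of culf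
  lifts of maps out of a standard simplex.\<close>

lemma culf_factor_map:
  assumes x: "x \<in> U_ob m" and y: "y \<in> U_ob m"
    and i: "smap (fst x) B i" and j: "strict_culf (fst y) B j"
    and ij: "scomp (std_simplex m) i (snd x) = scomp (std_simplex m) j (snd y)"
  obtains G where "smap (fst x) (fst y) G" "scomp (std_simplex m) G (snd x) = snd y"
    "scomp (fst x) j G = i"
proof -
  let ?e = "snd y 1 (dlong m)"
  have "?e \<in> cells (fst y) 1" using smap_in[OF U_obD(3)[OF y], of "dlong m" 1] by simp
  moreover have "j 1 ?e = i 1 e" if "long_edge (fst x) e" for e
    using U_ob_long_edge_eq[OF x that] scomp_cong_app[OF ij, of "dlong m" 1] by simp
  ultimately obtain G where G: "smap (fst x) (fst y) G" "scomp (fst x) j G = i"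
    "\<And>e. long_edge (fst x) e \<Longrightarrow> G 1 e = ?e"
    using culf_lift[OF U_obD(4)[OF x] U_obD(2)[OF y] j i] by metis
  have "scomp (std_simplex m) G (snd x) = snd y"
  proof (rule culf_unique[OF has_cones_std_simplex j smap_scomp[OF sset_std_simplex U_obD(3)[OF x] G(1)]
        U_obD(3)[OF y]])
    show "j n (scomp (std_simplex m) G (snd x) n s) = j n (snd y n s)" if "s \<in> cells (std_simplex m) n" for n s
      using that scomp_cong_app[OF ij that] scomp_eq_app[OF G(2), of "snd x n s" n]
        smap_in[OF U_obD(3)[OF x] that] by simp
    show "scomp (std_simplex m) G (snd x) 1 e = snd y 1 e" if "long_edge (std_simplex m) e" for e
      using that G(3)[OF U_ob_long_edge[OF x]] by (simp add: std_simplex_long_edge)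
  qed
  then show thesis using that G by blast
qed

text \<open>Lifting in both directions gives maps whose composites lie over \<open>B\<close> and fix
  the subdivision, hence are identities.\<close>

lemma culf_factor_iso:
  assumes x: "x \<in> U_ob m" and y: "y \<in> U_ob m"
    and i: "strict_culf (fst x) B i" and j: "strict_culf (fst y) B j"
    and ij: "scomp (std_simplex m) i (snd x) = scomp (std_simplex m) j (snd y)"
  shows "\<exists>!G. siso (fst x) (fst y) G \<and> scomp (std_simplex m) G (snd x) = snd y \<and> scomp (fst x) j G = i"
proof -
  obtain G where G: "smap (fst x) (fst y) G" "scomp (std_simplex m) G (snd x) = snd y"
    "scomp (fst x) j G = i" by (rule culf_factor_map[OF x y culfD[OF i] j ij])
  obtain H where H: "smap (fst y) (fst x) H" "scomp (std_simplex m) H (snd y) = snd x"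
    "scomp (fst y) i H = j" by (rule culf_factor_map[OF y x culfD[OF j] i ij[symmetric]])
  have inv: "scomp (fst z) K' K = sid (fst z)"
    if z: "z \<in> U_ob m" "z' \<in> U_ob m" and iz: "strict_culf (fst z) B iz"
      and K: "smap (fst z) (fst z') K" "scomp (std_simplex m) K (snd z) = snd z'" "scomp (fst z) jz K = iz"
      and K': "smap (fst z') (fst z) K'" "scomp (std_simplex m) K' (snd z') = snd z" "scomp (fst z') iz K' = jz"
    for z z' K K' iz jz
  proof (rule U_map_unique[OF z(1) iz smap_scomp[OF U_obD(2)[OF z(1)] K(1) K'(1)] smap_sid[OF U_obD(2)[OF z(1)]]])
    show "iz k (scomp (fst z) K' K k u) = iz k (sid (fst z) k u)" if "u \<in> cells (fst z) k" for k u
      using that scomp_eq_app[OF K(3) that] scomp_eq_app[OF K'(3) smap_in[OF K(1) that]] by simp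
    show "scomp (std_simplex m) (scomp (fst z) K' K) (snd z) = scomp (std_simplex m) (sid (fst z)) (snd z)"
      using scomp_assoc[OF U_obD(3)[OF z(1)], of K' K] scomp_sid_left[OF U_obD(3)[OF z(1)]] K(2) K'(2)
      by simp
  qed
  have "siso (fst x) (fst y) G"
    unfolding siso_def using G H inv[OF x y i G H] inv[OF y x j H G] by blast
  then show ?thesis
  proof (intro ex1I[of _ G] conjI G)
    fix G' assume G': "siso (fst x) (fst y) G' \<and> scomp (std_simplex m) G' (snd x) = snd y \<and>
      scomp (fst x) j G' = i"
    show "G' = G"
      by (rule U_map_unique[OF x j])
        (use G G' sisoD scomp_eq_app[OF G(3)] scomp_eq_app[of "fst x" j G' i] in auto)
  qed
qed

lemma comparison_props:
  assumes x: "x \<in> U_ob m" and y: "y \<in> U_ob m"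
    and i: "strict_culf (fst x) B i" and j: "strict_culf (fst y) B j"
    and ij: "scomp (std_simplex m) i (snd x) = scomp (std_simplex m) j (snd y)"
  obtains G where "comparison m x i y j = (x, y, G)" "(x, y, G) \<in> U_ar m"
    "\<And>k u. u \<in> cells (fst x) k \<Longrightarrow> j k (G k u) = i k u"
proof -
  let ?G = "THE G. siso (fst x) (fst y) G \<and>
        scomp (std_simplex m) G (snd x) = snd y \<and> scomp (fst x) j G = i"
  have "siso (fst x) (fst y) ?G \<and>
        scomp (std_simplex m) ?G (snd x) = snd y \<and> scomp (fst x) j ?G = i"
    by (rule theI'[OF culf_factor_iso[OF x y i j ij]])
  then show thesis
    using that[of ?G] x y by (auto simp: comparison_def U_ar_iff scomp_eq_app)
qed

text \<open>Arrows respect the subdivisions, so they may be compared after a culf map out of the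
  common target. The coherence equations below are reduced to equations of culf maps in this
  way.\<close>

lemma U_ar_eqI:
  assumes F: "(x, y, F) \<in> U_ar n" and G: "(x, y, G) \<in> U_ar n" and j: "strict_culf (fst y) C j"
    and jFG: "\<And>k u. u \<in> cells (fst x) k \<Longrightarrow> j k (F k u) = j k (G k u)"
  shows "F = G"
  by (rule U_map_unique[OF U_arD(1)[OF F] j U_arD(4)[OF F] U_arD(4)[OF G] jFG])
    (use U_arD(5)[OF F] U_arD(5)[OF G] in auto)

lemma U_ar_eqI':
  assumes F: "(x, y, F) \<in> U_ar n" and G: "(x, y, G) \<in> U_ar n"
    and FG: "\<And>k u. u \<in> cells (fst x) k \<Longrightarrow> F k u = G k u"
  shows "F = G"
  by (rule smap_eqI[OF U_arD(4)[OF F] U_arD(4)[OF G] FG])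

section \<open>The levels of U as groupoids\<close>

lemma U_lev_simps [simp]:
  "Ob (U_lev n) = U_ob n" "Ar (U_lev n) = U_ar n" "src (U_lev n) (x, y, F) = x"
  "tgt (U_lev n) (x, y, F) = y" "idn (U_lev n) x = (x, x, sid (fst x))"
  "cmp (U_lev n) (y', z, G) (x, y, F) = (x, z, scomp (fst x) G F)"
  by (simp_all add: U_lev_def)

lemma arrow_U: "arrow (U_lev n) f x y \<longleftrightarrow> (\<exists>F. f = (x, y, F) \<and> (x, y, F) \<in> U_ar n)"
  by (cases f) (auto simp: arrow_def)

lemma U_ar_id: "x \<in> U_ob n \<Longrightarrow> (x, x, sid (fst x)) \<in> U_ar n"
  using U_obD[of x n] by (simp add: U_ar_iff siso_sid scomp_sid_left)

lemma U_ar_comp: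
  assumes F: "(x, y, F) \<in> U_ar n" and G: "(y, z, G) \<in> U_ar n"
  shows "(x, z, scomp (fst x) G F) \<in> U_ar n"
proof -
  note x = U_obD[OF U_arD(1)[OF F]] and y = U_obD[OF U_arD(2)[OF F]] and z = U_obD[OF U_arD(2)[OF G]]
  show ?thesis
    using U_arD[OF F] U_arD[OF G] siso_scomp[OF x(2) y(2) z(2)] scomp_assoc[OF x(3), of G F]
    by (simp add: U_ar_iff)
qed

lemma U_ar_inv:
  assumes F: "(x, y, F) \<in> U_ar n"
  obtains G where "(y, x, G) \<in> U_ar n" "scomp (fst x) G F = sid (fst x)" "scomp (fst y) F G = sid (fst y)"
proof -
  obtain G where G: "siso (fst y) (fst x) G" "scomp (fst x) G F = sid (fst x)"
    "scomp (fst y) F G = sid (fst y)"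
    using siso_inv[OF U_arD(3)[OF F]] by blast
  note x = U_obD[OF U_arD(1)[OF F]]
  have "scomp (std_simplex n) G (snd y) = snd x"
    using scomp_assoc[OF x(3), of G F] scomp_sid_left[OF x(3)] U_arD(5)[OF F] G(2) by simp
  then show thesis using that[OF _ G(2,3)] U_arD[OF F] G(1) by (simp add: U_ar_iff)
qed

lemma groupoid_U: "groupoid (U_lev n)"
  unfolding groupoid_def
proof (intro conjI ballI allI impI)
  fix f assume "f \<in> Ar (U_lev n)"
  then show "src (U_lev n) f \<in> Ob (U_lev n)" "tgt (U_lev n) f \<in> Ob (U_lev n)"
    by (cases f; auto simp: U_ar_iff)+
next
  fix x :: "'a subdiv" assume "x \<in> Ob (U_lev n)"
  then show "arrow (U_lev n) (idn (U_lev n) x) x x" by (simp add: arrow_U U_ar_id)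
next
  fix x y z and f g :: "'a subdiv_arrow"
  assume "arrow (U_lev n) f x y \<and> arrow (U_lev n) g y z"
  then show "arrow (U_lev n) (cmp (U_lev n) g f) x z" by (auto simp: arrow_U intro: U_ar_comp)
next
  fix x y and f :: "'a subdiv_arrow"
  assume "arrow (U_lev n) f x y"
  then obtain F where F: "f = (x, y, F)" "(x, y, F) \<in> U_ar n" by (auto simp: arrow_U)
  show "cmp (U_lev n) f (idn (U_lev n) x) = f" "cmp (U_lev n) (idn (U_lev n) y) f = f"
    using scomp_sid_left[OF U_arD(4)[OF F(2)]] scomp_sid_right[OF U_arD(4)[OF F(2)]] by (simp_all add: F)
  obtain G where "(y, x, G) \<in> U_ar n" "scomp (fst x) G F = sid (fst x)" "scomp (fst y) F G = sid (fst y)"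
    using U_ar_inv[OF F(2)] by blast
  then show "\<exists>g. arrow (U_lev n) g y x \<and> cmp (U_lev n) g f = idn (U_lev n) x \<and>
      cmp (U_lev n) f g = idn (U_lev n) y"
    by (intro exI[of _ "(y, x, G)"]) (simp add: arrow_U F)
next
  fix w x y z and f g h :: "'a subdiv_arrow"
  assume "arrow (U_lev n) f w x \<and> arrow (U_lev n) g x y \<and> arrow (U_lev n) h y z"
  then obtain F G H where F: "f = (w, x, F)" "(w, x, F) \<in> U_ar n" and "g = (x, y, G)" "h = (y, z, H)"
    by (auto simp: arrow_U)
  then show "cmp (U_lev n) h (cmp (U_lev n) g f) = cmp (U_lev n) (cmp (U_lev n) h g) f"
    using scomp_assoc[OF U_arD(4)[OF F(2)]] by simp
qed

section \<open>Functors and coherence isomorphisms from chosen factorisations\<close>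

context
  fixes ch :: "'u factorisations"
  assumes ch: "factorisation_choice ch"
begin

lemma ch_props:
  assumes "x \<in> U_ob (dtgt p)"
  shows "fst (ch p x) \<in> U_ob (dsrc p)" "strict_culf (fst (fst (ch p x))) (fst x) (snd (ch p x))"
    "scomp (std_simplex (dsrc p)) (snd (ch p x)) (snd (fst (ch p x))) =
      scomp (std_simplex (dsrc p)) (snd x) (std_map p)"
    "active p \<Longrightarrow> ch p x = ((fst x, scomp (std_simplex (dsrc p)) (snd x) (std_map p)), sid (fst x))"
proof -
  obtain A a where x: "x = (A, a)" by (cases x)
  obtain A' a' i where c: "ch p (A, a) = ((A', a'), i)" by (metis surj_pair)
  have "(A, a) \<in> U_ob (dtgt p) \<and> ch p (A, a) = ((A', a'), i) \<longrightarrow>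
        (A', a') \<in> U_ob (dsrc p) \<and>
        strict_culf A' A i \<and>
        scomp (std_simplex (dsrc p)) i a' = scomp (std_simplex (dsrc p)) a (std_map p) \<and>
        (active p \<longrightarrow>
           A' = A \<and> a' = scomp (std_simplex (dsrc p)) a (std_map p) \<and> i = sid A)"
    using ch unfolding factorisation_choice_def by blast
  then show "fst (ch p x) \<in> U_ob (dsrc p)" "strict_culf (fst (fst (ch p x))) (fst x) (snd (ch p x))"
    "scomp (std_simplex (dsrc p)) (snd (ch p x)) (snd (fst (ch p x))) =
      scomp (std_simplex (dsrc p)) (snd x) (std_map p)"
    "active p \<Longrightarrow> ch p x = ((fst x, scomp (std_simplex (dsrc p)) (snd x) (std_map p)), sid (fst x))"
    using assms c by (auto simp: x)
qed

lemma U_act_ob: "x \<in> U_ob (dtgt p) \<Longrightarrow> fob (U_act ch p) x = fst (ch p x)"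
  by (simp add: U_act_def)

lemma scomp_std_map_arrow:
  assumes F: "(x, y, F) \<in> U_ar (dtgt p)"
  shows "scomp (std_simplex (dsrc p)) F (scomp (std_simplex (dsrc p)) (snd x) (std_map p)) =
    scomp (std_simplex (dsrc p)) (snd y) (std_map p)"
proof (rule ext, rule extensionalityI[OF scomp_ext scomp_ext])
  fix n s assume s: "s \<in> cells (std_simplex (dsrc p)) n"
  then have "std_map p n s \<in> cells (std_simplex (dtgt p)) n" by (simp add: std_map_def)
  then show "scomp (std_simplex (dsrc p)) F (scomp (std_simplex (dsrc p)) (snd x) (std_map p)) n s =
    scomp (std_simplex (dsrc p)) (snd y) (std_map p) n s"
    using s scomp_eq_app[OF U_arD(5)[OF F], of "std_map p n s" n] by simp
qed

lemma U_act_ar: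
  assumes F: "(x, y, F) \<in> U_ar (dtgt p)"
  obtains G where "far (U_act ch p) (x, y, F) = (fst (ch p x), fst (ch p y), G)"
    "(fst (ch p x), fst (ch p y), G) \<in> U_ar (dsrc p)"
    "\<And>k u. u \<in> cells (fst (fst (ch p x))) k \<Longrightarrow> snd (ch p y) k (G k u) = F k (snd (ch p x) k u)"
proof -
  note x = ch_props[OF U_arD(1)[OF F]] and y = ch_props[OF U_arD(2)[OF F]]
  let ?i = "snd (ch p x)" and ?x = "fst (ch p x)" and ?y = "fst (ch p y)"
  have culf: "strict_culf (fst ?x) (fst y) (scomp (fst ?x) F ?i)"
    by (rule culf_scomp[OF U_obD(2)[OF x(1)] x(2) siso_culf[OF U_obD(2)[OF U_arD(1)[OF F]] U_arD(3)[OF F]]])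
  have "scomp (std_simplex (dsrc p)) (scomp (fst ?x) F ?i) (snd ?x) =
      scomp (std_simplex (dsrc p)) (snd (ch p y)) (snd ?y)"
    using scomp_assoc[OF U_obD(3)[OF x(1)], of F ?i] scomp_std_map_arrow[OF F] x(3) y(3) by simp
  then obtain G where G: "comparison (dsrc p) ?x (scomp (fst ?x) F ?i) ?y (snd (ch p y)) = (?x, ?y, G)"
    "(?x, ?y, G) \<in> U_ar (dsrc p)"
    "\<And>k u. u \<in> cells (fst ?x) k \<Longrightarrow> snd (ch p y) k (G k u) = scomp (fst ?x) F ?i k u"
    by (rule comparison_props[OF x(1) y(1) culf y(2)]) blast+
  show thesis
    by (rule that[OF _ G(2)]) (use F G(1,3) in \<open>auto simp: U_act_def\<close>)
qed

text \<open>The equation with the chosen culf parts characterises the image of an arrow.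
  Functoriality follows because identities and composites satisfy the same equation.\<close>

lemma U_act_eqI:
  assumes F: "(x, y, F) \<in> U_ar (dtgt p)" and G: "(fst (ch p x), fst (ch p y), G) \<in> U_ar (dsrc p)"
    and eq: "\<And>k u. u \<in> cells (fst (fst (ch p x))) k \<Longrightarrow> snd (ch p y) k (G k u) = F k (snd (ch p x) k u)"
  shows "far (U_act ch p) (x, y, F) = (fst (ch p x), fst (ch p y), G)"
proof -
  obtain H where H: "far (U_act ch p) (x, y, F) = (fst (ch p x), fst (ch p y), H)"
    "(fst (ch p x), fst (ch p y), H) \<in> U_ar (dsrc p)"
    "\<And>k u. u \<in> cells (fst (fst (ch p x))) k \<Longrightarrow> snd (ch p y) k (H k u) = F k (snd (ch p x) k u)"
    by (rule U_act_ar[OF F], rule that)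
  have "H = G"
    by (rule U_ar_eqI[OF H(2) G ch_props(2)[OF U_arD(2)[OF F]]]) (simp add: H(3) eq)
  then show ?thesis using H by simp
qed

text \<open>At an active map the chosen culf part is the identity of the interval, so only the
  subdivisions change.\<close>

lemma U_act_ar_active:
  assumes F: "(x, y, F) \<in> U_ar (dtgt p)" and p: "active p"
  shows "far (U_act ch p) (x, y, F) = (fst (ch p x), fst (ch p y), F)"
proof -
  note x = U_arD(1)[OF F] and y = U_arD(2)[OF F]
  have "(fst (ch p x), fst (ch p y), F) \<in> U_ar (dsrc p)"
    using ch_props(1)[OF x] ch_props(1)[OF y] U_arD[OF F] scomp_std_map_arrow[OF F]
    by (simp add: U_ar_iff ch_props(4)[OF x p] ch_props(4)[OF y p])
  then show ?thesis
    by (rule U_act_eqI[OF F])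
      (use smap_in[OF U_arD(4)[OF F]] in \<open>simp add: ch_props(4)[OF x p] ch_props(4)[OF y p]\<close>)
qed

lemma gfunctor_U_act: "gfunctor (U_lev (dtgt p)) (U_lev (dsrc p)) (U_act ch p)"
  unfolding gfunctor_def
proof (intro conjI ballI impI)
  show "fob (U_act ch p) \<in> Ob (U_lev (dtgt p)) \<rightarrow>\<^sub>E Ob (U_lev (dsrc p))"
    by (auto simp: U_act_def ch_props(1))
  show "far (U_act ch p) \<in> Ar (U_lev (dtgt p)) \<rightarrow>\<^sub>E Ar (U_lev (dsrc p))"
  proof
    fix f :: "'u subdiv_arrow" assume "f \<in> Ar (U_lev (dtgt p))"
    then obtain x y F where f: "f = (x, y, F)" "(x, y, F) \<in> U_ar (dtgt p)" by (cases f) auto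
    show "far (U_act ch p) f \<in> Ar (U_lev (dsrc p))"
      by (rule U_act_ar[OF f(2)]) (simp add: f(1))
  next
    fix f :: "'u subdiv_arrow" assume "f \<notin> Ar (U_lev (dtgt p))"
    then show "far (U_act ch p) f = undefined" by (simp add: U_act_def)
  qed
next
  fix f :: "'u subdiv_arrow" assume "f \<in> Ar (U_lev (dtgt p))"
  then obtain x y F where f: "f = (x, y, F)" "(x, y, F) \<in> U_ar (dtgt p)" by (cases f) auto
  obtain G where "far (U_act ch p) (x, y, F) = (fst (ch p x), fst (ch p y), G)"
    by (rule U_act_ar[OF f(2)])
  then show "src (U_lev (dsrc p)) (far (U_act ch p) f) = fob (U_act ch p) (src (U_lev (dtgt p)) f)"
    "tgt (U_lev (dsrc p)) (far (U_act ch p) f) = fob (U_act ch p) (tgt (U_lev (dtgt p)) f)"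
    using U_arD(1,2)[OF f(2)] by (simp_all add: f U_act_ob)
next
  fix x :: "'u subdiv" assume "x \<in> Ob (U_lev (dtgt p))"
  then have x: "x \<in> U_ob (dtgt p)" by simp
  show "far (U_act ch p) (idn (U_lev (dtgt p)) x) = idn (U_lev (dsrc p)) (fob (U_act ch p) x)"
    using U_act_eqI[OF U_ar_id[OF x] U_ar_id[OF ch_props(1)[OF x]]] x
      smap_in[OF culfD[OF ch_props(2)[OF x]]] by (simp add: U_act_ob)
next
  fix f g :: "'u subdiv_arrow"
  assume "f \<in> Ar (U_lev (dtgt p))" "g \<in> Ar (U_lev (dtgt p))" "tgt (U_lev (dtgt p)) f = src (U_lev (dtgt p)) g"
  moreover obtain x y F where f1: "f = (x, y, F)" by (cases f)
  moreover obtain y' z G where g1: "g = (y', z, G)" by (cases g)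
  ultimately have "y' = y" and f: "f = (x, y, F)" "(x, y, F) \<in> U_ar (dtgt p)"
    and g: "g = (y, z, G)" "(y, z, G) \<in> U_ar (dtgt p)" by simp_all
  obtain F' where F': "far (U_act ch p) (x, y, F) = (fst (ch p x), fst (ch p y), F')"
    "(fst (ch p x), fst (ch p y), F') \<in> U_ar (dsrc p)"
    "\<And>k u. u \<in> cells (fst (fst (ch p x))) k \<Longrightarrow> snd (ch p y) k (F' k u) = F k (snd (ch p x) k u)"
    by (rule U_act_ar[OF f(2)], rule that)
  obtain G' where G': "far (U_act ch p) (y, z, G) = (fst (ch p y), fst (ch p z), G')"
    "(fst (ch p y), fst (ch p z), G') \<in> U_ar (dsrc p)"
    "\<And>k u. u \<in> cells (fst (fst (ch p y))) k \<Longrightarrow> snd (ch p z) k (G' k u) = G k (snd (ch p y) k u)"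
    by (rule U_act_ar[OF g(2)], rule that)
  have "far (U_act ch p) (x, z, scomp (fst x) G F) =
    (fst (ch p x), fst (ch p z), scomp (fst (fst (ch p x))) G' F')"
    by (rule U_act_eqI[OF U_ar_comp[OF f(2) g(2)] U_ar_comp[OF F'(2) G'(2)]])
      (simp add: F'(3) G'(3) smap_in[OF U_arD(4)[OF F'(2)]]
        smap_in[OF culfD[OF ch_props(2)[OF U_arD(1)[OF f(2)]]]])
  then show "far (U_act ch p) (cmp (U_lev (dtgt p)) g f) =
      cmp (U_lev (dsrc p)) (far (U_act ch p) g) (far (U_act ch p) f)"
    using f(1) g(1) F'(1) G'(1) by simp
qed

lemma U_coh_props:
  assumes x: "x \<in> U_ob (dtgt q)" and pq: "dtgt p = dsrc q"
  obtains G where "U_coh ch q p x = (fst (ch p (fst (ch q x))), fst (ch (q \<odot> p) x), G)"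
    "(fst (ch p (fst (ch q x))), fst (ch (q \<odot> p) x), G) \<in> U_ar (dsrc p)"
    "\<And>k u. u \<in> cells (fst (fst (ch p (fst (ch q x))))) k \<Longrightarrow>
      snd (ch (q \<odot> p) x) k (G k u) = snd (ch q x) k (snd (ch p (fst (ch q x))) k u)"
proof -
  let ?y = "fst (ch q x)" and ?j = "snd (ch q x)"
  let ?z = "fst (ch p ?y)" and ?i = "snd (ch p ?y)"
  let ?w = "fst (ch (q \<odot> p) x)" and ?k = "snd (ch (q \<odot> p) x)"
  have y: "?y \<in> U_ob (dtgt p)" using ch_props(1)[OF x] pq by simp
  have x': "x \<in> U_ob (dtgt (q \<odot> p))" using x pq by simp
  note cy = ch_props[OF x] and cz = ch_props[OF y]
  note cw = ch_props[OF x', unfolded dcomp_simps(1,2)[OF pq]]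
  have culf: "strict_culf (fst ?z) (fst x) (scomp (fst ?z) ?j ?i)"
    by (rule culf_scomp[OF U_obD(2)[OF cz(1)] cz(2) cy(2)])
  have "scomp (std_simplex (dsrc p)) (scomp (fst ?z) ?j ?i) (snd ?z) =
      scomp (std_simplex (dsrc p)) ?k (snd ?w)"
  proof (rule ext, rule extensionalityI[OF scomp_ext scomp_ext])
    fix n s assume s: "s \<in> cells (std_simplex (dsrc p)) n"
    have ps: "std_map p n s \<in> cells (std_simplex (dsrc q)) n" using s pq by (simp add: std_map_def)
    have "?j n (?i n (snd ?z n s)) = ?j n (snd ?y n (std_map p n s))"
      using scomp_cong_app[OF cz(3) s] by simp
    also have "\<dots> = snd x n (std_map q n (std_map p n s))"
      using scomp_cong_app[OF cy(3) ps] by simp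
    also have "std_map q n (std_map p n s) = std_map (q \<odot> p) n s"
      using s pq by (simp add: std_map_def dcomp_assoc)
    also have "snd x n \<dots> = ?k n (snd ?w n s)"
      using scomp_cong_app[OF cw(3) s] by simp
    finally show "scomp (std_simplex (dsrc p)) (scomp (fst ?z) ?j ?i) (snd ?z) n s =
      scomp (std_simplex (dsrc p)) ?k (snd ?w) n s"
      using s smap_in[OF U_obD(3)[OF cz(1)] s] by simp
  qed
  then obtain G where G: "comparison (dsrc p) ?z (scomp (fst ?z) ?j ?i) ?w ?k = (?z, ?w, G)"
    "(?z, ?w, G) \<in> U_ar (dsrc p)"
    "\<And>k u. u \<in> cells (fst ?z) k \<Longrightarrow> ?k k (G k u) = scomp (fst ?z) ?j ?i k u"
    by (rule comparison_props[OF cz(1) cw(1) culf cw(2)]) blast+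
  have "U_coh ch q p x = comparison (dsrc p) ?z (scomp (fst ?z) ?j ?i) ?w ?k"
    by (simp add: U_coh_def case_prod_unfold Let_def)
  then show thesis using that G by simp
qed

end

section \<open>The groupoid of strict culf maps\<close>

lemma modificationD:
  assumes "modification X U J J' \<Gamma>"
  shows "\<And>n. \<Gamma> n \<in> extensional (Ob (lev X n))"
    "\<And>n x. x \<in> Ob (lev X n) \<Longrightarrow> arrow (plev U n) (\<Gamma> n x) (fob (cpt J n) x) (fob (cpt J' n) x)"
    "\<And>n \<alpha>. \<alpha> \<in> Ar (lev X n) \<Longrightarrow> cmp (plev U n) (far (cpt J' n) \<alpha>) (\<Gamma> n (src (lev X n) \<alpha>)) =
        cmp (plev U n) (\<Gamma> n (tgt (lev X n) \<alpha>)) (far (cpt J n) \<alpha>)"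
    "\<And>p x. x \<in> Ob (lev X (dtgt p)) \<Longrightarrow>
        cmp (plev U (dsrc p)) (\<Gamma> (dsrc p) (fob (act X p) x)) (str J p x) =
        cmp (plev U (dsrc p)) (str J' p x) (far (pact U p) (\<Gamma> (dtgt p) x))"
  using assms unfolding modification_def by blast+

lemma groupoidD:
  assumes "groupoid G"
  shows "\<And>f. f \<in> Ar G \<Longrightarrow> src G f \<in> Ob G" "\<And>f. f \<in> Ar G \<Longrightarrow> tgt G f \<in> Ob G"
    "\<And>x. x \<in> Ob G \<Longrightarrow> arrow G (idn G x) x x"
    "\<And>x y z f g. arrow G f x y \<Longrightarrow> arrow G g y z \<Longrightarrow> arrow G (cmp G g f) x z"
    "\<And>x y f. arrow G f x y \<Longrightarrow> cmp G f (idn G x) = f"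
    "\<And>x y f. arrow G f x y \<Longrightarrow> cmp G (idn G y) f = f"
    "\<And>w x y z f g h. arrow G f w x \<Longrightarrow> arrow G g x y \<Longrightarrow> arrow G h y z \<Longrightarrow>
        cmp G h (cmp G g f) = cmp G (cmp G h g) f"
    "\<And>x y f. arrow G f x y \<Longrightarrow> \<exists>g. arrow G g y x \<and> cmp G g f = idn G x \<and> cmp G f g = idn G y"
  using assms unfolding groupoid_def by blast+

lemma gfunctorD:
  assumes "gfunctor G H F"
  shows "fob F \<in> extensional (Ob G)" "far F \<in> extensional (Ar G)"
    "\<And>x. x \<in> Ob G \<Longrightarrow> fob F x \<in> Ob H" "\<And>f. f \<in> Ar G \<Longrightarrow> far F f \<in> Ar H"
    "\<And>f x y. arrow G f x y \<Longrightarrow> arrow H (far F f) (fob F x) (fob F y)"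
    "\<And>x. x \<in> Ob G \<Longrightarrow> far F (idn G x) = idn H (fob F x)"
    "\<And>f g x y z. arrow G f x y \<Longrightarrow> arrow G g y z \<Longrightarrow> far F (cmp G g f) = cmp H (far F g) (far F f)"
  using assms unfolding gfunctor_def arrow_def by (auto simp: PiE_def)

lemma pseudonaturalD:
  assumes "pseudonatural X U J"
  shows "\<And>n. gfunctor (lev X n) (plev U n) (cpt J n)"
     "\<And>p. str J p \<in> extensional (Ob (lev X (dtgt p)))"
     "\<And>p x. x\<in>Ob (lev X (dtgt p)) \<Longrightarrow>
        arrow (plev U (dsrc p)) (str J p x)
          (fob (pact U p) (fob (cpt J (dtgt p)) x))
          (fob (cpt J (dsrc p)) (fob (act X p) x))"
     "\<And>p \<alpha>. \<alpha>\<in>Ar (lev X (dtgt p)) \<Longrightarrow>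
        cmp (plev U (dsrc p)) (far (cpt J (dsrc p)) (far (act X p) \<alpha>))
          (str J p (src (lev X (dtgt p)) \<alpha>)) =
        cmp (plev U (dsrc p)) (str J p (tgt (lev X (dtgt p)) \<alpha>))
          (far (pact U p) (far (cpt J (dtgt p)) \<alpha>))"
     "\<And>n x. x\<in>Ob (lev X n) \<Longrightarrow> str J (did n) x = idn (plev U n) (fob (cpt J n) x)"
     "\<And>p q x. dtgt p = dsrc q \<Longrightarrow> x\<in>Ob (lev X (dtgt q)) \<Longrightarrow>
        cmp (plev U (dsrc p)) (str J (q \<odot> p) x) (pcoh U q p (fob (cpt J (dtgt q)) x)) =
        cmp (plev U (dsrc p)) (str J p (fob (act X q) x)) (far (pact U p) (str J q x))"
  using assms unfolding pseudonatural_def by blast+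

section \<open>Identities, composites and inverses of modifications\<close>

locale modification_setting =
  fixes X :: "('o, 'a) sgpd" and U :: "('p, 'b) psgpd"
  assumes X: "simplicial_groupoid X"
    and U: "\<And>n. groupoid (plev U n)"
    and Uact: "\<And>p. gfunctor (plev U (dtgt p)) (plev U (dsrc p)) (pact U p)"
begin

lemma X_gpd: "groupoid (lev X n)" and X_act: "gfunctor (lev X (dtgt p)) (lev X (dsrc p)) (act X p)"
  using X unfolding simplicial_groupoid_def by blast+

lemma X_act_ob: "x \<in> Ob (lev X (dtgt p)) \<Longrightarrow> fob (act X p) x \<in> Ob (lev X (dsrc p))"
  by (rule gfunctorD(3)[OF X_act])

lemma X_arrow: "\<alpha> \<in> Ar (lev X n) \<Longrightarrow> arrow (lev X n) \<alpha> (src (lev X n) \<alpha>) (tgt (lev X n) \<alpha>)"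
  by (simp add: arrow_def)

lemmas X_src_tgt = groupoidD(1,2)[OF X_gpd]

lemma id_modification:
  assumes J: "pseudonatural X U J"
  shows "modification X U J J (id_mod X U J)"
  unfolding modification_def
proof (intro conjI allI ballI)
  fix n x assume "x \<in> Ob (lev X n)"
  then show "arrow (plev U n) (id_mod X U J n x) (fob (cpt J n) x) (fob (cpt J n) x)"
    using groupoidD(3)[OF U] gfunctorD(3)[OF pseudonaturalD(1)[OF J]] by (simp add: id_mod_def)
next
  fix n \<alpha> assume a: "\<alpha> \<in> Ar (lev X n)"
  have "arrow (plev U n) (far (cpt J n) \<alpha>) (fob (cpt J n) (src (lev X n) \<alpha>)) (fob (cpt J n) (tgt (lev X n) \<alpha>))"
    by (rule gfunctorD(5)[OF pseudonaturalD(1)[OF J] X_arrow[OF a]])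
  then show "cmp (plev U n) (far (cpt J n) \<alpha>) (id_mod X U J n (src (lev X n) \<alpha>)) =
    cmp (plev U n) (id_mod X U J n (tgt (lev X n) \<alpha>)) (far (cpt J n) \<alpha>)"
    using X_src_tgt[OF a] groupoidD(5,6)[OF U] by (simp add: id_mod_def)
next
  fix p x assume x: "x \<in> Ob (lev X (dtgt p))"
  note s = pseudonaturalD(3)[OF J x]
  show "cmp (plev U (dsrc p)) (id_mod X U J (dsrc p) (fob (act X p) x)) (str J p x) =
    cmp (plev U (dsrc p)) (str J p x) (far (pact U p) (id_mod X U J (dtgt p) x))"
    using x X_act_ob[OF x] groupoidD(5,6)[OF U s] gfunctorD(6)[OF Uact]
      gfunctorD(3)[OF pseudonaturalD(1)[OF J] x] by (simp add: id_mod_def)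
qed (simp add: id_mod_def)

lemma comp_modification:
  assumes J: "pseudonatural X U J" "pseudonatural X U J'" "pseudonatural X U J''"
    and G: "modification X U J J' \<Gamma>" and D: "modification X U J' J'' \<Delta>"
  shows "modification X U J J'' (comp_mod X U \<Delta> \<Gamma>)"
  unfolding modification_def
proof (intro conjI allI ballI)
  fix n x assume "x \<in> Ob (lev X n)"
  then show "arrow (plev U n) (comp_mod X U \<Delta> \<Gamma> n x) (fob (cpt J n) x) (fob (cpt J'' n) x)"
    using groupoidD(4)[OF U modificationD(2)[OF G] modificationD(2)[OF D]] by (simp add: comp_mod_def)
next
  fix n \<alpha> assume a: "\<alpha> \<in> Ar (lev X n)"
  note a' = X_src_tgt[OF a]
  let ?s = "src (lev X n) \<alpha>" and ?t = "tgt (lev X n) \<alpha>"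
  note arr = gfunctorD(5)[OF pseudonaturalD(1) X_arrow[OF a]]
  note Ga = modificationD(2)[OF G] and Da = modificationD(2)[OF D]
  have "cmp (plev U n) (far (cpt J'' n) \<alpha>) (cmp (plev U n) (\<Delta> n ?s) (\<Gamma> n ?s)) =
    cmp (plev U n) (cmp (plev U n) (far (cpt J'' n) \<alpha>) (\<Delta> n ?s)) (\<Gamma> n ?s)"
    by (rule groupoidD(7)[OF U Ga[OF a'(1)] Da[OF a'(1)] arr[OF J(3)]])
  also have "\<dots> = cmp (plev U n) (cmp (plev U n) (\<Delta> n ?t) (far (cpt J' n) \<alpha>)) (\<Gamma> n ?s)"
    by (simp add: modificationD(3)[OF D a])
  also have "\<dots> = cmp (plev U n) (\<Delta> n ?t) (cmp (plev U n) (far (cpt J' n) \<alpha>) (\<Gamma> n ?s))"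
    by (rule groupoidD(7)[OF U Ga[OF a'(1)] arr[OF J(2)] Da[OF a'(2)], symmetric])
  also have "\<dots> = cmp (plev U n) (\<Delta> n ?t) (cmp (plev U n) (\<Gamma> n ?t) (far (cpt J n) \<alpha>))"
    by (simp add: modificationD(3)[OF G a])
  also have "\<dots> = cmp (plev U n) (cmp (plev U n) (\<Delta> n ?t) (\<Gamma> n ?t)) (far (cpt J n) \<alpha>)"
    by (rule groupoidD(7)[OF U arr[OF J(1)] Ga[OF a'(2)] Da[OF a'(2)]])
  finally show "cmp (plev U n) (far (cpt J'' n) \<alpha>) (comp_mod X U \<Delta> \<Gamma> n ?s) =
    cmp (plev U n) (comp_mod X U \<Delta> \<Gamma> n ?t) (far (cpt J n) \<alpha>)"
    using a' by (simp add: comp_mod_def)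
next
  fix p x assume x: "x \<in> Ob (lev X (dtgt p))"
  note px = X_act_ob[OF x]
  let ?m = "dsrc p" and ?y = "fob (act X p) x"
  note Ga = modificationD(2)[OF G] and Da = modificationD(2)[OF D]
  note arr = pseudonaturalD(3)[OF _ x]
  note Gp = gfunctorD(5)[OF Uact Ga[OF x]] and Dp = gfunctorD(5)[OF Uact Da[OF x]]
  have "cmp (plev U ?m) (cmp (plev U ?m) (\<Delta> ?m ?y) (\<Gamma> ?m ?y)) (str J p x) =
    cmp (plev U ?m) (\<Delta> ?m ?y) (cmp (plev U ?m) (\<Gamma> ?m ?y) (str J p x))"
    by (rule groupoidD(7)[OF U arr[OF J(1)] Ga[OF px] Da[OF px], symmetric])
  also have "\<dots> = cmp (plev U ?m) (\<Delta> ?m ?y) (cmp (plev U ?m) (str J' p x) (far (pact U p) (\<Gamma> (dtgt p) x)))"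
    by (simp add: modificationD(4)[OF G x])
  also have "\<dots> = cmp (plev U ?m) (cmp (plev U ?m) (\<Delta> ?m ?y) (str J' p x)) (far (pact U p) (\<Gamma> (dtgt p) x))"
    by (rule groupoidD(7)[OF U Gp arr[OF J(2)] Da[OF px]])
  also have "\<dots> = cmp (plev U ?m) (cmp (plev U ?m) (str J'' p x) (far (pact U p) (\<Delta> (dtgt p) x)))
      (far (pact U p) (\<Gamma> (dtgt p) x))"
    by (simp add: modificationD(4)[OF D x])
  also have "\<dots> = cmp (plev U ?m) (str J'' p x) (cmp (plev U ?m) (far (pact U p) (\<Delta> (dtgt p) x))
      (far (pact U p) (\<Gamma> (dtgt p) x)))"
    by (rule groupoidD(7)[OF U Gp Dp arr[OF J(3)], symmetric])
  also have "cmp (plev U ?m) (far (pact U p) (\<Delta> (dtgt p) x)) (far (pact U p) (\<Gamma> (dtgt p) x)) =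
      far (pact U p) (cmp (plev U (dtgt p)) (\<Delta> (dtgt p) x) (\<Gamma> (dtgt p) x))"
    by (rule gfunctorD(7)[OF Uact Ga[OF x] Da[OF x], symmetric])
  finally show "cmp (plev U ?m) (comp_mod X U \<Delta> \<Gamma> ?m ?y) (str J p x) =
    cmp (plev U ?m) (str J'' p x) (far (pact U p) (comp_mod X U \<Delta> \<Gamma> (dtgt p) x))"
    using x px by (simp add: comp_mod_def)
qed (simp add: comp_mod_def)

text \<open>Inverts two opposite sides of a commuting square. It serves both conditions on a
  modification, naturality and compatibility with the structure isomorphisms.\<close>

lemma gpd_square_inv:
  assumes G: "groupoid G" and f: "arrow G f a b" and g: "arrow G g c d"
    and h: "arrow G h a c" and h': "arrow G h' c a" "cmp G h' h = idn G a" "cmp G h h' = idn G c"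
    and k: "arrow G k b d" and k': "arrow G k' d b" "cmp G k' k = idn G b" "cmp G k k' = idn G d"
    and sq: "cmp G g h = cmp G k f"
  shows "cmp G f h' = cmp G k' g"
proof -
  have "cmp G k' g = cmp G k' (cmp G g (cmp G h h'))"
    using groupoidD(5)[OF G g] h'(3) by simp
  also have "\<dots> = cmp G k' (cmp G (cmp G k f) h')"
    using groupoidD(7)[OF G h'(1) h g] sq by simp
  also have "\<dots> = cmp G (cmp G k' (cmp G k f)) h'"
    by (rule groupoidD(7)[OF G h'(1) groupoidD(4)[OF G f k] k'(1)])
  also have "cmp G k' (cmp G k f) = f"
    using groupoidD(7)[OF G f k k'(1)] k'(2) groupoidD(6)[OF G f] by simp
  finally show ?thesis by simp
qed

text \<open>The levels of \<open>U\<close> are groupoids, so inverses exist at each object; the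
  conditions are commuting squares and pass to the inverses.\<close>

lemma modification_invertible:
  assumes J: "pseudonatural X U J" "pseudonatural X U J'" and G: "modification X U J J' \<Gamma>"
  obtains \<Delta> where "modification X U J' J \<Delta>" "comp_mod X U \<Delta> \<Gamma> = id_mod X U J"
    "comp_mod X U \<Gamma> \<Delta> = id_mod X U J'"
proof -
  let ?P = "\<lambda>n x g. arrow (plev U n) g (fob (cpt J' n) x) (fob (cpt J n) x) \<and>
      cmp (plev U n) g (\<Gamma> n x) = idn (plev U n) (fob (cpt J n) x) \<and>
      cmp (plev U n) (\<Gamma> n x) g = idn (plev U n) (fob (cpt J' n) x)"
  note Ga = modificationD(2)[OF G]
  define \<Delta> where "\<Delta> n = (\<lambda>x\<in>Ob (lev X n). SOME g. ?P n x g)" for n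
  have D: "?P n x (\<Delta> n x)" if "x \<in> Ob (lev X n)" for n x
    using someI_ex[OF groupoidD(8)[OF U Ga[OF that]]] that by (simp add: \<Delta>_def)
  have D1: "arrow (plev U n) (\<Delta> n x) (fob (cpt J' n) x) (fob (cpt J n) x)"
    and D2: "cmp (plev U n) (\<Delta> n x) (\<Gamma> n x) = idn (plev U n) (fob (cpt J n) x)"
    and D3: "cmp (plev U n) (\<Gamma> n x) (\<Delta> n x) = idn (plev U n) (fob (cpt J' n) x)"
    if "x \<in> Ob (lev X n)" for n x
    using D[OF that] by auto
  have "modification X U J' J \<Delta>"
    unfolding modification_def
  proof (intro conjI allI ballI)
    fix n \<alpha> assume a: "\<alpha> \<in> Ar (lev X n)"
    note a' = X_src_tgt[OF a]
    note arr = gfunctorD(5)[OF pseudonaturalD(1) X_arrow[OF a]]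
    show "cmp (plev U n) (far (cpt J n) \<alpha>) (\<Delta> n (src (lev X n) \<alpha>)) =
      cmp (plev U n) (\<Delta> n (tgt (lev X n) \<alpha>)) (far (cpt J' n) \<alpha>)"
      by (rule gpd_square_inv[OF U arr[OF J(1)] arr[OF J(2)] Ga[OF a'(1)] D1[OF a'(1)] D2[OF a'(1)]
            D3[OF a'(1)] Ga[OF a'(2)] D1[OF a'(2)] D2[OF a'(2)] D3[OF a'(2)] modificationD(3)[OF G a]])
  next
    fix p x assume x: "x \<in> Ob (lev X (dtgt p))"
    note px = X_act_ob[OF x]
    note arr = pseudonaturalD(3)[OF _ x]
    note F = gfunctorD[OF Uact]
    have i: "fob (cpt J (dtgt p)) x \<in> Ob (plev U (dtgt p))" "fob (cpt J' (dtgt p)) x \<in> Ob (plev U (dtgt p))"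
      using gfunctorD(3)[OF pseudonaturalD(1) x] J by blast+
    have 1: "cmp (plev U (dsrc p)) (far (pact U p) (\<Delta> (dtgt p) x)) (far (pact U p) (\<Gamma> (dtgt p) x)) =
        idn (plev U (dsrc p)) (fob (pact U p) (fob (cpt J (dtgt p)) x))"
      using F(7)[OF Ga[OF x] D1[OF x]] D2[OF x] F(6)[OF i(1)] by simp
    have 2: "cmp (plev U (dsrc p)) (far (pact U p) (\<Gamma> (dtgt p) x)) (far (pact U p) (\<Delta> (dtgt p) x)) =
        idn (plev U (dsrc p)) (fob (pact U p) (fob (cpt J' (dtgt p)) x))"
      using F(7)[OF D1[OF x] Ga[OF x]] D3[OF x] F(6)[OF i(2)] by simp
    show "cmp (plev U (dsrc p)) (\<Delta> (dsrc p) (fob (act X p) x)) (str J' p x) =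
      cmp (plev U (dsrc p)) (str J p x) (far (pact U p) (\<Delta> (dtgt p) x))"
      by (rule gpd_square_inv[OF U arr[OF J(1)] arr[OF J(2)] F(5)[OF Ga[OF x]] F(5)[OF D1[OF x]] 1 2
            Ga[OF px] D1[OF px] D2[OF px] D3[OF px] modificationD(4)[OF G x, symmetric], symmetric])
  qed (use D1 in \<open>simp_all add: \<Delta>_def\<close>)
  moreover have "comp_mod X U \<Delta> \<Gamma> = id_mod X U J" "comp_mod X U \<Gamma> \<Delta> = id_mod X U J'"
    using D2 D3 by (auto simp: comp_mod_def id_mod_def fun_eq_iff)
  ultimately show thesis by (rule that)
qed

lemma invertible_modification_iff:
  assumes "pseudonatural X U J" "pseudonatural X U J'"
  shows "invertible_modification X U J J' \<Gamma> \<longleftrightarrow> modification X U J J' \<Gamma>"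
  using modification_invertible[OF assms] unfolding invertible_modification_def by blast

lemma arrow_map_gpd: "arrow (map_gpd X U) f J J' \<longleftrightarrow>
    (\<exists>\<Gamma>. f = (J, J', \<Gamma>) \<and> strict_culf_map X U J \<and> strict_culf_map X U J' \<and> modification X U J J' \<Gamma>)"
  using invertible_modification_iff[of J J']
  by (cases f) (auto simp: arrow_def map_gpd_def strict_culf_map_def)

lemma map_gpd_simps [simp]:
  "Ob (map_gpd X U) = {J. strict_culf_map X U J}" "idn (map_gpd X U) J = (J, J, id_mod X U J)"
  "cmp (map_gpd X U) (J', J'', \<Delta>) (J, K, \<Gamma>) = (J, J'', comp_mod X U \<Delta> \<Gamma>)"
  by (simp_all add: map_gpd_def)

lemma strict_culf_map_pseudonatural: "strict_culf_map X U J \<Longrightarrow> pseudonatural X U J"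
  by (simp add: strict_culf_map_def)

lemma groupoid_map_gpd: "groupoid (map_gpd X U)"
  unfolding groupoid_def
proof (intro conjI ballI allI impI)
  fix f assume "f \<in> Ar (map_gpd X U)"
  then show "src (map_gpd X U) f \<in> Ob (map_gpd X U)" "tgt (map_gpd X U) f \<in> Ob (map_gpd X U)"
    by (auto simp: map_gpd_def)
next
  fix J assume "J \<in> Ob (map_gpd X U)"
  then show "arrow (map_gpd X U) (idn (map_gpd X U) J) J J"
    by (auto simp: arrow_map_gpd intro: id_modification strict_culf_map_pseudonatural)
next
  fix J K L f g assume "arrow (map_gpd X U) f J K \<and> arrow (map_gpd X U) g K L"
  then obtain \<Gamma> \<Delta> where f: "f = (J, K, \<Gamma>)" "g = (K, L, \<Delta>)"
    and G: "strict_culf_map X U J" "strict_culf_map X U K" "strict_culf_map X U L"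
      "modification X U J K \<Gamma>" "modification X U K L \<Delta>"
    by (auto simp: arrow_map_gpd)
  then show "arrow (map_gpd X U) (cmp (map_gpd X U) g f) J L"
    using comp_modification[OF G(1-3)[THEN strict_culf_map_pseudonatural] G(4,5)]
    by (simp add: arrow_map_gpd)
next
  fix J K f assume "arrow (map_gpd X U) f J K"
  then obtain \<Gamma> where f: "f = (J, K, \<Gamma>)" and J: "strict_culf_map X U J" "strict_culf_map X U K"
    and G: "modification X U J K \<Gamma>"
    by (auto simp: arrow_map_gpd)
  note Ga = modificationD(2)[OF G] and e = modificationD(1)[OF G]
  have "comp_mod X U \<Gamma> (id_mod X U J) = \<Gamma>" "comp_mod X U (id_mod X U K) \<Gamma> = \<Gamma>"
    by (rule ext, rule extensionalityI[OF _ e],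
        use groupoidD(5,6)[OF U Ga] in \<open>simp_all add: comp_mod_def id_mod_def\<close>)+
  then show "cmp (map_gpd X U) f (idn (map_gpd X U) J) = f" "cmp (map_gpd X U) (idn (map_gpd X U) K) f = f"
    by (simp_all add: f)
  obtain \<Delta> where "modification X U K J \<Delta>" "comp_mod X U \<Delta> \<Gamma> = id_mod X U J"
    "comp_mod X U \<Gamma> \<Delta> = id_mod X U K"
    using modification_invertible[OF _ _ G] J by (metis strict_culf_map_pseudonatural)
  then show "\<exists>g. arrow (map_gpd X U) g K J \<and> cmp (map_gpd X U) g f = idn (map_gpd X U) J \<and>
      cmp (map_gpd X U) f g = idn (map_gpd X U) K"
    using J by (intro exI[of _ "(K, J, \<Delta>)"]) (simp add: arrow_map_gpd f)
next
  fix J K L M f g h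
  assume "arrow (map_gpd X U) f J K \<and> arrow (map_gpd X U) g K L \<and> arrow (map_gpd X U) h L M"
  then obtain \<Gamma> \<Delta> \<Theta> where f: "f = (J, K, \<Gamma>)" "g = (K, L, \<Delta>)" "h = (L, M, \<Theta>)"
    and G: "modification X U J K \<Gamma>" "modification X U K L \<Delta>" "modification X U L M \<Theta>"
    by (auto simp: arrow_map_gpd)
  have "comp_mod X U \<Theta> (comp_mod X U \<Delta> \<Gamma>) = comp_mod X U (comp_mod X U \<Theta> \<Delta>) \<Gamma>"
    using groupoidD(7)[OF U modificationD(2)[OF G(1)] modificationD(2)[OF G(2)] modificationD(2)[OF G(3)]]
    by (auto simp: comp_mod_def fun_eq_iff)
  then show "cmp (map_gpd X U) h (cmp (map_gpd X U) g f) = cmp (map_gpd X U) (cmp (map_gpd X U) h g) f"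
    by (simp add: f)
qed

text \<open>Every modification between strict culf maps is invertible, so it suffices to connect
  everything to one object.\<close>

lemma connected_map_gpd:
  assumes I: "strict_culf_map X U I"
    and J: "\<And>J. strict_culf_map X U J \<Longrightarrow> \<exists>\<Gamma>. modification X U J I \<Gamma>"
  shows "connected_groupoid (map_gpd X U)"
  unfolding connected_groupoid_def
proof (intro conjI ballI groupoid_map_gpd)
  show "Ob (map_gpd X U) \<noteq> {}" using I by auto
  fix J K assume "J \<in> Ob (map_gpd X U)" "K \<in> Ob (map_gpd X U)"
  then have JK: "strict_culf_map X U J" "strict_culf_map X U K" by auto
  obtain \<Gamma> \<Delta> where "modification X U J I \<Gamma>" "modification X U K I \<Delta>" using J JK by blast
  then have f: "arrow (map_gpd X U) (J, I, \<Gamma>) J I" and g: "arrow (map_gpd X U) (K, I, \<Delta>) K I"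
    using JK I by (auto simp: arrow_map_gpd)
  obtain h where "arrow (map_gpd X U) h I K" using groupoidD(8)[OF groupoid_map_gpd g] by blast
  then show "\<exists>f. arrow (map_gpd X U) f J K" using groupoidD(4)[OF groupoid_map_gpd f] by blast
qed

end

section \<open>Rigid decomposition groupoids\<close>

text \<open>A strict pullback of groupoids is a pullback on objects and on arrows, so these become
  two separate simplicial sets with the same decomposition property.\<close>

definition obs :: "('o, 'a) sgpd \<Rightarrow> 'o sset" where
  "obs X = \<lparr>cells = \<lambda>n. Ob (lev X n), sact = \<lambda>p. fob (act X p)\<rparr>"

definition ars :: "('o, 'a) sgpd \<Rightarrow> 'a sset" where
  "ars X = \<lparr>cells = \<lambda>n. Ar (lev X n), sact = \<lambda>p. far (act X p)\<rparr>"

lemma obs_ars_simps: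
  "Ob (lev X n) = cells (obs X) n" "fob (act X p) = sact (obs X) p"
  "Ar (lev X n) = cells (ars X) n" "far (act X p) = sact (ars X) p"
  by (simp_all add: obs_def ars_def)

lemma bij_betw_ex1: "bij_betw f A B \<Longrightarrow> y \<in> B \<Longrightarrow> \<exists>!x. x \<in> A \<and> f x = y"
  unfolding bij_betw_def by (metis (no_types, lifting) imageE inj_onD)

lemma bij_betw_surjE:
  assumes "bij_betw f A B" "y \<in> B"
  obtains x where "x \<in> A" "f x = y"
  using bij_betw_ex1[OF assms] by blast

lemma groupoid_inverse_unique:
  assumes G: "groupoid G" and f: "arrow G f x y" and g: "arrow G g y x" and h: "arrow G h y x"
    and gf: "cmp G g f = idn G x" and fh: "cmp G f h = idn G y"
  shows "g = h"
proof -
  have "g = cmp G g (cmp G f h)" using groupoidD(5)[OF G g] fh by simp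
  also have "\<dots> = cmp G (cmp G g f) h" by (rule groupoidD(7)[OF G h f g])
  also have "\<dots> = h" using groupoidD(6)[OF G h] gf by simp
  finally show ?thesis .
qed

locale rdg =
  fixes X :: "('u, 'a) sgpd"
  assumes rigid: "rigid_decomposition_groupoid X"
begin

lemma X: "simplicial_groupoid X"
  using rigid by (simp add: rigid_decomposition_groupoid_def)

lemma gpd: "groupoid (lev X n)" and act_ftr: "gfunctor (lev X (dtgt p)) (lev X (dsrc p)) (act X p)"
  using X unfolding simplicial_groupoid_def by blast+

abbreviation XO :: "nat \<Rightarrow> 'u set" where "XO \<equiv> cells (obs X)"
abbreviation XA :: "nat \<Rightarrow> 'a set" where "XA \<equiv> cells (ars X)"
abbreviation res :: "simplex_map \<Rightarrow> 'u \<Rightarrow> 'u" where "res \<equiv> sact (obs X)"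
abbreviation resA :: "simplex_map \<Rightarrow> 'a \<Rightarrow> 'a" where "resA \<equiv> sact (ars X)"
abbreviation intv :: "'u \<Rightarrow> 'u interval" where "intv \<equiv> fib (obs X)"
abbreviation proj :: "'u \<Rightarrow> nat \<Rightarrow> 'u \<Rightarrow> 'u" where "proj \<equiv> fib_proj (obs X)"

lemma src_act: "\<alpha> \<in> XA n \<Longrightarrow> dtgt p = n \<Longrightarrow> dsrc p = m \<Longrightarrow>
    src (lev X m) (resA p \<alpha>) = res p (src (lev X n) \<alpha>)"
  and tgt_act: "\<alpha> \<in> XA n \<Longrightarrow> dtgt p = n \<Longrightarrow> dsrc p = m \<Longrightarrow>
    tgt (lev X m) (resA p \<alpha>) = res p (tgt (lev X n) \<alpha>)"
  using act_ftr[of p] unfolding gfunctor_def obs_ars_simps by blast+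

lemma src_in: "\<alpha> \<in> XA n \<Longrightarrow> src (lev X n) \<alpha> \<in> XO n"
  and tgt_in: "\<alpha> \<in> XA n \<Longrightarrow> tgt (lev X n) \<alpha> \<in> XO n"
  using groupoidD(1,2)[OF gpd, of \<alpha> n] by (simp_all add: obs_ars_simps)

lemma sset_obs: "sset (obs X)" and sset_ars: "sset (ars X)"
proof -
  have f: "fob (act X p) \<in> Ob (lev X (dtgt p)) \<rightarrow>\<^sub>E Ob (lev X (dsrc p))"
    "far (act X p) \<in> Ar (lev X (dtgt p)) \<rightarrow>\<^sub>E Ar (lev X (dsrc p))" for p
    using act_ftr[of p] unfolding gfunctor_def by blast+
  have i: "act X (did n) = id_ftr (lev X n)" for n
    using X unfolding simplicial_groupoid_def by blast
  have c: "act X (q \<odot> p) = comp_ftr (lev X (dtgt q)) (act X p) (act X q)" if "dtgt p = dsrc q" for p q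
    using X that unfolding simplicial_groupoid_def by blast
  show "sset (obs X)" "sset (ars X)"
    unfolding sset_def obs_def ars_def using f
    by (simp_all add: i c id_ftr_def comp_ftr_def)
qed

lemma glue_pullback:
  assumes "active a"
  shows "strict_pullback (lev X (l + dtgt a + s)) (lev X (l + dsrc a + s)) (lev X (dtgt a))
    (act X (glue l s a)) (act X (incl l (dtgt a) s)) (act X (incl l (dsrc a) s)) (act X a)"
  using rigid is_pushout_glue[OF assms, of l s] assms inert_incl[of l "dsrc a" s]
  unfolding rigid_decomposition_groupoid_def by (metis (no_types) glue_simps(2) incl_simps(2))

lemma decomp_obs: "decomposition_set (obs X)"
  unfolding decomposition_set_def
proof (intro conjI sset_obs allI impI)
  fix a l s x y
  assume *: "active a \<and> x \<in> XO (l + dsrc a + s) \<and> y \<in> XO (dtgt a) \<and>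
        res (incl l (dsrc a) s) x = res a y"
  have "bij_betw (\<lambda>z. (res (glue l s a) z, res (incl l (dtgt a) s) z))
      (XO (l + dtgt a + s))
      {(x, y). x \<in> XO (l + dsrc a + s) \<and> y \<in> XO (dtgt a) \<and>
        res (incl l (dsrc a) s) x = res a y}"
    using glue_pullback[of a l s] * unfolding strict_pullback_def obs_ars_simps by (elim conjE) simp
  from bij_betw_ex1[OF this, of "(x, y)"] *
  show "\<exists>!w. w \<in> XO (l + dtgt a + s) \<and> res (glue l s a) w = x \<and>
           res (incl l (dtgt a) s) w = y"
    by simp
qed

lemma decomp_ars: "decomposition_set (ars X)"
  unfolding decomposition_set_def
proof (intro conjI sset_ars allI impI)
  fix a l s x y
  assume *: "active a \<and> x \<in> XA (l + dsrc a + s) \<and> y \<in> XA (dtgt a) \<and>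
        resA (incl l (dsrc a) s) x = resA a y"
  have "bij_betw (\<lambda>z. (resA (glue l s a) z, resA (incl l (dtgt a) s) z))
      (XA (l + dtgt a + s))
      {(x, y). x \<in> XA (l + dsrc a + s) \<and> y \<in> XA (dtgt a) \<and>
        resA (incl l (dsrc a) s) x = resA a y}"
    using glue_pullback[of a l s] * unfolding strict_pullback_def obs_ars_simps by (elim conjE) simp
  from bij_betw_ex1[OF this, of "(x, y)"] *
  show "\<exists>!w. w \<in> XA (l + dtgt a + s) \<and> resA (glue l s a) w = x \<and>
           resA (incl l (dtgt a) s) w = y"
    by simp
qed

lemma obs_in: "x \<in> XO n \<Longrightarrow> dtgt p = n \<Longrightarrow> dsrc p = m \<Longrightarrow> res p x \<in> XO m"
  using sact_in[OF sset_obs] by blast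

lemma ars_in: "x \<in> XA n \<Longrightarrow> dtgt p = n \<Longrightarrow> dsrc p = m \<Longrightarrow> resA p x \<in> XA m"
  using sact_in[OF sset_ars] by blast

section \<open>Lifting arrows along the long edge\<close>

abbreviation lng :: "nat \<Rightarrow> 'u \<Rightarrow> 'u" where "lng n x \<equiv> res (dlong n) x"
abbreviation lngA :: "nat \<Rightarrow> 'a \<Rightarrow> 'a" where "lngA n x \<equiv> resA (dlong n) x"

lemma long_act: "x \<in> XO n \<Longrightarrow> active p \<Longrightarrow> dtgt p = n \<Longrightarrow> dsrc p = m \<Longrightarrow>
    lng m (res p x) = lng n x"
  using active_dlong[of p] by (auto simp: sact_sact[OF sset_obs])

lemma longA_act: "x \<in> XA n \<Longrightarrow> active p \<Longrightarrow> dtgt p = n \<Longrightarrow> dsrc p = m \<Longrightarrow>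
    lngA m (resA p x) = lngA n x"
  using active_dlong[of p] by (auto simp: sact_sact[OF sset_ars])

text \<open>Discreteness spreads from \<open>d_1\<close> by induction: a simplex of dimension
  \<open>k + 2\<close> amounts to its first 2-simplex together with the face that omits vertex 1. An
  arrow lifts to that face by induction, the first edge of the lift then lifts to the 2-simplex, and
  the decomposition property of the arrows pastes the two lifts.\<close>

lemma long_lift_target:
  assumes "e \<in> XO (k + 1)" "\<beta> \<in> XA 1" "tgt (lev X 1) \<beta> = lng (k + 1) e"
  shows "\<exists>!\<epsilon>. \<epsilon> \<in> XA (k + 1) \<and> tgt (lev X (k + 1)) \<epsilon> = e \<and> lngA (k + 1) \<epsilon> = \<beta>"
  using assms
proof (induction k arbitrary: e \<beta>)
  case 0
  have o: "lng 1 e = e" if "e \<in> XO 1" for e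
    using sact_did[OF sset_obs that] by (simp add: dlong_1)
  have a: "lngA 1 e = e" if "e \<in> XA 1" for e
    using sact_did[OF sset_ars that] by (simp add: dlong_1)
  show ?case unfolding add_0
  proof (rule ex1I[of _ \<beta>])
    show "\<beta> \<in> XA 1 \<and> tgt (lev X 1) \<beta> = e \<and> lngA 1 \<beta> = \<beta>"
      using 0 o a by simp
  qed (use a in metis)
next
  case (Suc k)
  have two: "\<exists>!\<epsilon>. \<epsilon> \<in> XA 2 \<and> tgt (lev X 2) \<epsilon> = e \<and> lngA 2 \<epsilon> = \<beta>"
    if "e \<in> XO 2" "\<beta> \<in> XA 1" "tgt (lev X 1) \<beta> = lng 2 e" for e \<beta>
  proof -
    have "coface 1 1 = dlong 2" by (rule simplex_map_eqI) (auto simp: le_Suc_eq One_nat_def)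
    then show ?thesis
      using rigid that
      unfolding rigid_decomposition_groupoid_def discrete_fibration_def obs_ars_simps by simp
  qed
  let ?g = "glue 0 k (dlong 2)" and ?i = "incl 0 2 k" and ?j = "incl 0 1 k"
  have g: "active ?g" "dtgt ?g = k + 2" "dsrc ?g = k + 1" by (simp_all add: active_glue)
  have n: "Suc k + 1 = k + 2" by simp
  have sq: "?g \<odot> ?j = ?i \<odot> dlong 2"
  proof (rule simplex_map_eqI)
    fix i assume "i \<le> dsrc (?g \<odot> ?j)"
    then consider "i = 0" | "i = 1" by fastforce
    then show "dapp (?g \<odot> ?j) i = dapp (?i \<odot> dlong 2) i" by cases auto
  qed auto
  have e: "e \<in> XO (k + 2)" using Suc.prems(1) by (simp only: n)
  have be: "tgt (lev X 1) \<beta> = lng (k + 2) e" using Suc.prems(3) by (simp only: n)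
  have ge: "res ?g e \<in> XO (k + 1)" by (rule obs_in[OF e g(2,3)])
  have ie: "res ?i e \<in> XO 2" by (rule obs_in[OF e]) auto
  obtain \<epsilon>1 where e1: "\<epsilon>1 \<in> XA (k + 1)" "tgt (lev X (k + 1)) \<epsilon>1 = res ?g e"
    "lngA (k + 1) \<epsilon>1 = \<beta>"
    using ex1_implies_ex[OF Suc.IH[OF ge Suc.prems(2)]] be long_act[OF e g] by auto
  have j1: "resA ?j \<epsilon>1 \<in> XA 1" by (rule ars_in[OF e1(1)]) auto
  have "tgt (lev X 1) (resA ?j \<epsilon>1) = lng 2 (res ?i e)"
    using tgt_act[OF e1(1), of ?j 1] e1(2) e sq by (simp add: sact_sact[OF sset_obs] add.commute)
  then obtain \<epsilon>2 where e2: "\<epsilon>2 \<in> XA 2" "tgt (lev X 2) \<epsilon>2 = res ?i e"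
    "lngA 2 \<epsilon>2 = resA ?j \<epsilon>1"
    using ex1_implies_ex[OF two[OF ie j1]] by blast
  obtain \<epsilon> where \<epsilon>: "\<epsilon> \<in> XA (k + 2)" "resA ?g \<epsilon> = \<epsilon>1" "resA ?i \<epsilon> = \<epsilon>2"
    using decomp_ex[OF decomp_ars active_simps(2), of \<epsilon>1 0 2 k \<epsilon>2,
        unfolded dlong_simps add_0 add.commute[of 1 k] add.commute[of 2 k]] e1(1) e2(1,3)
    by metis
  \<comment> \<open>The target of the pasted arrow has the same two components as
    \<open>e\<close>.\<close>
  have "tgt (lev X (k + 2)) \<epsilon> = e"
  proof (rule decomp_unique[OF decomp_obs, of "dlong 2" _ 0 k])
    show "tgt (lev X (k + 2)) \<epsilon> \<in> XO (0 + dtgt (dlong 2) + k)"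
      using tgt_in[OF \<epsilon>(1)] by (simp add: add.commute)
    show "e \<in> XO (0 + dtgt (dlong 2) + k)" using e by (simp add: add.commute)
    show "res ?g (tgt (lev X (k + 2)) \<epsilon>) = res ?g e"
      using tgt_act[OF \<epsilon>(1) g(2,3)] \<epsilon>(2) e1(2) by simp
    show "res (incl 0 (dtgt (dlong 2)) k) (tgt (lev X (k + 2)) \<epsilon>) =
        res (incl 0 (dtgt (dlong 2)) k) e"
      using tgt_act[OF \<epsilon>(1), of ?i 2] \<epsilon>(3) e2(2) by simp
  qed simp
  moreover have "lngA (k + 2) \<epsilon> = \<beta>" using longA_act[OF \<epsilon>(1) g] \<epsilon>(2) e1(3) by simp
  moreover have "\<epsilon>' = \<epsilon>''"
    if a: "\<epsilon>' \<in> XA (k + 2)" "tgt (lev X (k + 2)) \<epsilon>' = e" "lngA (k + 2) \<epsilon>' = \<beta>"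
      and b: "\<epsilon>'' \<in> XA (k + 2)" "tgt (lev X (k + 2)) \<epsilon>'' = e" "lngA (k + 2) \<epsilon>'' = \<beta>" for \<epsilon>' \<epsilon>''
  proof -
    have g_props: "resA ?g x \<in> XA (k + 1) \<and>
        tgt (lev X (k + 1)) (resA ?g x) = res ?g e \<and>
        lngA (k + 1) (resA ?g x) = \<beta>"
      if "x \<in> XA (k + 2)" "tgt (lev X (k + 2)) x = e" "lngA (k + 2) x = \<beta>" for x
      using that ars_in[OF that(1) g(2,3)] tgt_act[OF that(1) g(2,3)] longA_act[OF that(1) g] by simp
    have "tgt (lev X 1) \<beta> = lng (k + 1) (res ?g e)" using be long_act[OF e g] by simp
    from Suc.IH[OF ge Suc.prems(2) this]
    have 1: "resA ?g \<epsilon>' = resA ?g \<epsilon>''"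
      using g_props[OF a] g_props[OF b] by blast
    have i_props: "resA ?i x \<in> XA 2 \<and>
        tgt (lev X 2) (resA ?i x) = res ?i e \<and>
        lngA 2 (resA ?i x) = resA ?j (resA ?g x)"
      if "x \<in> XA (k + 2)" "tgt (lev X (k + 2)) x = e" for x
      using that ars_in[OF that(1), of ?i 2] tgt_act[OF that(1), of ?i 2] sq
        sact_sact[OF sset_ars, of x ?i "dlong 2"] sact_sact[OF sset_ars, of x ?g ?j]
      by (simp add: add.commute)
    have gb: "resA ?g \<epsilon>'' \<in> XA (k + 1)" using g_props[OF b] by blast
    have j1': "resA ?j (resA ?g \<epsilon>'') \<in> XA 1"
      by (rule ars_in[OF gb]) auto
    have "tgt (lev X 1) (resA ?j (resA ?g \<epsilon>'')) = lng 2 (res ?i e)"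
      using tgt_act[OF gb, of ?j 1] g_props[OF b] e sq
        sact_sact[OF sset_obs, of e ?i "dlong 2"] sact_sact[OF sset_obs, of e ?g ?j]
      by (simp add: add.commute)
    from two[OF ie j1' this] have 2: "resA ?i \<epsilon>' = resA ?i \<epsilon>''"
      using i_props[OF a(1,2)] i_props[OF b(1,2)] 1 by auto
    show ?thesis
      by (rule decomp_unique[OF decomp_ars, of "dlong 2" _ 0 k])
        (use a(1) b(1) 1 2 in \<open>simp_all add: add.commute\<close>)
  qed
  ultimately show ?case unfolding n
    by (intro ex1I[of _ \<epsilon>]) (use \<epsilon>(1) in blast)+
qed

lemma arrow_ars: "arrow (lev X n) \<alpha> x y \<Longrightarrow> \<alpha> \<in> XA n"
  "\<alpha> \<in> XA n \<Longrightarrow> arrow (lev X n) \<alpha> (src (lev X n) \<alpha>) (tgt (lev X n) \<alpha>)"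
  by (simp_all add: arrow_def obs_ars_simps)

lemma act_inverse:
  assumes "arrow (lev X n) \<alpha> x y" "arrow (lev X n) \<beta> y x" "cmp (lev X n) \<beta> \<alpha> = idn (lev X n) x"
    and p: "dtgt p = n" "dsrc p = m"
  shows "arrow (lev X m) (resA p \<alpha>) (res p x) (res p y)"
    "arrow (lev X m) (resA p \<beta>) (res p y) (res p x)"
    "cmp (lev X m) (resA p \<beta>) (resA p \<alpha>) = idn (lev X m) (res p x)"
proof -
  note F = gfunctorD[OF act_ftr[of p], unfolded p obs_ars_simps]
  have x: "x \<in> XO n" using assms(1) src_in[OF arrow_ars(1)[OF assms(1)]] by (simp add: arrow_def)
  show "arrow (lev X m) (resA p \<alpha>) (res p x) (res p y)"
    "arrow (lev X m) (resA p \<beta>) (res p y) (res p x)"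
    using F(5) assms by blast+
  show "cmp (lev X m) (resA p \<beta>) (resA p \<alpha>) = idn (lev X m) (res p x)"
    using F(7)[OF assms(1,2)] F(6)[OF x] assms(3) by simp
qed

text \<open>The lifts above have a prescribed target, whereas transport needs a prescribed source.
  So the inverse of \<beta> is lifted, and the lift is inverted.\<close>

lemma long_lift_ex:
  assumes x: "x \<in> XO n" and n: "n \<ge> 1" and b: "\<beta> \<in> XA 1" "src (lev X 1) \<beta> = lng n x"
  obtains \<alpha> where "\<alpha> \<in> XA n" "src (lev X n) \<alpha> = x" "lngA n \<alpha> = \<beta>"
proof -
  let ?g = "tgt (lev X 1) \<beta>"
  have ab: "arrow (lev X 1) \<beta> (lng n x) ?g" using arrow_ars(2)[OF b(1)] b(2) by simp
  obtain \<gamma> where c: "arrow (lev X 1) \<gamma> ?g (lng n x)" "cmp (lev X 1) \<gamma> \<beta> = idn (lev X 1) (lng n x)"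
    "cmp (lev X 1) \<beta> \<gamma> = idn (lev X 1) ?g"
    using groupoidD(8)[OF gpd ab] by blast
  have "n - 1 + 1 = n" using n by simp
  then obtain \<delta> where d: "\<delta> \<in> XA n" "tgt (lev X n) \<delta> = x" "lngA n \<delta> = \<gamma>"
    using long_lift_target[of x "n - 1" \<gamma>] x c(1) arrow_ars(1)[OF c(1)] by (auto simp: arrow_def)
  let ?y = "src (lev X n) \<delta>"
  have ad: "arrow (lev X n) \<delta> ?y x" using arrow_ars(2)[OF d(1)] d(2) by simp
  obtain \<alpha> where a: "arrow (lev X n) \<alpha> x ?y" "cmp (lev X n) \<alpha> \<delta> = idn (lev X n) ?y"
    "cmp (lev X n) \<delta> \<alpha> = idn (lev X n) x"
    using groupoidD(8)[OF gpd ad] by blast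
  note A = act_inverse[OF ad a(1,2), of "dlong n" 1]
  have y: "res (dlong n) ?y = ?g"
    using A(1) c(1) d(3) by (simp add: arrow_def)
  have "lngA n \<alpha> = \<beta>"
    by (rule groupoid_inverse_unique[OF gpd c(1) _ ab _ c(2)])
      (use A d(3) y in auto)
  then show thesis using that a(1) arrow_ars(1)[OF a(1)] by (auto simp: arrow_def)
qed

lemma long_lift_unique:
  assumes a: "\<alpha> \<in> XA n" "\<alpha>' \<in> XA n" and s: "src (lev X n) \<alpha> = src (lev X n) \<alpha>'"
    and l: "lngA n \<alpha> = lngA n \<alpha>'"
  shows "\<alpha> = \<alpha>'"
proof (cases "n = 0")
  case True
  \<comment> \<open>In dimension 0 the long edge is a degenerate edge, and its vertex recovers the
    arrow.\<close>
  have "dlong 0 \<odot> vert 1 0 = did 0" by (rule simplex_map_eqI) auto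
  then have "\<alpha> = resA (vert 1 0) (lngA 0 \<alpha>)" if "\<alpha> \<in> XA 0" for \<alpha>
    using that sact_did[OF sset_ars that] by (simp add: sact_sact[OF sset_ars])
  then show ?thesis using a l True by metis
next
  case False
  then have n: "n - 1 + 1 = n" by simp
  let ?x = "src (lev X n) \<alpha>" and ?\<beta> = "lngA n \<alpha>"
  have inv: "\<exists>\<gamma>. arrow (lev X n) \<gamma> (tgt (lev X n) \<alpha>) ?x \<and> cmp (lev X n) \<gamma> \<alpha> = idn (lev X n) ?x \<and>
    cmp (lev X n) \<alpha> \<gamma> = idn (lev X n) (tgt (lev X n) \<alpha>)" if "\<alpha> \<in> XA n" "src (lev X n) \<alpha> = ?x" for \<alpha>
    using groupoidD(8)[OF gpd arrow_ars(2)[OF that(1)]] that(2) by auto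
  obtain \<gamma> where c: "arrow (lev X n) \<gamma> (tgt (lev X n) \<alpha>) ?x" "cmp (lev X n) \<gamma> \<alpha> = idn (lev X n) ?x"
    "cmp (lev X n) \<alpha> \<gamma> = idn (lev X n) (tgt (lev X n) \<alpha>)" using inv[OF a(1)] by auto
  obtain \<gamma>' where c': "arrow (lev X n) \<gamma>' (tgt (lev X n) \<alpha>') ?x" "cmp (lev X n) \<gamma>' \<alpha>' = idn (lev X n) ?x"
    "cmp (lev X n) \<alpha>' \<gamma>' = idn (lev X n) (tgt (lev X n) \<alpha>')" using inv[OF a(2)] s by auto
  have ar: "arrow (lev X n) \<alpha> ?x (tgt (lev X n) \<alpha>)" "arrow (lev X n) \<alpha>' ?x (tgt (lev X n) \<alpha>')"
    using arrow_ars(2)[OF a(1)] arrow_ars(2)[OF a(2)] s by auto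
  note A = act_inverse[OF ar(1) c(1,2), of "dlong n" 1] and A' = act_inverse[OF ar(2) c'(1,2), of "dlong n" 1]
  note B = act_inverse[OF c(1) ar(1) c(3), of "dlong n" 1] and B' = act_inverse[OF c'(1) ar(2) c'(3), of "dlong n" 1]
  have t: "lng n (tgt (lev X n) \<alpha>') = lng n (tgt (lev X n) \<alpha>)"
    using tgt_act[OF a(1), of "dlong n" 1] tgt_act[OF a(2), of "dlong n" 1] l by simp
  \<comment> \<open>Restriction to \<open>X_1\<close> preserves inverses, so the two inverses have
    the same long edge; both have target \<open>?x\<close>, which makes uniqueness of lifts with
    given target applicable.\<close>
  have "lngA n \<gamma> = lngA n \<gamma>'"
    by (rule groupoid_inverse_unique[OF gpd A(1) A(2)]) (use A A' B' l t in auto)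
  moreover have "\<gamma> \<in> XA n" "\<gamma>' \<in> XA n" using c c' arrow_ars(1) by blast+
  moreover have "tgt (lev X n) \<gamma> = ?x" "tgt (lev X n) \<gamma>' = ?x" using c c' by (auto simp: arrow_def)
  ultimately have "\<gamma> = \<gamma>'"
    using long_lift_target[of ?x "n - 1" "lngA n \<gamma>"] src_in[OF a(1)] ars_in[of \<gamma> n "dlong n" 1]
      tgt_act[of \<gamma> n "dlong n" 1] unfolding n by auto
  then have "tgt (lev X n) \<alpha> = tgt (lev X n) \<alpha>'" using c(1) c'(1) by (simp add: arrow_def)
  then show ?thesis
    using groupoid_inverse_unique[OF gpd c(1) ar(1) _ c(3)] ar(2) c'(2) \<open>\<gamma> = \<gamma>'\<close> by simp
qed

section \<open>The interval construction\<close>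

lemma I_cells_eq: "I_cells X f = cells (intv f)"
  by (rule ext) (simp add: fib_def I_cells_def long_ob_def obs_ars_simps)

lemma I_int_eq: "I_int X f = intv f"
  unfolding I_int_def I_cells_eq obs_ars_simps by (simp add: fib_def)

lemma M_map_eq: "M_map X f = proj f"
proof (rule ext, rule extensionalityI[of _ "cells (intv f) n" for n])
  fix n
  show "M_map X f n \<in> extensional (cells (intv f) n)"
    "proj f n \<in> extensional (cells (intv f) n)"
    by (simp_all add: M_map_def fib_proj_def I_cells_eq)
  fix x assume x: "x \<in> cells (intv f) n"
  then show "M_map X f n x = proj f n x"
    by (simp add: M_map_def I_cells_eq obs_ars_simps sact_sact[OF sset_obs] fib_cells iota_eq_coface add.assoc)
qed

lemma simplex_as_map_eq: "simplex_as_map X n x = yoneda (obs X) n x"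
  by (rule ext) (simp add: simplex_as_map_def yoneda_def obs_ars_simps)

text \<open>The top simplex of the stretched map belonging to \<open>x\<close>: the simplex
  \<open>x\<close> with both end vertices repeated, seen in the interval of its long edge.\<close>

abbreviation hat :: "nat \<Rightarrow> 'u \<Rightarrow> 'u" where "hat n x \<equiv> res (extend (did n)) x"

abbreviation Ivl :: "nat \<Rightarrow> 'u \<Rightarrow> 'u interval" where "Ivl n x \<equiv> intv (lng n x)"

lemma lng_in: "x \<in> XO n \<Longrightarrow> lng n x \<in> XO 1"
  by (rule obs_in) auto

lemma hat_in: "x \<in> XO n \<Longrightarrow> hat n x \<in> cells (Ivl n x) n"
  using fib_ext[OF sset_obs, of x n "did n"] by simp

lemma hat_iota: "x \<in> XO n \<Longrightarrow> res (iota n) (hat n x) = x"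
  using ext_iota[of "did n"] sact_did[OF sset_obs] by (simp add: sact_sact[OF sset_obs])

lemma Int_dai: "x \<in> XO n \<Longrightarrow> discrete_algebraic_interval (Ivl n x)"
  by (rule dai_fib[OF decomp_obs lng_in])

lemma sset_Int: "sset (intv f)" by (rule sset_fib[OF sset_obs])

text \<open>Both maps are stretched and so agree on the long edge, and they agree after the culf
  projection to \<open>X\<close>.\<close>

lemma phi_unique:
  assumes x: "x \<in> XO n" and a: "stretched (std_simplex n) (Ivl n x) a"
    and M: "scomp (std_simplex n) (proj (lng n x)) a = yoneda (obs X) n x"
  shows "a = yoneda (Ivl n x) n (hat n x)"
proof (rule culf_unique[OF has_cones_std_simplex culf_fib_proj[OF decomp_obs]])
  have a': "(Ivl n x, a) \<in> U_ob n" and b': "(Ivl n x, yoneda (Ivl n x) n (hat n x)) \<in> U_ob n"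
    using a stretched_fib[OF sset_obs x] Int_dai[OF x] by (simp_all add: U_ob_def)
  show "smap (std_simplex n) (Ivl n x) a" using a by (simp add: stretched_def)
  show "smap (std_simplex n) (Ivl n x) (yoneda (Ivl n x) n (hat n x))"
    by (rule smap_yoneda[OF sset_Int hat_in[OF x]])
  show "proj (lng n x) k (a k s) = proj (lng n x) k (yoneda (Ivl n x) n (hat n x) k s)"
    if "s \<in> cells (std_simplex n) k" for k s
  proof -
    have s: "dsrc s = k" "dtgt s = n" using that by auto
    have "yoneda (Ivl n x) n (hat n x) k s = res (extend s) x"
      using fib_sact_ext[OF sset_obs x, of "did n" s] s by simp
    then show ?thesis
      using scomp_eq_app[OF M that] fib_proj_ext[OF sset_obs x s(2,1)] s by simp
  qed
  show "a 1 e = yoneda (Ivl n x) n (hat n x) 1 e" if "long_edge (std_simplex n) e" for e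
    using U_ob_long_edge_eq[OF a'] U_ob_long_edge[OF b'] that by (simp add: std_simplex_long_edge)
qed

lemma phi_eq:
  assumes x: "x \<in> XO n"
  shows "phi X n x = yoneda (Ivl n x) n (hat n x)"
  unfolding phi_def I_int_eq long_ob_def M_map_eq simplex_as_map_eq obs_ars_simps
proof (rule the_equality)
  show "stretched (std_simplex n) (Ivl n x) (yoneda (Ivl n x) n (hat n x)) \<and>
    scomp (std_simplex n) (proj (lng n x)) (yoneda (Ivl n x) n (hat n x)) = yoneda (obs X) n x"
    using stretched_fib[OF sset_obs x] scomp_yoneda[OF sset_Int smap_fib_proj[OF sset_obs] hat_in[OF x]]
      hat_in[OF x] hat_iota[OF x] by simp
qed (use phi_unique[OF x] in blast)

lemma I_ob_eq: "x \<in> XO n \<Longrightarrow> I_ob X n x = (Ivl n x, yoneda (Ivl n x) n (hat n x))"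
  by (simp add: I_ob_def I_int_eq phi_eq long_ob_def obs_ars_simps)

lemma I_ob_in: "x \<in> XO n \<Longrightarrow> I_ob X n x \<in> U_ob n"
  using stretched_fib[OF sset_obs] Int_dai by (simp add: I_ob_eq U_ob_def)

lemma fst_I_ob: "x \<in> XO n \<Longrightarrow> fst (I_ob X n x) = Ivl n x"
  by (simp add: I_ob_eq)

section \<open>The culf maps between the intervals of X\<close>

definition comparison_map :: "simplex_map \<Rightarrow> 'u \<Rightarrow> (nat \<Rightarrow> 'u \<Rightarrow> 'u) \<Rightarrow> bool" where
  "comparison_map p x c \<longleftrightarrow>
     (let x' = res p x; f = lng (dtgt p) x; f' = lng (dsrc p) x' in
     smap (intv f') (intv f) c \<and> c (dsrc p) (hat (dsrc p) x') = res (extend p) x \<and>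
     scomp (intv f') (proj f) c = proj f')"

lemma comparison_map_unique:
  "x \<in> XO (dtgt p) \<Longrightarrow> comparison_map p x c \<Longrightarrow> comparison_map p x d \<Longrightarrow> c = d"
  unfolding comparison_map_def Let_def
  by (rule fib_map_unique[OF decomp_obs _ refl refl refl refl refl]) blast+

text \<open>Maps out of a standard simplex are determined by their top simplex, so the equation of
  maps is one between two simplices.\<close>

lemma scomp_phi_iff:
  assumes x: "x \<in> XO (dtgt p)" and x': "x' = res p x"
    and c: "smap (Ivl (dsrc p) x') (Ivl (dtgt p) x) c"
  shows "scomp (std_simplex (dsrc p)) c (phi X (dsrc p) x') =
      scomp (std_simplex (dsrc p)) (phi X (dtgt p) x) (std_map p) \<longleftrightarrow>
    c (dsrc p) (hat (dsrc p) x') = res (extend p) x"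
proof -
  have x'A: "x' \<in> XO (dsrc p)" unfolding x' by (rule obs_in[OF x refl refl])
  have 1: "sact (Ivl (dtgt p) x) p (hat (dtgt p) x) = res (extend p) x"
    using fib_sact_ext[OF sset_obs x, of "did (dtgt p)" p] by simp
  have 2: "res (extend p) x \<in> cells (Ivl (dtgt p) x) (dsrc p)"
    using fib_ext[OF sset_obs x, of p] by simp
  show ?thesis
    unfolding phi_eq[OF x] phi_eq[OF x'A] scomp_yoneda[OF sset_Int c hat_in[OF x'A]]
      scomp_yoneda_std_map[OF sset_Int hat_in[OF x]] 1
    by (rule yoneda_inject[OF sset_Int smap_in[OF c hat_in[OF x'A]] 2])
qed

lemma I_culf_comparison_map:
  assumes x: "x \<in> XO (dtgt p)"
  shows "comparison_map p x (I_culf X p x)"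
proof -
  let ?x' = "res p x"
  obtain c where c: "comparison_map p x c"
    using fib_map_ex[OF decomp_obs x refl refl refl refl refl] unfolding comparison_map_def Let_def by blast
  have "I_culf X p x = (THE c. comparison_map p x c)"
    unfolding I_culf_def Let_def I_int_eq M_map_eq long_ob_def obs_ars_simps comparison_map_def
    by (rule arg_cong[where f = The], rule ext) (use scomp_phi_iff[OF x refl] in blast)
  also have "\<dots> = c"
    by (rule the_equality[where P = "comparison_map p x", OF c]) (rule comparison_map_unique[OF x _ c])
  finally show ?thesis using c by simp
qed

lemma I_culf_eqI: "x \<in> XO (dtgt p) \<Longrightarrow> comparison_map p x c \<Longrightarrow> I_culf X p x = c"
  using comparison_map_unique I_culf_comparison_map by blast

lemma I_culf_props:
  assumes x: "x \<in> XO (dtgt p)"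
  shows "smap (Ivl (dsrc p) (res p x)) (Ivl (dtgt p) x) (I_culf X p x)"
    "I_culf X p x (dsrc p) (hat (dsrc p) (res p x)) = res (extend p) x"
    "scomp (Ivl (dsrc p) (res p x)) (proj (lng (dtgt p) x)) (I_culf X p x) =
      proj (lng (dsrc p) (res p x))"
    "strict_culf (Ivl (dsrc p) (res p x)) (Ivl (dtgt p) x) (I_culf X p x)"
    "scomp (std_simplex (dsrc p)) (I_culf X p x) (snd (I_ob X (dsrc p) (res p x))) =
      scomp (std_simplex (dsrc p)) (snd (I_ob X (dtgt p) x)) (std_map p)"
proof -
  show 1: "smap (Ivl (dsrc p) (res p x)) (Ivl (dtgt p) x) (I_culf X p x)"
    "I_culf X p x (dsrc p) (hat (dsrc p) (res p x)) = res (extend p) x"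
    "scomp (Ivl (dsrc p) (res p x)) (proj (lng (dtgt p) x)) (I_culf X p x) =
      proj (lng (dsrc p) (res p x))"
    using I_culf_comparison_map[OF x] unfolding comparison_map_def Let_def by blast+
  show "strict_culf (Ivl (dsrc p) (res p x)) (Ivl (dtgt p) x) (I_culf X p x)"
    by (rule culf_fib_map[OF decomp_obs 1(1,3)])
  show "scomp (std_simplex (dsrc p)) (I_culf X p x) (snd (I_ob X (dsrc p) (res p x))) =
      scomp (std_simplex (dsrc p)) (snd (I_ob X (dtgt p) x)) (std_map p)"
    unfolding I_ob_def snd_conv using scomp_phi_iff[OF x refl 1(1)] 1(2) by simp
qed

lemma I_culf_char:
  assumes x: "x \<in> XO (dtgt p)" and y: "y \<in> cells (Ivl (dsrc p) (res p x)) k"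
    and w: "w \<in> XO (k + 4)"
      "res (shift (dlong (k + 2))) w = res (extend (p \<odot> dlong (dsrc p))) x"
      "res (iota (k + 2)) w = y"
  shows "I_culf X p x k y = res (shift (iota k)) w"
  by (rule fib_map_char[OF decomp_obs x refl refl refl refl refl I_culf_props(1-3)[OF x] y w])

lemma I_culf_active:
  assumes x: "x \<in> XO (dtgt p)" and p: "active p"
  shows "I_culf X p x = sid (Ivl (dtgt p) x)"
proof (rule I_culf_eqI[OF x])
  have l: "lng (dsrc p) (res p x) = lng (dtgt p) x" by (rule long_act[OF x p refl refl])
  have "hat (dsrc p) (res p x) = res (extend p) x"
    using x p by (simp add: sact_sact[OF sset_obs] active_dcomp_ext)
  then show "comparison_map p x (sid (Ivl (dtgt p) x))"
    using l smap_sid[OF sset_Int] scomp_sid_right[OF smap_fib_proj[OF sset_obs]]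
      fib_ext[OF sset_obs x, of p]
    by (simp add: comparison_map_def)
qed

text \<open>The composite satisfies the conditions that single out the map for
  \<open>q \<odot> p\<close>.\<close>

lemma I_culf_dcomp:
  assumes x: "x \<in> XO (dtgt q)" and pq: "dtgt p = dsrc q"
  shows "I_culf X (q \<odot> p) x =
    scomp (Ivl (dsrc p) (res (q \<odot> p) x)) (I_culf X q x) (I_culf X p (res q x))"
proof (rule I_culf_eqI)
  let ?y = "res q x"
  have y: "?y \<in> XO (dtgt p)" using obs_in[OF x refl refl] pq by simp
  have py: "res p ?y = res (q \<odot> p) x" using x pq by (simp add: sact_sact[OF sset_obs])
  note q = I_culf_props[OF x] and p = I_culf_props[OF y, unfolded py]
  show "x \<in> XO (dtgt (q \<odot> p))" using x pq by simp
  have z: "res (q \<odot> p) x \<in> XO (dsrc p)" by (rule obs_in[OF x]) (use pq in auto)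
  have "I_culf X q x (dsrc p) (res (extend p) ?y) = res (extend (q \<odot> p)) x"
  proof -
    have "res (extend p) ?y = sact (Ivl (dsrc q) ?y) p (hat (dsrc q) ?y)"
      using fib_sact_ext[OF sset_obs y, of "did (dsrc q)" p] pq by simp
    then show ?thesis
      using smap_sact[OF q(1) hat_in, of p "dsrc p"] y pq q(2) fib_sact_ext[OF sset_obs x, of q p] by simp
  qed
  moreover have "scomp (Ivl (dsrc p) (res (q \<odot> p) x)) (proj (lng (dtgt q) x))
     (scomp (Ivl (dsrc p) (res (q \<odot> p) x)) (I_culf X q x) (I_culf X p ?y)) =
     proj (lng (dsrc p) (res (q \<odot> p) x))"
    using p(3) q(3) pq unfolding scomp_assoc[OF p(1)] by simp
  ultimately show "comparison_map (q \<odot> p) x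
     (scomp (Ivl (dsrc p) (res (q \<odot> p) x)) (I_culf X q x) (I_culf X p ?y))"
    unfolding comparison_map_def Let_def dcomp_simps(1,2)[OF pq]
    using smap_scomp[OF sset_Int p(1) q(1)[folded pq]] p(2) hat_in[OF z] pq by simp
qed

section \<open>Transport along arrows of X_1\<close>

lemma transport_eq:
  assumes e: "\<epsilon> \<in> XA (k + 2)"
  shows "transport X (lngA (k + 2) \<epsilon>) k (src (lev X (k + 2)) \<epsilon>) = tgt (lev X (k + 2)) \<epsilon>"
proof -
  have l: "src (lev X 1) (lngA (k + 2) \<epsilon>) = lng (k + 2) (src (lev X (k + 2)) \<epsilon>)"
    by (rule src_act[OF e]) auto
  have "(THE \<epsilon>'. \<epsilon>' \<in> XA (k + 2) \<and> src (lev X (k + 2)) \<epsilon>' = src (lev X (k + 2)) \<epsilon> \<and>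
      lngA (k + 2) \<epsilon>' = lngA (k + 2) \<epsilon>) = \<epsilon>"
    by (rule the_equality) (use e long_lift_unique[OF _ e] in auto)
  then show ?thesis
    using src_in[OF e] l by (simp add: transport_def I_cells_eq fib_cells long_ar_def obs_ars_simps)
qed

text \<open>Keeps the lifting arrow as a witness, which turns claims about \<open>transport\<close>
  into claims about the source and target of an arrow.\<close>

lemma fib_lift:
  assumes b: "arrow (lev X 1) \<beta> f g" and y: "y \<in> cells (intv f) k"
  obtains \<epsilon> where "\<epsilon> \<in> XA (k + 2)" "src (lev X (k + 2)) \<epsilon> = y" "lngA (k + 2) \<epsilon> = \<beta>"
    "transport X \<beta> k y = tgt (lev X (k + 2)) \<epsilon>" "tgt (lev X (k + 2)) \<epsilon> \<in> cells (intv g) k"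
proof -
  have "src (lev X 1) \<beta> = lng (k + 2) y" "y \<in> XO (k + 2)" using b y by (auto simp: arrow_def fib_cells)
  then obtain \<epsilon> where e: "\<epsilon> \<in> XA (k + 2)" "src (lev X (k + 2)) \<epsilon> = y" "lngA (k + 2) \<epsilon> = \<beta>"
    using long_lift_ex[of y "k + 2" \<beta>] arrow_ars(1)[OF b] by auto
  have "lng (k + 2) (tgt (lev X (k + 2)) \<epsilon>) = g"
    using tgt_act[OF e(1), of "dlong (k + 2)" 1] e(3) b by (simp add: arrow_def)
  then show thesis using that[OF e] transport_eq[OF e(1)] e tgt_in[OF e(1)] by (simp add: fib_cells)
qed

lemma smap_transport:
  assumes b: "arrow (lev X 1) \<beta> f g"
  shows "smap (intv f) (intv g) (transport X \<beta>)"
proof (rule smapI)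
  show "transport X \<beta> n \<in> extensional (cells (intv f) n)" for n
    using b by (simp add: transport_def I_cells_eq arrow_def)
  show "transport X \<beta> n y \<in> cells (intv g) n" if y: "y \<in> cells (intv f) n" for n y
    by (rule fib_lift[OF b y]) simp
  fix p y assume y: "y \<in> cells (intv f) (dtgt p)"
  obtain \<epsilon> where e: "\<epsilon> \<in> XA (dtgt p + 2)" "src (lev X (dtgt p + 2)) \<epsilon> = y"
    "lngA (dtgt p + 2) \<epsilon> = \<beta>" "transport X \<beta> (dtgt p) y = tgt (lev X (dtgt p + 2)) \<epsilon>"
    "tgt (lev X (dtgt p + 2)) \<epsilon> \<in> cells (intv g) (dtgt p)" by (rule fib_lift[OF b y])
  have pe: "resA (shift p) \<epsilon> \<in> XA (dsrc p + 2)" by (rule ars_in[OF e(1)]) auto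
  have "lngA (dsrc p + 2) (resA (shift p) \<epsilon>) = \<beta>"
    using longA_act[OF e(1), of "shift p" "dsrc p + 2"] e(3) by simp
  then show "transport X \<beta> (dsrc p) (sact (intv f) p y) = sact (intv g) p (transport X \<beta> (dtgt p) y)"
    using transport_eq[OF pe] src_act[OF e(1), of "shift p" "dsrc p + 2"]
      tgt_act[OF e(1), of "shift p" "dsrc p + 2"] e y by (simp add: fib_sact)
qed

lemma transport_comp:
  assumes b: "arrow (lev X 1) \<beta> f g" and c: "arrow (lev X 1) \<gamma> g h"
  shows "transport X (cmp (lev X 1) \<gamma> \<beta>) = scomp (intv f) (transport X \<gamma>) (transport X \<beta>)"
proof (rule smap_eqI[OF smap_transport[OF groupoidD(4)[OF gpd b c]]
      smap_scomp[OF sset_Int smap_transport[OF b] smap_transport[OF c]]])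
  fix k y assume y: "y \<in> cells (intv f) k"
  obtain \<epsilon> where e: "\<epsilon> \<in> XA (k + 2)" "src (lev X (k + 2)) \<epsilon> = y" "lngA (k + 2) \<epsilon> = \<beta>"
    "transport X \<beta> k y = tgt (lev X (k + 2)) \<epsilon>" "tgt (lev X (k + 2)) \<epsilon> \<in> cells (intv g) k"
    by (rule fib_lift[OF b y])
  obtain \<delta> where d: "\<delta> \<in> XA (k + 2)" "src (lev X (k + 2)) \<delta> = tgt (lev X (k + 2)) \<epsilon>"
    "lngA (k + 2) \<delta> = \<gamma>" "transport X \<gamma> k (tgt (lev X (k + 2)) \<epsilon>) = tgt (lev X (k + 2)) \<delta>"
    by (rule fib_lift[OF c e(5)])
  have a: "arrow (lev X (k + 2)) \<epsilon> y (tgt (lev X (k + 2)) \<epsilon>)"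
    "arrow (lev X (k + 2)) \<delta> (tgt (lev X (k + 2)) \<epsilon>) (tgt (lev X (k + 2)) \<delta>)"
    using e d by (auto simp: arrow_def obs_ars_simps)
  note de = groupoidD(4)[OF gpd a]
  have "lngA (k + 2) (cmp (lev X (k + 2)) \<delta> \<epsilon>) = cmp (lev X 1) \<gamma> \<beta>"
    using gfunctorD(7)[OF act_ftr[of "dlong (k + 2)"], unfolded dlong_simps obs_ars_simps, OF a] e d by simp
  then show "transport X (cmp (lev X 1) \<gamma> \<beta>) k y = scomp (intv f) (transport X \<gamma>) (transport X \<beta>) k y"
    using transport_eq[OF arrow_ars(1)[OF de]] de y e d by (simp add: arrow_def)
qed

lemma transport_id:
  assumes f: "f \<in> XO 1"
  shows "transport X (idn (lev X 1) f) = sid (intv f)"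
proof (rule smap_eqI[OF smap_transport smap_sid[OF sset_Int]])
  show a: "arrow (lev X 1) (idn (lev X 1) f) f f"
    by (rule groupoidD(3)[OF gpd]) (simp add: f obs_ars_simps)
  fix k y assume y: "y \<in> cells (intv f) k"
  then have y': "y \<in> XO (k + 2)" "lng (k + 2) y = f" by (auto simp: fib_cells)
  have i: "arrow (lev X (k + 2)) (idn (lev X (k + 2)) y) y y"
    by (rule groupoidD(3)[OF gpd]) (simp add: y' obs_ars_simps)
  have "lngA (k + 2) (idn (lev X (k + 2)) y) = idn (lev X 1) f"
    using gfunctorD(6)[OF act_ftr[of "dlong (k + 2)"], unfolded dlong_simps obs_ars_simps, OF y'(1)] y'(2) by simp
  then show "transport X (idn (lev X 1) f) k y = sid (intv f) k y"
    using transport_eq[OF arrow_ars(1)[OF i]] i y by (simp add: arrow_def)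
qed

lemma siso_transport:
  assumes b: "arrow (lev X 1) \<beta> f g"
  shows "siso (intv f) (intv g) (transport X \<beta>)"
proof -
  obtain \<gamma> where c: "arrow (lev X 1) \<gamma> g f" "cmp (lev X 1) \<gamma> \<beta> = idn (lev X 1) f"
    "cmp (lev X 1) \<beta> \<gamma> = idn (lev X 1) g" using groupoidD(8)[OF gpd b] by blast
  have fg: "f \<in> XO 1" "g \<in> XO 1"
    using src_in[OF arrow_ars(1)[OF b]] tgt_in[OF arrow_ars(1)[OF b]] b by (auto simp: arrow_def)
  show ?thesis
    unfolding siso_def
    using smap_transport[OF b] smap_transport[OF c(1)] transport_comp[OF b c(1)] transport_comp[OF c(1) b]
      c(2,3) transport_id[OF fg(1)] transport_id[OF fg(2)] by metis
qed

lemma long_arrow: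
  assumes a: "\<alpha> \<in> XA n"
  shows "arrow (lev X 1) (lngA n \<alpha>) (lng n (src (lev X n) \<alpha>)) (lng n (tgt (lev X n) \<alpha>))"
  using ars_in[OF a, of "dlong n" 1] src_act[OF a, of "dlong n" 1] tgt_act[OF a, of "dlong n" 1]
  by (simp add: arrow_def obs_ars_simps)

text \<open>As \<open>extend (did n)\<close> is active, \<open>?e\<close> lies over the long edge of
  \<alpha> and is therefore the lift that defines the transport.\<close>

lemma transport_hat:
  assumes a: "\<alpha> \<in> XA n"
  shows "transport X (lngA n \<alpha>) n (hat n (src (lev X n) \<alpha>)) = hat n (tgt (lev X n) \<alpha>)"
proof -
  let ?e = "resA (extend (did n)) \<alpha>"
  have e: "?e \<in> XA (n + 2)" by (rule ars_in[OF a]) auto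
  show ?thesis
    using transport_eq[OF e] longA_act[OF a, of "extend (did n)" "n + 2"] src_act[OF a, of "extend (did n)" "n + 2"]
      tgt_act[OF a, of "extend (did n)" "n + 2"] by simp
qed

lemma transport_in_U:
  assumes a: "\<alpha> \<in> XA n"
  shows "(I_ob X n (src (lev X n) \<alpha>), I_ob X n (tgt (lev X n) \<alpha>), transport X (lngA n \<alpha>)) \<in> U_ar n"
  using I_ob_in[OF src_in[OF a]] I_ob_in[OF tgt_in[OF a]] siso_transport[OF long_arrow[OF a]]
    scomp_yoneda[OF sset_Int smap_transport[OF long_arrow[OF a]] hat_in[OF src_in[OF a]]] transport_hat[OF a]
  by (simp add: U_ar_iff I_ob_eq[OF src_in[OF a]] I_ob_eq[OF tgt_in[OF a]])

text \<open>The simplex \<open>w\<close> of \<open>I_culf_char\<close> is built among the arrows of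
  \<open>X\<close>: this gives one arrow \<omega> whose source and target serve as \<open>w\<close>
  for the source and the target of \<alpha>.\<close>

lemma transport_I_culf:
  assumes a: "\<alpha> \<in> XA (dtgt p)"
    and u: "u \<in> cells (Ivl (dsrc p) (res p (src (lev X (dtgt p)) \<alpha>))) k"
  shows "I_culf X p (tgt (lev X (dtgt p)) \<alpha>) k (transport X (lngA (dsrc p) (resA p \<alpha>)) k u) =
    transport X (lngA (dtgt p) \<alpha>) k (I_culf X p (src (lev X (dtgt p)) \<alpha>) k u)"
proof -
  let ?n = "dtgt p" and ?m = "dsrc p"
  let ?x = "src (lev X ?n) \<alpha>" and ?y = "tgt (lev X ?n) \<alpha>" and ?\<alpha> = "resA p \<alpha>"
  have pa: "?\<alpha> \<in> XA ?m" by (rule ars_in[OF a refl refl])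
  have st: "src (lev X ?m) ?\<alpha> = res p ?x" "tgt (lev X ?m) ?\<alpha> = res p ?y"
    by (rule src_act[OF a refl refl], rule tgt_act[OF a refl refl])
  note la = long_arrow[OF pa, unfolded st]
  obtain \<epsilon> where e: "\<epsilon> \<in> XA (k + 2)" "src (lev X (k + 2)) \<epsilon> = u" "lngA (k + 2) \<epsilon> = lngA ?m ?\<alpha>"
    "transport X (lngA ?m ?\<alpha>) k u = tgt (lev X (k + 2)) \<epsilon>"
    "tgt (lev X (k + 2)) \<epsilon> \<in> cells (Ivl ?m (res p ?y)) k"
    by (rule fib_lift[OF la u])
  have "\<epsilon> \<in> cells (fib (ars X) (lngA ?m ?\<alpha>)) k" using e by (simp add: fib_cells)
  then obtain \<omega> where w: "\<omega> \<in> XA (k + 4)"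
    "resA (shift (dlong (k + 2))) \<omega> = resA (extend (p \<odot> dlong ?m)) \<alpha>"
    "resA (iota (k + 2)) \<omega> = \<epsilon>"
    using fib_pull_ex[OF decomp_ars a refl refl] by blast
  have d: "dtgt (shift (dlong (k + 2))) = k + 4" "dsrc (shift (dlong (k + 2))) = 3"
    "dtgt (extend (p \<odot> dlong ?m)) = ?n" "dsrc (extend (p \<odot> dlong ?m)) = 3"
    "dtgt (iota (k + 2)) = k + 4" "dtgt (shift (iota k)) = k + 4" "dsrc (shift (iota k)) = k + 2" by simp_all
  have c1: "I_culf X p ?x k u = res (shift (iota k)) (src (lev X (k + 4)) \<omega>)"
    by (rule I_culf_char[OF src_in[OF a] u src_in[OF w(1)]])
      (use w d e src_act[OF w(1) d(1,2)] src_act[OF a d(3,4)] src_act[OF w(1) d(5), of "k + 2"] in auto)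
  have c2: "I_culf X p ?y k (tgt (lev X (k + 2)) \<epsilon>) = res (shift (iota k)) (tgt (lev X (k + 4)) \<omega>)"
    by (rule I_culf_char[OF tgt_in[OF a] e(5) tgt_in[OF w(1)]])
      (use w d e tgt_act[OF w(1) d(1,2)] tgt_act[OF a d(3,4)] tgt_act[OF w(1) d(5), of "k + 2"] in auto)
  \<comment> \<open>An arrow from the one value of \<open>I_culf\<close> to the other. It lies over
    the long edge of \<alpha>, so transport along that edge carries the first value to the
    second.\<close>
  let ?\<eta> = "resA (shift (iota k)) \<omega>"
  have eta: "?\<eta> \<in> XA (k + 2)" by (rule ars_in[OF w(1) d(6,7)])
  have "lngA (k + 2) ?\<eta> = lngA (k + 4) \<omega>" by (rule longA_act[OF w(1) _ d(6,7)]) simp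
  also have "\<dots> = lngA 3 (resA (shift (dlong (k + 2))) \<omega>)" by (rule longA_act[OF w(1) _ d(1,2), symmetric]) simp
  also have "\<dots> = lngA ?n \<alpha>" unfolding w(2) by (rule longA_act[OF a _ d(3,4)]) simp
  finally show ?thesis
    using transport_eq[OF eta] src_act[OF w(1) d(6,7)] tgt_act[OF w(1) d(6,7)] c1 c2 e(4) by simp
qed

end

lemma UU_simps [simp]: "plev (UU ch) = U_lev" "pact (UU ch) = U_act ch" "pcoh (UU ch) = U_coh ch"
  by (simp_all add: UU_def)

section \<open>Pseudonaturality of the interval construction\<close>

locale rdg_choice = rdg X for X :: "('u, 'a) sgpd" +
  fixes ch :: "'u factorisations"
  assumes ch: "factorisation_choice ch"
begin

abbreviation "IC \<equiv> interval_construction ch X"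

lemma IC_ob: "x \<in> XO n \<Longrightarrow> fob (cpt IC n) x = I_ob X n x"
  by (simp add: interval_construction_def obs_ars_simps)

lemma IC_ar: "\<alpha> \<in> XA n \<Longrightarrow> far (cpt IC n) \<alpha> =
    (I_ob X n (src (lev X n) \<alpha>), I_ob X n (tgt (lev X n) \<alpha>), transport X (lngA n \<alpha>))"
  by (simp add: interval_construction_def obs_ars_simps long_ar_def)

lemma IC_str:
  assumes x: "x \<in> XO (dtgt p)"
  obtains S where
    "str IC p x = (fst (ch p (I_ob X (dtgt p) x)), I_ob X (dsrc p) (res p x), S)"
    "(fst (ch p (I_ob X (dtgt p) x)), I_ob X (dsrc p) (res p x), S) \<in> U_ar (dsrc p)"
    "\<And>k u. u \<in> cells (fst (fst (ch p (I_ob X (dtgt p) x)))) k \<Longrightarrow>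
      I_culf X p x k (S k u) = snd (ch p (I_ob X (dtgt p) x)) k u"
proof -
  let ?x = "I_ob X (dtgt p) x" and ?x' = "I_ob X (dsrc p) (res p x)"
  have px: "res p x \<in> XO (dsrc p)" by (rule obs_in[OF x refl refl])
  note c = ch_props[OF ch I_ob_in[OF x]]
  have j: "strict_culf (fst ?x') (fst ?x) (I_culf X p x)"
    using I_culf_props(4)[OF x] by (simp add: fst_I_ob[OF x] fst_I_ob[OF px])
  have e: "scomp (std_simplex (dsrc p)) (snd (ch p ?x)) (snd (fst (ch p ?x))) =
      scomp (std_simplex (dsrc p)) (I_culf X p x) (snd ?x')"
    using c(3) I_culf_props(5)[OF x] by simp
  have "str IC p x = comparison (dsrc p) (fst (ch p ?x)) (snd (ch p ?x)) ?x' (I_culf X p x)"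
    using x by (simp add: interval_construction_def obs_ars_simps case_prod_unfold Let_def)
  then show thesis
    using comparison_props[OF c(1) I_ob_in[OF px] c(2) j e] that by metis
qed

text \<open>Restriction along an active map keeps the long edge and hence the interval.\<close>

lemma I_ob_active:
  assumes x: "x \<in> XO (dtgt p)" and p: "active p"
  shows "fst (ch p (I_ob X (dtgt p) x)) = I_ob X (dsrc p) (res p x)"
    "snd (ch p (I_ob X (dtgt p) x)) = sid (Ivl (dtgt p) x)"
proof -
  have px: "res p x \<in> XO (dsrc p)" by (rule obs_in[OF x refl refl])
  have l: "lng (dsrc p) (res p x) = lng (dtgt p) x" by (rule long_act[OF x p refl refl])
  have h: "hat (dsrc p) (res p x) = res (extend p) x"
    using x p by (simp add: sact_sact[OF sset_obs] active_dcomp_ext)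
  have "sact (Ivl (dtgt p) x) p (hat (dtgt p) x) = res (extend p) x"
    using fib_sact_ext[OF sset_obs x, of "did (dtgt p)" p] by simp
  then show "fst (ch p (I_ob X (dtgt p) x)) = I_ob X (dsrc p) (res p x)"
    "snd (ch p (I_ob X (dtgt p) x)) = sid (Ivl (dtgt p) x)"
    using ch_props(4)[OF ch I_ob_in[OF x] p] scomp_yoneda_std_map[OF sset_Int hat_in[OF x]]
    by (simp_all add: I_ob_eq[OF x] I_ob_eq[OF px] l h)
qed

lemma gfunctor_IC: "gfunctor (lev X n) (U_lev n) (cpt IC n)"
  unfolding gfunctor_def obs_ars_simps U_lev_simps
proof (intro conjI ballI impI)
  show "fob (cpt IC n) \<in> XO n \<rightarrow>\<^sub>E U_ob n"
  proof
    show "fob (cpt IC n) x \<in> U_ob n" if "x \<in> XO n" for x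
      using that by (simp add: IC_ob I_ob_in)
    show "fob (cpt IC n) x = undefined" if "x \<notin> XO n" for x
      using that by (simp add: interval_construction_def obs_ars_simps)
  qed
  show "far (cpt IC n) \<in> XA n \<rightarrow>\<^sub>E U_ar n"
  proof
    show "far (cpt IC n) \<alpha> \<in> U_ar n" if "\<alpha> \<in> XA n" for \<alpha>
      using that by (simp add: IC_ar transport_in_U)
    show "far (cpt IC n) \<alpha> = undefined" if "\<alpha> \<notin> XA n" for \<alpha>
      using that by (simp add: interval_construction_def obs_ars_simps)
  qed
next
  fix \<alpha> assume a: "\<alpha> \<in> XA n"
  show "src (U_lev n) (far (cpt IC n) \<alpha>) = fob (cpt IC n) (src (lev X n) \<alpha>)"
    "tgt (U_lev n) (far (cpt IC n) \<alpha>) = fob (cpt IC n) (tgt (lev X n) \<alpha>)"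
    using a by (simp_all add: IC_ar IC_ob src_in tgt_in)
next
  fix x assume x: "x \<in> XO n"
  have i: "arrow (lev X n) (idn (lev X n) x) x x"
    by (rule groupoidD(3)[OF gpd]) (simp add: x obs_ars_simps)
  have "lngA n (idn (lev X n) x) = idn (lev X 1) (lng n x)"
    using gfunctorD(6)[OF act_ftr[of "dlong n"], unfolded dlong_simps obs_ars_simps, OF x] .
  then show "far (cpt IC n) (idn (lev X n) x) = (fob (cpt IC n) x, fob (cpt IC n) x, sid (fst (fob (cpt IC n) x)))"
    using i x transport_id[OF lng_in[OF x]] by (simp add: IC_ar[OF arrow_ars(1)[OF i]] IC_ob arrow_def fst_I_ob)
next
  fix \<alpha> \<beta> assume *: "\<alpha> \<in> XA n" "\<beta> \<in> XA n" "tgt (lev X n) \<alpha> = src (lev X n) \<beta>"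
  then have a: "arrow (lev X n) \<alpha> (src (lev X n) \<alpha>) (src (lev X n) \<beta>)"
    "arrow (lev X n) \<beta> (src (lev X n) \<beta>) (tgt (lev X n) \<beta>)" by (auto simp: arrow_def obs_ars_simps)
  note ab = groupoidD(4)[OF gpd a]
  have "lngA n (cmp (lev X n) \<beta> \<alpha>) = cmp (lev X 1) (lngA n \<beta>) (lngA n \<alpha>)"
    using gfunctorD(7)[OF act_ftr[of "dlong n"], unfolded dlong_simps obs_ars_simps, OF a] .
  then show "far (cpt IC n) (cmp (lev X n) \<beta> \<alpha>) = cmp (U_lev n) (far (cpt IC n) \<beta>) (far (cpt IC n) \<alpha>)"
    using ab * transport_comp[OF long_arrow[OF *(1), unfolded *(3)] long_arrow[OF *(2)]] src_in[OF *(1)]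
    by (simp add: IC_ar[OF arrow_ars(1)[OF ab]] IC_ar arrow_def fst_I_ob)
qed

text \<open>At an active map both \<open>I_culf\<close> and the chosen culf part are identities, so
  the comparison between them is one too.\<close>

lemma IC_str_active:
  assumes x: "x \<in> XO (dtgt p)" and p: "active p"
  shows "str IC p x = idn (U_lev (dsrc p)) (fob (cpt IC (dsrc p)) (res p x))"
proof -
  let ?x = "I_ob X (dtgt p) x" and ?x' = "I_ob X (dsrc p) (res p x)"
  have px: "res p x \<in> XO (dsrc p)" by (rule obs_in[OF x refl refl])
  have l: "lng (dsrc p) (res p x) = lng (dtgt p) x" by (rule long_act[OF x p refl refl])
  have e: "fst (ch p ?x) = ?x'" "snd (ch p ?x) = sid (Ivl (dtgt p) x)" "fst ?x' = Ivl (dtgt p) x"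
    using I_ob_active[OF x p] by (simp_all add: fst_I_ob[OF px] l)
  obtain S where S: "str IC p x = (?x', ?x', S)" "(?x', ?x', S) \<in> U_ar (dsrc p)"
    "\<And>k u. u \<in> cells (Ivl (dtgt p) x) k \<Longrightarrow> I_culf X p x k (S k u) = sid (Ivl (dtgt p) x) k u"
    using IC_str[OF x, unfolded e] by metis
  have "S = sid (fst ?x')"
  proof (rule U_ar_eqI'[OF S(2) U_ar_id[OF I_ob_in[OF px]]])
    fix k u assume u: "u \<in> cells (fst ?x') k"
    have "S k u \<in> cells (Ivl (dtgt p) x) k" using smap_in[OF U_arD(4)[OF S(2)] u] e by simp
    then show "S k u = sid (fst ?x') k u" using S(3)[of u k] u e by (simp add: I_culf_active[OF x p])
  qed
  then show ?thesis using S(1) by (simp add: IC_ob[OF px])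
qed

text \<open>The two coherence equations are tested after a culf map \<open>I_culf\<close>, where
  structure isomorphisms turn into chosen culf parts. They then say that \<open>I_culf\<close> is
  natural in arrows and functorial in \<open>p\<close>.\<close>

lemma pseudonatural_IC: "pseudonatural X (UU ch) IC"
  unfolding pseudonatural_def UU_simps obs_ars_simps
proof (intro conjI allI ballI impI)
  fix n show "gfunctor (lev X n) (U_lev n) (cpt IC n)" by (rule gfunctor_IC)
next
  fix p show "str IC p \<in> extensional (XO (dtgt p))"
    by (simp add: interval_construction_def obs_ars_simps)
next
  fix p x assume x: "x \<in> XO (dtgt p)"
  show "arrow (U_lev (dsrc p)) (str IC p x) (fob (U_act ch p) (fob (cpt IC (dtgt p)) x))
        (fob (cpt IC (dsrc p)) (res p x))"
    by (rule IC_str[OF x])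
      (use x obs_in[OF x refl refl] in \<open>simp add: IC_ob arrow_U U_act_ob[OF ch I_ob_in[OF x]]\<close>)
next
  fix p \<alpha> assume a: "\<alpha> \<in> XA (dtgt p)"
  let ?n = "dtgt p" and ?m = "dsrc p"
  let ?x = "src (lev X ?n) \<alpha>" and ?y = "tgt (lev X ?n) \<alpha>" and ?pa = "resA p \<alpha>"
  note x = src_in[OF a] and y = tgt_in[OF a]
  have pa: "?pa \<in> XA ?m" by (rule ars_in[OF a refl refl])
  have st: "src (lev X ?m) ?pa = res p ?x" "tgt (lev X ?m) ?pa = res p ?y"
    by (rule src_act[OF a refl refl], rule tgt_act[OF a refl refl])
  have px: "res p ?x \<in> XO ?m" and py: "res p ?y \<in> XO ?m"
    using obs_in[OF x refl refl] obs_in[OF y refl refl] by auto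
  let ?F = "transport X (lngA ?n \<alpha>)" and ?F' = "transport X (lngA ?m ?pa)"
  let ?cx = "ch p (I_ob X ?n ?x)" and ?cy = "ch p (I_ob X ?n ?y)"
  let ?x' = "I_ob X ?m (res p ?x)" and ?y' = "I_ob X ?m (res p ?y)"
  obtain S where S: "str IC p ?x = (fst ?cx, ?x', S)" "(fst ?cx, ?x', S) \<in> U_ar ?m"
    "\<And>k u. u \<in> cells (fst (fst ?cx)) k \<Longrightarrow> I_culf X p ?x k (S k u) = snd ?cx k u"
    using IC_str[OF x] by metis
  obtain T where T: "str IC p ?y = (fst ?cy, ?y', T)" "(fst ?cy, ?y', T) \<in> U_ar ?m"
    "\<And>k u. u \<in> cells (fst (fst ?cy)) k \<Longrightarrow> I_culf X p ?y k (T k u) = snd ?cy k u"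
    using IC_str[OF y] by metis
  note F = transport_in_U[OF a] and F' = transport_in_U[OF pa, unfolded st]
  obtain G where G: "far (U_act ch p) (I_ob X ?n ?x, I_ob X ?n ?y, ?F) = (fst ?cx, fst ?cy, G)"
    "(fst ?cx, fst ?cy, G) \<in> U_ar ?m"
    "\<And>k u. u \<in> cells (fst (fst ?cx)) k \<Longrightarrow> snd ?cy k (G k u) = ?F k (snd ?cx k u)"
    by (rule U_act_ar[OF ch F], rule that)
  have "scomp (fst (fst ?cx)) ?F' S = scomp (fst (fst ?cx)) T G"
  proof (rule U_ar_eqI[OF U_ar_comp[OF S(2) F'] U_ar_comp[OF G(2) T(2)]])
    show "strict_culf (fst ?y') (Ivl ?n ?y) (I_culf X p ?y)"
      using I_culf_props(4)[OF y] by (simp add: fst_I_ob[OF py])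
    fix k u assume u: "u \<in> cells (fst (fst ?cx)) k"
    have Su: "S k u \<in> cells (Ivl ?m (res p ?x)) k"
      using smap_in[OF U_arD(4)[OF S(2)] u] by (simp add: fst_I_ob[OF px])
    have Gu: "G k u \<in> cells (fst (fst ?cy)) k" using smap_in[OF U_arD(4)[OF G(2)] u] .
    have "I_culf X p ?y k (?F' k (S k u)) = ?F k (I_culf X p ?x k (S k u))"
      by (rule transport_I_culf[OF a Su])
    also have "\<dots> = I_culf X p ?y k (T k (G k u))" using S(3)[OF u] T(3)[OF Gu] G(3)[OF u] by simp
    finally show "I_culf X p ?y k (scomp (fst (fst ?cx)) ?F' S k u) =
      I_culf X p ?y k (scomp (fst (fst ?cx)) T G k u)" using u by simp
  qed
  then show "cmp (U_lev ?m) (far (cpt IC ?m) ?pa) (str IC p ?x) =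
    cmp (U_lev ?m) (str IC p ?y) (far (U_act ch p) (far (cpt IC ?n) \<alpha>))"
    by (simp add: IC_ar[OF pa] IC_ar[OF a] S(1) T(1) G(1) st)
next
  fix n x assume x: "x \<in> XO n"
  then show "str IC (did n) x = idn (U_lev n) (fob (cpt IC n) x)"
    using IC_str_active[of x "did n"] sact_did[OF sset_obs x] by simp
next
  fix p q x assume pq: "dtgt p = dsrc q" and x: "x \<in> XO (dtgt q)"
  let ?m = "dsrc p" and ?n = "dsrc q" and ?y = "res q x"
  let ?Ix = "I_ob X (dtgt q) x" and ?Iy = "I_ob X ?n ?y"
  have y: "?y \<in> XO (dtgt p)" using obs_in[OF x refl refl] pq by simp
  have x': "x \<in> XO (dtgt (q \<odot> p))" using x pq by simp
  let ?z = "res (q \<odot> p) x"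
  have z: "res p ?y = ?z" using x pq by (simp add: sact_sact[OF sset_obs])
  have zA: "?z \<in> XO ?m" using obs_in[OF y refl refl] z by simp
  let ?Iz = "I_ob X ?m ?z"
  obtain S where S: "str IC (q \<odot> p) x = (fst (ch (q \<odot> p) ?Ix), ?Iz, S)"
    "(fst (ch (q \<odot> p) ?Ix), ?Iz, S) \<in> U_ar ?m"
    "\<And>k u. u \<in> cells (fst (fst (ch (q \<odot> p) ?Ix))) k \<Longrightarrow>
      I_culf X (q \<odot> p) x k (S k u) = snd (ch (q \<odot> p) ?Ix) k u"
    using IC_str[OF x', unfolded dcomp_simps(1,2)[OF pq]] by metis
  obtain T where T: "str IC p ?y = (fst (ch p ?Iy), ?Iz, T)" "(fst (ch p ?Iy), ?Iz, T) \<in> U_ar ?m"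
    "\<And>k u. u \<in> cells (fst (fst (ch p ?Iy))) k \<Longrightarrow> I_culf X p ?y k (T k u) = snd (ch p ?Iy) k u"
    using IC_str[OF y, unfolded z, unfolded pq] by metis
  obtain R where R: "str IC q x = (fst (ch q ?Ix), ?Iy, R)" "(fst (ch q ?Ix), ?Iy, R) \<in> U_ar ?n"
    "\<And>k u. u \<in> cells (fst (fst (ch q ?Ix))) k \<Longrightarrow> I_culf X q x k (R k u) = snd (ch q ?Ix) k u"
    using IC_str[OF x] by metis
  have R': "(fst (ch q ?Ix), ?Iy, R) \<in> U_ar (dtgt p)" using R(2) pq by simp
  let ?v = "fst (ch p (fst (ch q ?Ix)))"
  obtain K where K: "U_coh ch q p ?Ix = (?v, fst (ch (q \<odot> p) ?Ix), K)"
    "(?v, fst (ch (q \<odot> p) ?Ix), K) \<in> U_ar ?m"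
    "\<And>k u. u \<in> cells (fst ?v) k \<Longrightarrow>
      snd (ch (q \<odot> p) ?Ix) k (K k u) = snd (ch q ?Ix) k (snd (ch p (fst (ch q ?Ix))) k u)"
    by (rule U_coh_props[OF ch I_ob_in[OF x] pq], rule that)
  obtain H where H: "far (U_act ch p) (fst (ch q ?Ix), ?Iy, R) = (?v, fst (ch p ?Iy), H)"
    "(?v, fst (ch p ?Iy), H) \<in> U_ar ?m"
    "\<And>k u. u \<in> cells (fst ?v) k \<Longrightarrow> snd (ch p ?Iy) k (H k u) = R k (snd (ch p (fst (ch q ?Ix))) k u)"
    by (rule U_act_ar[OF ch R'], rule that)
  have "scomp (fst ?v) S K = scomp (fst ?v) T H"
  proof (rule U_ar_eqI[OF U_ar_comp[OF K(2) S(2)] U_ar_comp[OF H(2) T(2)]])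
    show "strict_culf (fst ?Iz) (Ivl (dtgt q) x) (I_culf X (q \<odot> p) x)"
      using I_culf_props(4)[OF x'] pq by (simp add: fst_I_ob[OF zA])
    fix k u assume u: "u \<in> cells (fst ?v) k"
    have Ku: "K k u \<in> cells (fst (fst (ch (q \<odot> p) ?Ix))) k" using smap_in[OF U_arD(4)[OF K(2)] u] .
    have Hu: "H k u \<in> cells (fst (fst (ch p ?Iy))) k" using smap_in[OF U_arD(4)[OF H(2)] u] .
    have THu: "T k (H k u) \<in> cells (Ivl ?m ?z) k"
      using smap_in[OF U_arD(4)[OF T(2)] Hu] by (simp add: fst_I_ob[OF zA])
    have iu: "snd (ch p (fst (ch q ?Ix))) k u \<in> cells (fst (fst (ch q ?Ix))) k"
      by (rule smap_in[OF culfD[OF ch_props(2)[OF ch U_arD(1)[OF R']]] u])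
    have "I_culf X (q \<odot> p) x k (T k (H k u)) = I_culf X q x k (I_culf X p ?y k (T k (H k u)))"
      using THu by (simp add: I_culf_dcomp[OF x pq])
    also have "\<dots> = I_culf X q x k (R k (snd (ch p (fst (ch q ?Ix))) k u))"
      using T(3)[OF Hu] H(3)[OF u] by simp
    also have "\<dots> = I_culf X (q \<odot> p) x k (S k (K k u))"
      using R(3)[OF iu] S(3)[OF Ku] K(3)[OF u] by simp
    finally show "I_culf X (q \<odot> p) x k (scomp (fst ?v) S K k u) = I_culf X (q \<odot> p) x k (scomp (fst ?v) T H k u)"
      using u by simp
  qed
  then show "cmp (U_lev ?m) (str IC (q \<odot> p) x) (U_coh ch q p (fob (cpt IC (dtgt q)) x)) =
    cmp (U_lev ?m) (str IC p (res q x)) (far (U_act ch p) (str IC q x))"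
    by (simp add: IC_ob[OF x] S(1) T(1) R(1) K(1) H(1))
qed

section \<open>Pullback squares of the interval construction\<close>

lemma I_ob_inject:
  assumes z: "z \<in> XO n" "z' \<in> XO n" and l: "lng n z = lng n z'"
    and e: "snd (I_ob X n z) = snd (I_ob X n z')"
  shows "z = z'"
proof -
  have "hat n z = hat n z'"
    using e yoneda_inject[OF sset_Int hat_in[OF z(1)], of "hat n z'"] hat_in[OF z(2)]
    by (simp add: I_ob_eq[OF z(1)] I_ob_eq[OF z(2)] l)
  then show ?thesis using hat_iota[OF z(1)] hat_iota[OF z(2)] by metis
qed

text \<open>The subdivision in \<open>y\<close> is given by its top simplex \<open>?t\<close>, a
  simplex of \<open>X\<close> of dimension two higher, whose inner part is the simplex sought. Since
  \<open>p\<close> is active, this inner part has the same long edge as \<open>x\<close>; therefore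
  the subdivision is the stretched map belonging to it.\<close>

lemma I_ob_surj:
  assumes x: "x \<in> XO (dsrc p)" and p: "active p" and y: "y \<in> U_ob (dtgt p)"
    and xy: "I_ob X (dsrc p) x = fst (ch p y)"
  obtains z where "z \<in> XO (dtgt p)" "res p z = x" "I_ob X (dtgt p) z = y"
proof -
  let ?n = "dtgt p" and ?m = "dsrc p" and ?f = "lng (dsrc p) x"
  have xy': "(Ivl ?m x, yoneda (Ivl ?m x) ?m (hat ?m x)) = (fst y, scomp (std_simplex ?m) (snd y) (std_map p))"
    using xy unfolding ch_props(4)[OF ch y p] I_ob_eq[OF x] fst_conv .
  then have A: "fst y = Ivl ?m x" by simp
  have st: "stretched (std_simplex ?n) (Ivl ?m x) (snd y)" using y A by (simp add: U_ob_iff)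
  let ?t = "snd y ?n (did ?n)"
  have t: "?t \<in> cells (Ivl ?m x) ?n" using smap_in[OF U_obD(3)[OF y], of "did ?n" ?n] A by simp
  have a: "snd y = yoneda (Ivl ?m x) ?n ?t" using yoneda_unique[OF sset_Int] st by (simp add: stretched_def)
  have "yoneda (Ivl ?m x) ?m (hat ?m x) = yoneda (Ivl ?m x) ?m (sact (Ivl ?m x) p ?t)"
    using Pair_inject[OF xy'] a scomp_yoneda_std_map[OF sset_Int t] by metis
  then have "hat ?m x = sact (Ivl ?m x) p ?t"
    using yoneda_inject[OF sset_Int hat_in[OF x]] sact_in[OF sset_Int t refl refl] by simp
  then have hx: "hat ?m x = res (shift p) ?t" using t by (simp add: fib_sact)
  have tA: "?t \<in> XO (?n + 2)" using t by (simp add: fib_cells)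
  let ?z = "res (iota ?n) ?t"
  have z: "?z \<in> XO ?n" by (rule obs_in[OF tA]) auto
  have "res (iota ?m) (hat ?m x) = res p ?z"
    using tA hx by (simp add: sact_sact[OF sset_obs] shift_iota)
  then have pz: "res p ?z = x" using hat_iota[OF x] by simp
  have l: "lng ?n ?z = ?f" using long_act[OF z p refl refl] pz by simp
  have "snd y = yoneda (Ivl ?n ?z) ?n (hat ?n ?z)"
  proof (rule phi_unique[OF z])
    show "stretched (std_simplex ?n) (Ivl ?n ?z) (snd y)" using st l by simp
    show "scomp (std_simplex ?n) (proj (lng ?n ?z)) (snd y) = yoneda (obs X) ?n ?z"
      unfolding l using scomp_yoneda[OF sset_Int smap_fib_proj[OF sset_obs] t] a t by simp
  qed
  then have "I_ob X ?n ?z = y" using A l by (simp add: I_ob_eq[OF z] prod_eq_iff)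
  then show thesis using that z pz by blast
qed

text \<open>In positive dimension the lift of \<beta> that starts at \<open>z\<close> ends at
  \<open>z'\<close>, because a simplex is the inner part of its \<open>hat\<close>. In dimension 0
  the long edge is \<open>s_0\<close>, and the arrow comes from full faithfulness.\<close>

lemma long_lift_between:
  assumes z: "z \<in> XO n" "z' \<in> XO n" and b: "arrow (lev X 1) \<beta> (lng n z) (lng n z')"
    and t: "transport X \<beta> n (hat n z) = hat n z'"
  obtains \<zeta> where "\<zeta> \<in> XA n" "src (lev X n) \<zeta> = z" "tgt (lev X n) \<zeta> = z'" "lngA n \<zeta> = \<beta>"
proof (cases "n = 0")
  case True
  have "dlong 0 = codegen 0 0" by (rule simplex_map_eqI) (auto simp: le_Suc_eq One_nat_def)
  then have "fully_faithful (lev X 0) (lev X 1) (act X (dlong 0))"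
    using rigid by (simp add: rigid_decomposition_groupoid_def)
  then have "bij_betw (resA (dlong 0)) {f. arrow (lev X 0) f z z'} {g. arrow (lev X 1) g (lng 0 z) (lng 0 z')}"
    using z True unfolding fully_faithful_def obs_ars_simps by simp
  then obtain \<zeta> where "arrow (lev X 0) \<zeta> z z'" "resA (dlong 0) \<zeta> = \<beta>"
    using b True by (auto elim: bij_betw_surjE[of _ _ _ \<beta>])
  then show thesis using that True by (auto simp: arrow_def obs_ars_simps)
next
  case False
  then obtain \<zeta> where c: "\<zeta> \<in> XA n" "src (lev X n) \<zeta> = z" "lngA n \<zeta> = \<beta>"
    using long_lift_ex[of z n \<beta>] z b arrow_ars(1)[OF b] by (auto simp: arrow_def)
  have "hat n (tgt (lev X n) \<zeta>) = hat n z'" using transport_hat[OF c(1)] c t by simp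
  then have "tgt (lev X n) \<zeta> = z'" using hat_iota[OF tgt_in[OF c(1)]] hat_iota[OF z(2)] by metis
  then show thesis using that c by blast
qed

lemma strict_culf_IC: "strict_culf_map X (UU ch) IC"
  unfolding strict_culf_map_def UU_simps obs_ars_simps
proof (intro conjI allI impI ballI pseudonatural_IC)
  fix p x assume "active p" "x \<in> XO (dtgt p)"
  then show "str IC p x = idn (U_lev (dsrc p)) (fob (cpt IC (dsrc p)) (res p x))"
    using IC_str_active by blast
next
  fix p assume p: "active p"
  let ?n = "dtgt p" and ?m = "dsrc p"
  have ob: "fob (U_act ch p) (I_ob X ?n z) = I_ob X ?m (res p z)" if "z \<in> XO ?n" for z
    using I_ob_active(1)[OF that p] U_act_ob[OF ch I_ob_in[OF that]] by simp
  have ob_inj: "z = z'" if "z \<in> XO ?n" "z' \<in> XO ?n"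
    "res p z = res p z'" "I_ob X ?n z = I_ob X ?n z'" for z z'
    by (rule I_ob_inject[OF that(1,2)])
      (use that(3,4) long_act[OF that(1) p refl refl] long_act[OF that(2) p refl refl] in auto)
  have ar_src: "src (lev X ?m) (resA p \<zeta>) = res p (src (lev X ?n) \<zeta>)"
    "tgt (lev X ?m) (resA p \<zeta>) = res p (tgt (lev X ?n) \<zeta>)"
    if "\<zeta> \<in> XA ?n" for \<zeta>
    by (rule src_act[OF that refl refl], rule tgt_act[OF that refl refl])
  have ar: "far (cpt IC ?m) (resA p \<zeta>) = far (U_act ch p) (far (cpt IC ?n) \<zeta>)"
    if z: "\<zeta> \<in> XA ?n" for \<zeta>
    using IC_ar[OF ars_in[OF z refl refl]] IC_ar[OF z] U_act_ar_active[OF ch transport_in_U[OF z] p]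
      I_ob_active(1)[OF src_in[OF z] p] I_ob_active(1)[OF tgt_in[OF z] p] ar_src[OF z] longA_act[OF z p refl refl]
    by simp
  show "strict_pullback (lev X ?n) (lev X ?m) (U_lev ?n) (act X p) (cpt IC ?n) (cpt IC ?m) (U_act ch p)"
    unfolding strict_pullback_def obs_ars_simps U_lev_simps
  proof
    show "bij_betw (\<lambda>z. (res p z, fob (cpt IC ?n) z)) (XO ?n)
       {(x, y). x \<in> XO ?m \<and> y \<in> U_ob ?n \<and> fob (cpt IC ?m) x = fob (U_act ch p) y}"
      (is "bij_betw ?f _ ?T")
      unfolding bij_betw_def
    proof
      show "inj_on ?f (XO ?n)"
        by (rule inj_onI) (use ob_inj in \<open>simp add: IC_ob\<close>)
      show "?f ` XO ?n = ?T"
      proof (intro equalityI subsetI)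
        fix t assume "t \<in> ?f ` XO ?n"
        then obtain z where z: "z \<in> XO ?n" "t = ?f z" by blast
        then show "t \<in> ?T"
          using obs_in[OF z(1) refl refl] ob[OF z(1)] I_ob_in[OF z(1)] by (simp add: IC_ob)
      next
        fix t assume "t \<in> ?T"
        then obtain x y where t: "t = (x, y)" "x \<in> XO ?m" "y \<in> U_ob ?n"
          "fob (cpt IC ?m) x = fob (U_act ch p) y" by blast
        then have "I_ob X ?m x = fst (ch p y)" by (simp add: IC_ob U_act_ob[OF ch])
        then obtain z where "z \<in> XO ?n" "res p z = x" "I_ob X ?n z = y"
          using I_ob_surj[OF t(2) p t(3)] by blast
        then show "t \<in> ?f ` XO ?n" using t(1) by (intro image_eqI[of _ _ z]) (simp_all add: IC_ob)
      qed
    qed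
    show "bij_betw (\<lambda>\<zeta>. (resA p \<zeta>, far (cpt IC ?n) \<zeta>)) (XA ?n)
       {(\<xi>, \<eta>). \<xi> \<in> XA ?m \<and> \<eta> \<in> U_ar ?n \<and> far (cpt IC ?m) \<xi> = far (U_act ch p) \<eta>}"
      (is "bij_betw ?f _ ?T")
      unfolding bij_betw_def
    proof
      show "inj_on ?f (XA ?n)"
      proof (rule inj_onI)
        fix \<zeta> \<zeta>' assume z: "\<zeta> \<in> XA ?n" "\<zeta>' \<in> XA ?n" "?f \<zeta> = ?f \<zeta>'"
        then have "res p (src (lev X ?n) \<zeta>) = res p (src (lev X ?n) \<zeta>')"
          using ar_src(1)[OF z(1)] ar_src(1)[OF z(2)] by simp
        moreover have "I_ob X ?n (src (lev X ?n) \<zeta>) = I_ob X ?n (src (lev X ?n) \<zeta>')"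
          using z IC_ar[OF z(1)] IC_ar[OF z(2)] by simp
        ultimately have s: "src (lev X ?n) \<zeta> = src (lev X ?n) \<zeta>'"
          using ob_inj src_in[OF z(1)] src_in[OF z(2)] by blast
        \<comment> \<open>Active restriction keeps long edges, so the two arrows have the same long
          edge as well as the same source.\<close>
        show "\<zeta> = \<zeta>'"
          by (rule long_lift_unique[OF z(1,2) s])
            (use z(3) longA_act[OF z(1) p refl refl] longA_act[OF z(2) p refl refl] in simp)
      qed
      show "?f ` XA ?n = ?T"
      proof (intro equalityI subsetI)
        fix t assume "t \<in> ?f ` XA ?n"
        then obtain z where z: "z \<in> XA ?n" "t = ?f z" by blast
        then show "t \<in> ?T"
          using ars_in[OF z(1) refl refl] ar[OF z(1)] transport_in_U[OF z(1)] IC_ar[OF z(1)] by simp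
      next
        fix t assume "t \<in> ?T"
        then obtain \<xi> \<eta> where t: "t = (\<xi>, \<eta>)" "\<xi> \<in> XA ?m" "\<eta> \<in> U_ar ?n"
          "far (cpt IC ?m) \<xi> = far (U_act ch p) \<eta>" by blast
        obtain y y' F where eta: "\<eta> = (y, y', F)" by (cases \<eta>)
        have F: "(y, y', F) \<in> U_ar ?n" using t(3) eta by simp
        have e: "I_ob X ?m (src (lev X ?m) \<xi>) = fst (ch p y)" "I_ob X ?m (tgt (lev X ?m) \<xi>) = fst (ch p y')"
          "transport X (lngA ?m \<xi>) = F"
          using t(4) U_act_ar_active[OF ch F p] IC_ar[OF t(2)] eta by simp_all
        obtain z where z: "z \<in> XO ?n" "res p z = src (lev X ?m) \<xi>" "I_ob X ?n z = y"
          by (rule I_ob_surj[OF src_in[OF t(2)] p U_arD(1)[OF F] e(1)])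
        obtain z' where z': "z' \<in> XO ?n" "res p z' = tgt (lev X ?m) \<xi>" "I_ob X ?n z' = y'"
          by (rule I_ob_surj[OF tgt_in[OF t(2)] p U_arD(2)[OF F] e(2)])
        have b: "arrow (lev X 1) (lngA ?m \<xi>) (lng ?n z) (lng ?n z')"
          using long_arrow[OF t(2)] long_act[OF z(1) p refl refl] long_act[OF z'(1) p refl refl] z(2) z'(2) by simp
        \<comment> \<open>An arrow of \<open>U\<close> respects the subdivisions; at the top simplex
          this becomes the transport condition of \<open>long_lift_between\<close>.\<close>
        have "F ?n (snd y ?n (did ?n)) = snd y' ?n (did ?n)"
          by (rule scomp_eq_app[OF U_arD(5)[OF F]]) simp
        moreover have "snd y ?n (did ?n) = hat ?n z" "snd y' ?n (did ?n) = hat ?n z'"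
          using z(3) z'(3) I_ob_eq[OF z(1)] I_ob_eq[OF z'(1)]
            yoneda_did[OF sset_Int hat_in[OF z(1)]] yoneda_did[OF sset_Int hat_in[OF z'(1)]] by auto
        ultimately have "transport X (lngA ?m \<xi>) ?n (hat ?n z) = hat ?n z'" using e(3) by simp
        then obtain \<zeta> where c: "\<zeta> \<in> XA ?n" "src (lev X ?n) \<zeta> = z" "tgt (lev X ?n) \<zeta> = z'"
          "lngA ?n \<zeta> = lngA ?m \<xi>"
          using long_lift_between[OF z(1) z'(1) b] by blast
        have "resA p \<zeta> = \<xi>"
          by (rule long_lift_unique[OF ars_in[OF c(1) refl refl] t(2)])
            (use ar_src(1)[OF c(1)] c z longA_act[OF c(1) p refl refl] in simp_all)
        moreover have "far (cpt IC ?n) \<zeta> = \<eta>"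
          using IC_ar[OF c(1)] c z z' e(3) eta by simp
        ultimately show "t \<in> ?f ` XA ?n" using t(1) c(1) by (intro image_eqI[of _ _ \<zeta>]) simp_all
      qed
    qed
  qed
qed

end

section \<open>Comparing a strict culf map with the interval construction\<close>

locale rdg_culf = rdg_choice X ch for X :: "('u, 'a) sgpd" and ch :: "'u factorisations" +
  fixes J :: "('u, 'a, 'u subdiv, 'u subdiv_arrow) pnt"
  assumes J: "strict_culf_map X (UU ch) J"
begin

lemma J_pn: "pseudonatural X (UU ch) J"
  using J by (simp add: strict_culf_map_def)

abbreviation "Jo n x \<equiv> fob (cpt J n) x"
abbreviation "Ji n x \<equiv> fst (fob (cpt J n) x)"

lemma J_ftr: "gfunctor (lev X n) (U_lev n) (cpt J n)"
  using pseudonaturalD(1)[OF J_pn] by simp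

lemma Jo_in: "x \<in> XO n \<Longrightarrow> Jo n x \<in> U_ob n"
  using gfunctorD(3)[OF J_ftr, of x n] by (simp add: obs_ars_simps)

lemma J_arrow:
  assumes "\<alpha> \<in> XA n"
  obtains F where "far (cpt J n) \<alpha> = (Jo n (src (lev X n) \<alpha>), Jo n (tgt (lev X n) \<alpha>), F)"
    "(Jo n (src (lev X n) \<alpha>), Jo n (tgt (lev X n) \<alpha>), F) \<in> U_ar n"
  using gfunctorD(5)[OF J_ftr arrow_ars(2)[OF assms]] by (auto simp: arrow_U)

lemma J_str:
  assumes x: "x \<in> XO (dtgt p)"
  obtains T where "str J p x = (fst (ch p (Jo (dtgt p) x)), Jo (dsrc p) (res p x), T)"
    "(fst (ch p (Jo (dtgt p) x)), Jo (dsrc p) (res p x), T) \<in> U_ar (dsrc p)"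
  using pseudonaturalD(3)[OF J_pn, of x p] x U_act_ob[OF ch Jo_in[OF x]]
  by (auto simp: arrow_U obs_ars_simps)

lemma J_str_active: "active p \<Longrightarrow> x \<in> XO (dtgt p) \<Longrightarrow>
    str J p x = idn (U_lev (dsrc p)) (Jo (dsrc p) (res p x))"
  using J by (simp add: strict_culf_map_def obs_ars_simps)

section \<open>Strictness of J on active maps\<close>

lemma Jo_active:
  assumes x: "x \<in> XO (dtgt p)" and p: "active p"
  shows "fst (ch p (Jo (dtgt p) x)) = Jo (dsrc p) (res p x)"
    "Ji (dsrc p) (res p x) = Ji (dtgt p) x"
    "snd (Jo (dsrc p) (res p x)) = scomp (std_simplex (dsrc p)) (snd (Jo (dtgt p) x)) (std_map p)"
    "snd (ch p (Jo (dtgt p) x)) = sid (Ji (dtgt p) x)"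
proof -
  obtain T where "str J p x = (fst (ch p (Jo (dtgt p) x)), Jo (dsrc p) (res p x), T)"
    by (rule J_str[OF x])
  then show 1: "fst (ch p (Jo (dtgt p) x)) = Jo (dsrc p) (res p x)"
    using J_str_active[OF p x] by simp
  note c = ch_props(4)[OF ch Jo_in[OF x] p]
  show "Ji (dsrc p) (res p x) = Ji (dtgt p) x"
    "snd (Jo (dsrc p) (res p x)) = scomp (std_simplex (dsrc p)) (snd (Jo (dtgt p) x)) (std_map p)"
    unfolding 1[symmetric] c by simp_all
  show "snd (ch p (Jo (dtgt p) x)) = sid (Ji (dtgt p) x)" unfolding c by simp
qed

text \<open>The top simplex of the subdivision \<open>Jo n x\<close>, which by Yoneda carries the
  same information.\<close>

definition pt :: "nat \<Rightarrow> 'u \<Rightarrow> 'u" where "pt n x = snd (Jo n x) n (did n)"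

lemma sset_Ji: "x \<in> XO n \<Longrightarrow> sset (Ji n x)"
  by (rule U_obD(2)[OF Jo_in])

lemma pt_in: "x \<in> XO n \<Longrightarrow> pt n x \<in> cells (Ji n x) n"
  unfolding pt_def by (rule smap_in[OF U_obD(3)[OF Jo_in]]) auto

lemma snd_Jo: "x \<in> XO n \<Longrightarrow> snd (Jo n x) = yoneda (Ji n x) n (pt n x)"
  unfolding pt_def by (rule yoneda_unique[OF sset_Ji U_obD(3)[OF Jo_in]])

lemma Ji_active: "x \<in> XO n \<Longrightarrow> active p \<Longrightarrow> dtgt p = n \<Longrightarrow> dsrc p = m \<Longrightarrow>
    Ji m (res p x) = Ji n x"
  using Jo_active(2)[of x p] by simp

lemma pt_active:
  assumes x: "x \<in> XO n" and p: "active p" "dtgt p = n" "dsrc p = m"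
  shows "pt m (res p x) = sact (Ji n x) p (pt n x)"
proof -
  have "snd (Jo m (res p x)) = yoneda (Ji n x) m (sact (Ji n x) p (pt n x))"
    using Jo_active(3)[of x p] scomp_yoneda_std_map[OF sset_Ji[OF x], of "pt n x" p] x p pt_in[OF x]
    by (simp add: snd_Jo[OF x])
  then show ?thesis
    using yoneda_did[OF sset_Ji[OF x] sact_in[OF sset_Ji[OF x] pt_in[OF x], of p m]] p by (simp add: pt_def)
qed

lemma Ji_long: "x \<in> XO n \<Longrightarrow> Ji 1 (lng n x) = Ji n x"
  by (rule Ji_active) auto

text \<open>Structure isomorphisms at active maps are identities, so naturality leaves the
  underlying isomorphism of intervals unchanged.\<close>

lemma J_arrow_active:
  assumes a: "\<alpha> \<in> XA (dtgt p)" and p: "active p"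
    and F: "far (cpt J (dtgt p)) \<alpha> = (Jo (dtgt p) (src (lev X (dtgt p)) \<alpha>), Jo (dtgt p) (tgt (lev X (dtgt p)) \<alpha>), F)"
  shows "snd (snd (far (cpt J (dsrc p)) (resA p \<alpha>))) = F"
proof -
  let ?n = "dtgt p" and ?m = "dsrc p"
  let ?x = "src (lev X ?n) \<alpha>" and ?y = "tgt (lev X ?n) \<alpha>"
  note x = src_in[OF a] and y = tgt_in[OF a]
  have pa: "resA p \<alpha> \<in> XA ?m" by (rule ars_in[OF a refl refl])
  have st: "src (lev X ?m) (resA p \<alpha>) = res p ?x"
    "tgt (lev X ?m) (resA p \<alpha>) = res p ?y"
    by (rule src_act[OF a refl refl], rule tgt_act[OF a refl refl])
  obtain G where G: "far (cpt J ?m) (resA p \<alpha>) = (Jo ?m (res p ?x), Jo ?m (res p ?y), G)"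
    "(Jo ?m (res p ?x), Jo ?m (res p ?y), G) \<in> U_ar ?m"
    by (rule J_arrow[OF pa, unfolded st])
  obtain F' where F': "far (cpt J ?n) \<alpha> = (Jo ?n ?x, Jo ?n ?y, F')" "(Jo ?n ?x, Jo ?n ?y, F') \<in> U_ar ?n"
    by (rule J_arrow[OF a])
  then have FU: "(Jo ?n ?x, Jo ?n ?y, F) \<in> U_ar ?n" using F by simp
  have act: "far (U_act ch p) (Jo ?n ?x, Jo ?n ?y, F) = (Jo ?m (res p ?x), Jo ?m (res p ?y), F)"
    using U_act_ar_active[OF ch FU p] Jo_active(1)[OF x p] Jo_active(1)[OF y p] by simp
  have aU: "(Jo ?m (res p ?x), Jo ?m (res p ?y), F) \<in> U_ar ?m"
    using gfunctorD(4)[OF gfunctor_U_act[OF ch, of p], of "(Jo ?n ?x, Jo ?n ?y, F)"] FU act by simp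
  have "cmp (U_lev ?m) (far (cpt J ?m) (resA p \<alpha>)) (str J p ?x) =
      cmp (U_lev ?m) (str J p ?y) (far (U_act ch p) (far (cpt J ?n) \<alpha>))"
    using pseudonaturalD(4)[OF J_pn, of \<alpha> p] a by (simp add: obs_ars_simps)
  then have "scomp (Ji ?m (res p ?x)) G (sid (Ji ?m (res p ?x))) =
      scomp (Ji ?m (res p ?x)) (sid (Ji ?m (res p ?y))) F"
    by (simp add: J_str_active[OF p x] J_str_active[OF p y] F act G(1))
  then have "G = F"
    using scomp_sid_left[OF U_arD(4)[OF aU]] scomp_sid_right[OF U_arD(4)[OF G(2)]] by simp
  then show ?thesis using G(1) by simp
qed

lemma J_pullback:
  assumes p: "active p"
  shows "bij_betw (\<lambda>z. (res p z, Jo (dtgt p) z)) (XO (dtgt p))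
       {(x, y). x \<in> XO (dsrc p) \<and> y \<in> U_ob (dtgt p) \<and> Jo (dsrc p) x = fob (U_act ch p) y}"
  using J p by (simp add: strict_culf_map_def strict_pullback_def obs_ars_simps)

text \<open>The long edge determines the interval and \<open>pt\<close> the subdivision; the
  pullback square at \<open>dlong n\<close> then determines the simplex.\<close>

lemma pt_inject:
  assumes x: "x \<in> XO n" and y: "y \<in> XO n" and l: "lng n x = lng n y" and pt: "pt n x = pt n y"
  shows "x = y"
proof -
  have "Ji n x = Ji n y" using Ji_long[OF x] Ji_long[OF y] l by simp
  then have "Jo n x = Jo n y" using snd_Jo[OF x] snd_Jo[OF y] pt by (simp add: prod_eq_iff)
  then show ?thesis
    using inj_onD[OF bij_betw_imp_inj_on[OF J_pullback[of "dlong n"]], of x y] x y l by simp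
qed

text \<open>For the pullback square at \<open>dlong n\<close> the subdivision by \<open>t\<close>
  has to restrict to \<open>Jo 1 f\<close>. It does, because an interval has only one long
  edge.\<close>

lemma pt_surj:
  assumes f: "f \<in> XO 1" and t: "t \<in> cells (Ji 1 f) n"
    "sact (Ji 1 f) (vert n 0) t = ibot (Ji 1 f)" "sact (Ji 1 f) (vert n n) t = itop (Ji 1 f)"
  obtains x where "x \<in> XO n" "lng n x = f" "pt n x = t"
proof -
  let ?A = "Ji 1 f" and ?y = "(Ji 1 f, yoneda (Ji 1 f) n t)"
  note A = U_obD(1)[OF Jo_in[OF f]]
  have y: "?y \<in> U_ob n"
    using stretched_yoneda[OF sset_Ji[OF f] t(1)] t A by (simp add: U_ob_iff)
  have y1: "(Ji 1 f, snd (Jo 1 f)) \<in> U_ob 1" using Jo_in[OF f] by simp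
  have y': "?y \<in> U_ob (dtgt (dlong n))" using y by simp
  have c: "fst (ch (dlong n) ?y) = (?A, yoneda ?A 1 (sact ?A (dlong n) t))"
    using ch_props(4)[OF ch y' active_simps(2)] scomp_yoneda_std_map[OF sset_Ji[OF f], of t "dlong n"] t(1) by simp
  have "fst (ch (dlong n) ?y) \<in> U_ob 1" using ch_props(1)[OF ch y'] by simp
  then have "long_edge ?A (yoneda ?A 1 (sact ?A (dlong n) t) 1 (dlong 1))" using U_ob_long_edge c by fastforce
  moreover have "sact ?A (dlong n) t \<in> cells ?A 1" using sact_in[OF sset_Ji[OF f] t(1), of "dlong n" 1] by simp
  ultimately have "long_edge ?A (sact ?A (dlong n) t)" using yoneda_did[OF sset_Ji[OF f]] by (simp add: dlong_1)
  then have "sact ?A (dlong n) t = pt 1 f"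
    using U_ob_long_edge_eq[OF Jo_in[OF f]] by (simp add: pt_def dlong_1)
  then have "Jo 1 f = fob (U_act ch (dlong n)) ?y"
    using c snd_Jo[OF f] U_act_ob[OF ch y'] by (simp add: prod_eq_iff)
  then have "(f, ?y) \<in> {(x, y). x \<in> XO (dsrc (dlong n)) \<and> y \<in> U_ob (dtgt (dlong n)) \<and>
      Jo (dsrc (dlong n)) x = fob (U_act ch (dlong n)) y}" using f y by simp
  then obtain x where x: "x \<in> XO (dtgt (dlong n))" "(lng n x, Jo (dtgt (dlong n)) x) = (f, ?y)"
    by (rule bij_betw_surjE[OF J_pullback[OF active_simps(2)]])
  then have "pt n x = t" using yoneda_did[OF sset_Ji[OF f] t(1)] by (simp add: pt_def)
  then show thesis using that x by simp
qed

text \<open>A simplex \<open>y\<close> of the interval of \<open>f\<close> is a simplex of \<open>X\<close> with long edge \<open>f\<close>; its image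
  under \<open>J\<close> is a subdivision of the interval \<open>J f\<close>, of which \<open>gam\<close> takes the inner part.\<close>

definition gam :: "'u \<Rightarrow> nat \<Rightarrow> 'u \<Rightarrow> 'u" where
  "gam f k = (\<lambda>y\<in>cells (intv f) k. sact (Ji 1 f) (iota k) (pt (k + 2) y))"

lemma fib_Ji:
  assumes "y \<in> cells (intv f) k"
  shows "y \<in> XO (k + 2)" "lng (k + 2) y = f" "Ji (k + 2) y = Ji 1 f"
    "pt (k + 2) y \<in> cells (Ji 1 f) (k + 2)"
  using assms Ji_long[of y "k + 2"] pt_in[of y "k + 2"] by (auto simp: fib_cells)

lemma gam_app: "y \<in> cells (intv f) k \<Longrightarrow> gam f k y = sact (Ji 1 f) (iota k) (pt (k + 2) y)"
  by (simp add: gam_def)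

lemma smap_gam:
  assumes f: "f \<in> XO 1"
  shows "smap (intv f) (Ji 1 f) (gam f)"
proof (rule smapI)
  note A = sset_Ji[OF f]
  show "gam f n \<in> extensional (cells (intv f) n)" for n by (simp add: gam_def)
  show "gam f n y \<in> cells (Ji 1 f) n" if "y \<in> cells (intv f) n" for n y
    using sact_in[OF A fib_Ji(4)[OF that], of "iota n" n] that by (simp add: gam_app)
  fix p y assume y: "y \<in> cells (intv f) (dtgt p)"
  have py: "res (shift p) y \<in> cells (intv f) (dsrc p)" by (rule fib_sact_in[OF sset_obs y])
  have "pt (dsrc p + 2) (res (shift p) y) = sact (Ji 1 f) (shift p) (pt (dtgt p + 2) y)"
    using pt_active[OF fib_Ji(1)[OF y], of "shift p" "dsrc p + 2"] fib_Ji(3)[OF y] by simp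
  then show "gam f (dsrc p) (sact (intv f) p y) = sact (Ji 1 f) p (gam f (dtgt p) y)"
    using y py fib_Ji(4)[OF y] A by (simp add: fib_sact gam_app sact_sact shift_iota)
qed

lemma pt_cone:
  assumes y: "y \<in> cells (intv f) k"
  shows "cone (Ji 1 f) k (gam f k y) (pt (k + 2) y)"
proof -
  have "stretched (std_simplex (k + 2)) (Ji (k + 2) y) (yoneda (Ji (k + 2) y) (k + 2) (pt (k + 2) y))"
    using Jo_in[OF fib_Ji(1)[OF y]] snd_Jo[OF fib_Ji(1)[OF y]] by (simp add: U_ob_iff)
  then show ?thesis
    using stretched_yoneda[OF sset_Ji pt_in, OF fib_Ji(1)[OF y] fib_Ji(1)[OF y]] fib_Ji[OF y]
    by (simp add: cone_def gam_app[OF y])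
qed

text \<open>The simplex \<open>pt (k + 2) y\<close> is the cone over \<open>gam f k y\<close>. So
  \<open>gam\<close> is inverted by forming the cone and finding the simplex of \<open>X\<close>
  with that subdivision.\<close>

lemma siso_gam:
  assumes f: "f \<in> XO 1"
  shows "siso (intv f) (Ji 1 f) (gam f)"
proof (rule siso_bijI[OF sset_Int sset_Ji[OF f] smap_gam[OF f]])
  fix k
  note hc = has_conesD[OF U_obD(4)[OF Jo_in[OF f]]]
  show "bij_betw (gam f k) (cells (intv f) k) (cells (Ji 1 f) k)"
    unfolding bij_betw_def
  proof
    show "inj_on (gam f k) (cells (intv f) k)"
    proof (rule inj_onI)
      fix y z assume y: "y \<in> cells (intv f) k" and z: "z \<in> cells (intv f) k"
        and e: "gam f k y = gam f k z"
      have "pt (k + 2) y = pt (k + 2) z"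
        using hc[OF smap_in[OF smap_gam[OF f] y]] pt_cone[OF y] pt_cone[OF z] e by auto
      then show "y = z"
        using pt_inject[OF fib_Ji(1)[OF y] fib_Ji(1)[OF z]] fib_Ji(2)[OF y] fib_Ji(2)[OF z] by simp
    qed
    show "gam f k ` cells (intv f) k = cells (Ji 1 f) k"
    proof (intro equalityI subsetI)
      fix u assume "u \<in> gam f k ` cells (intv f) k"
      then show "u \<in> cells (Ji 1 f) k" using smap_in[OF smap_gam[OF f]] by blast
    next
      fix u assume u: "u \<in> cells (Ji 1 f) k"
      obtain t where t: "t \<in> cells (Ji 1 f) (k + 2)" "sact (Ji 1 f) (iota k) t = u"
        "sact (Ji 1 f) (vert (k + 2) 0) t = ibot (Ji 1 f)" "sact (Ji 1 f) (vert (k + 2) (k + 2)) t = itop (Ji 1 f)"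
        using hc[OF u] unfolding cone_def by blast
      obtain y where y: "y \<in> XO (k + 2)" "lng (k + 2) y = f" "pt (k + 2) y = t"
        by (rule pt_surj[OF f t(1,3,4)])
      then have "y \<in> cells (intv f) k" by (simp add: fib_cells)
      then show "u \<in> gam f k ` cells (intv f) k"
        using gam_app y(3) t(2) by (intro image_eqI[of _ _ y]) auto
    qed
  qed
qed

text \<open>A modification from the interval construction to \<open>J\<close>: in this direction the
  isomorphism has a formula. The modification out of \<open>J\<close> is its inverse.\<close>

definition Theta :: "nat \<Rightarrow> 'u \<Rightarrow> 'u subdiv_arrow" where
  "Theta n = (\<lambda>x\<in>XO n. (I_ob X n x, Jo n x, gam (lng n x)))"

lemma gam_in_U:
  assumes x: "x \<in> XO n"
  shows "(I_ob X n x, Jo n x, gam (lng n x)) \<in> U_ar n"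
proof -
  note f = lng_in[OF x]
  \<comment> \<open>Active restriction commutes with \<open>pt\<close>; taking the inner part then
    undoes the repetition of the end vertices.\<close>
  have "pt (n + 2) (hat n x) = sact (Ji n x) (extend (did n)) (pt n x)" by (rule pt_active[OF x]) auto
  then have "gam (lng n x) n (hat n x) = pt n x"
    using gam_app[OF hat_in[OF x]] pt_in[OF x] Ji_long[OF x] sset_Ji[OF x] ext_iota[of "did n"]
      sact_did[OF sset_Ji[OF x] pt_in[OF x]]
    by (simp add: sact_sact)
  then have "scomp (std_simplex n) (gam (lng n x)) (snd (I_ob X n x)) = snd (Jo n x)"
    using scomp_yoneda[OF sset_Int smap_gam[OF f] hat_in[OF x]] Ji_long[OF x] snd_Jo[OF x] by (simp add: I_ob_eq[OF x])
  then show ?thesis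
    using I_ob_in[OF x] Jo_in[OF x] siso_gam[OF f] Ji_long[OF x] by (simp add: U_ar_iff fst_I_ob[OF x])
qed

text \<open>The lift \<epsilon> and the arrow \<alpha> restrict along active maps to the same arrow
  of \<open>X_1\<close>, so \<open>J\<close> assigns to them the same isomorphism of
  intervals.\<close>

lemma gam_natural:
  assumes a: "\<alpha> \<in> XA n"
    and F: "far (cpt J n) \<alpha> = (Jo n (src (lev X n) \<alpha>), Jo n (tgt (lev X n) \<alpha>), F)"
    and y: "y \<in> cells (Ivl n (src (lev X n) \<alpha>)) k"
  shows "F k (gam (lng n (src (lev X n) \<alpha>)) k y) =
    gam (lng n (tgt (lev X n) \<alpha>)) k (transport X (lngA n \<alpha>) k y)"
proof -
  let ?f = "lng n (src (lev X n) \<alpha>)" and ?g = "lng n (tgt (lev X n) \<alpha>)"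
  obtain \<epsilon> where e: "\<epsilon> \<in> XA (k + 2)" "src (lev X (k + 2)) \<epsilon> = y" "lngA (k + 2) \<epsilon> = lngA n \<alpha>"
    "transport X (lngA n \<alpha>) k y = tgt (lev X (k + 2)) \<epsilon>" "tgt (lev X (k + 2)) \<epsilon> \<in> cells (intv ?g) k"
    by (rule fib_lift[OF long_arrow[OF a] y])
  let ?z = "tgt (lev X (k + 2)) \<epsilon>"
  obtain G where G: "far (cpt J (k + 2)) \<epsilon> = (Jo (k + 2) y, Jo (k + 2) ?z, G)"
    "(Jo (k + 2) y, Jo (k + 2) ?z, G) \<in> U_ar (k + 2)"
    using J_arrow[OF e(1)] e(2) by metis
  have "G = F"
    using J_arrow_active[of \<epsilon> "dlong (k + 2)" G] J_arrow_active[of \<alpha> "dlong n" F] e(1,2,3) a F G(1) by simp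
  then have "F (k + 2) (pt (k + 2) y) = pt (k + 2) ?z"
    unfolding pt_def using scomp_eq_app[OF U_arD(5)[OF G(2)], of "did (k + 2)" "k + 2"] by simp
  moreover have "F k (sact (Ji 1 ?f) (iota k) (pt (k + 2) y)) = sact (Ji 1 ?g) (iota k) (F (k + 2) (pt (k + 2) y))"
    using smap_sact[OF U_arD(4)[OF G(2)], of "pt (k + 2) y" "k + 2" "iota k" k] \<open>G = F\<close>
      fib_Ji[OF y] fib_Ji[OF e(5)] by simp
  ultimately show ?thesis using gam_app[OF y] gam_app[OF e(5)] e(4) by simp
qed

text \<open>The structure isomorphisms of \<open>J\<close>, read as culf maps between the intervals
  of \<open>J\<close>.\<close>

definition J_culf :: "simplex_map \<Rightarrow> 'u \<Rightarrow> nat \<Rightarrow> 'u \<Rightarrow> 'u" where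
  "J_culf p x = scomp (Ji (dsrc p) (res p x)) (snd (ch p (Jo (dtgt p) x)))
     (SOME T'. scomp (fst (fst (ch p (Jo (dtgt p) x)))) T' (snd (snd (str J p x))) =
        sid (fst (fst (ch p (Jo (dtgt p) x)))) \<and>
       siso (Ji (dsrc p) (res p x)) (fst (fst (ch p (Jo (dtgt p) x)))) T')"

section \<open>Functoriality of the culf maps of J\<close>

lemma J_culf_props:
  assumes x: "x \<in> XO (dtgt p)"
    and T: "str J p x = (fst (ch p (Jo (dtgt p) x)), Jo (dsrc p) (res p x), T)"
  shows "strict_culf (Ji (dsrc p) (res p x)) (Ji (dtgt p) x) (J_culf p x)"
    "\<And>k u. u \<in> cells (fst (fst (ch p (Jo (dtgt p) x)))) k \<Longrightarrow> J_culf p x k (T k u) = snd (ch p (Jo (dtgt p) x)) k u"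
proof -
  let ?y = "Jo (dsrc p) (res p x)" and ?z = "fst (ch p (Jo (dtgt p) x))"
  let ?P = "\<lambda>T'. scomp (fst ?z) T' (snd (snd (str J p x))) = sid (fst ?z) \<and> siso (fst ?y) (fst ?z) T'"
  have px: "res p x \<in> XO (dsrc p)" by (rule obs_in[OF x refl refl])
  obtain T2 where "str J p x = (?z, ?y, T2)" "(?z, ?y, T2) \<in> U_ar (dsrc p)" by (rule J_str[OF x])
  then have TU: "(?z, ?y, T) \<in> U_ar (dsrc p)" using T by simp
  obtain T3 where T3: "(?y, ?z, T3) \<in> U_ar (dsrc p)" "scomp (fst ?z) T3 T = sid (fst ?z)"
    by (rule U_ar_inv[OF TU])
  have "?P T3" using U_arD(3)[OF T3(1)] T3(2) T by simp
  then have "\<exists>T'. ?P T'" by (rule exI[of ?P])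
  then have P: "?P (SOME T'. ?P T')" by (rule someI_ex)
  show "strict_culf (fst ?y) (Ji (dtgt p) x) (J_culf p x)"
    unfolding J_culf_def
    by (rule culf_scomp[OF sset_Ji[OF px] siso_culf[OF sset_Ji[OF px] conjunct2[OF P]] ch_props(2)[OF ch Jo_in[OF x]]])
  fix k u assume u: "u \<in> cells (fst ?z) k"
  have "(SOME T'. ?P T') k (T k u) = u"
    using scomp_eq_app[OF conjunct1[OF P] u] u T by simp
  then show "J_culf p x k (T k u) = snd (ch p (Jo (dtgt p) x)) k u"
    unfolding J_culf_def using smap_in[OF U_arD(4)[OF TU] u] by simp
qed

text \<open>The structure isomorphism and the chosen culf part both respect subdivisions. This fixes
  \<open>J_culf\<close> at one simplex, also when \<open>p\<close> is inert.\<close>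

lemma J_culf_pt:
  assumes x: "x \<in> XO n" and p: "dtgt p = n" "dsrc p = m"
  shows "J_culf p x m (pt m (res p x)) = sact (Ji n x) p (pt n x)"
proof -
  let ?y = "Jo m (res p x)" and ?z = "fst (ch p (Jo n x))"
  have x': "x \<in> XO (dtgt p)" using x p by simp
  obtain T where T: "str J p x = (?z, ?y, T)" "(?z, ?y, T) \<in> U_ar m"
    by (rule J_str[OF x', unfolded p])
  note j = J_culf_props[OF x', unfolded p, OF T(1)]
  note c = ch_props[OF ch Jo_in[OF x'], unfolded p]
  have "pt m (res p x) = T m (snd ?z m (did m))"
    unfolding pt_def using scomp_eq_app[OF U_arD(5)[OF T(2)], of "did m" m] by simp
  then have "J_culf p x m (pt m (res p x)) = snd (ch p (Jo n x)) m (snd ?z m (did m))"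
    using j(2)[OF smap_in[OF U_obD(3)[OF c(1)]], of "did m" m] by simp
  also have "\<dots> = snd (Jo n x) m p"
    using scomp_cong_app[OF c(3), of "did m" m] p by (simp add: std_map_def)
  finally show ?thesis using snd_Jo[OF x] p by simp
qed

lemma J_culf_active:
  assumes x: "x \<in> XO n" and p: "active p" "dtgt p = n" "dsrc p = m" and u: "u \<in> cells (Ji n x) k"
  shows "J_culf p x k u = u"
proof -
  have x': "x \<in> XO (dtgt p)" using x p by simp
  note a = Jo_active[OF x' p(1), unfolded p]
  have "str J p x = (fst (ch p (Jo n x)), Jo m (res p x), sid (Ji n x))"
    using J_str_active[OF p(1) x'] a p by simp
  from J_culf_props(2)[OF x', unfolded p, OF this, of u k] show ?thesis
    using u a by simp
qed

text \<open>Pseudonaturality with the coherence isomorphism of \<open>U\<close> absorbed: once the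
  structure isomorphisms are read as culf maps, it becomes strict functoriality.\<close>

lemma J_culf_dcomp:
  assumes x: "x \<in> XO (dtgt q)" and pq: "dtgt p = dsrc q"
    and u: "u \<in> cells (Ji (dsrc p) (res (q \<odot> p) x)) k"
  shows "J_culf (q \<odot> p) x k u = J_culf q x k (J_culf p (res q x) k u)"
proof -
  let ?m = "dsrc p" and ?n = "dsrc q" and ?y = "res q x"
  let ?Jx = "Jo (dtgt q) x" and ?Jy = "Jo ?n ?y"
  have y: "?y \<in> XO (dtgt p)" using obs_in[OF x refl refl] pq by simp
  have x': "x \<in> XO (dtgt (q \<odot> p))" using x pq by simp
  let ?z = "res (q \<odot> p) x"
  have z: "res p ?y = ?z" using x pq by (simp add: sact_sact[OF sset_obs])
  let ?Jz = "Jo ?m ?z"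
  obtain S where S: "str J (q \<odot> p) x = (fst (ch (q \<odot> p) ?Jx), ?Jz, S)" "(fst (ch (q \<odot> p) ?Jx), ?Jz, S) \<in> U_ar ?m"
    by (rule J_str[OF x', unfolded dcomp_simps(1,2)[OF pq]])
  obtain T where T: "str J p ?y = (fst (ch p ?Jy), ?Jz, T)" "(fst (ch p ?Jy), ?Jz, T) \<in> U_ar ?m"
    by (rule J_str[OF y, unfolded z, unfolded pq])
  obtain R where R: "str J q x = (fst (ch q ?Jx), ?Jy, R)" "(fst (ch q ?Jx), ?Jy, R) \<in> U_ar ?n"
    by (rule J_str[OF x])
  have R': "(fst (ch q ?Jx), ?Jy, R) \<in> U_ar (dtgt p)" using R(2) pq by simp
  let ?v = "fst (ch p (fst (ch q ?Jx)))"
  obtain K where K: "U_coh ch q p ?Jx = (?v, fst (ch (q \<odot> p) ?Jx), K)"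
    "(?v, fst (ch (q \<odot> p) ?Jx), K) \<in> U_ar ?m"
    "\<And>k u. u \<in> cells (fst ?v) k \<Longrightarrow>
      snd (ch (q \<odot> p) ?Jx) k (K k u) = snd (ch q ?Jx) k (snd (ch p (fst (ch q ?Jx))) k u)"
    by (rule U_coh_props[OF ch Jo_in[OF x] pq], rule that)
  obtain H where H: "far (U_act ch p) (fst (ch q ?Jx), ?Jy, R) = (?v, fst (ch p ?Jy), H)"
    "(?v, fst (ch p ?Jy), H) \<in> U_ar ?m"
    "\<And>k u. u \<in> cells (fst ?v) k \<Longrightarrow> snd (ch p ?Jy) k (H k u) = R k (snd (ch p (fst (ch q ?Jx))) k u)"
    by (rule U_act_ar[OF ch R'], rule that)
  have "cmp (U_lev ?m) (str J (q \<odot> p) x) (U_coh ch q p ?Jx) =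
    cmp (U_lev ?m) (str J p ?y) (far (U_act ch p) (str J q x))"
    using pseudonaturalD(6)[OF J_pn pq, of x] x by (simp add: obs_ars_simps)
  then have e: "scomp (fst ?v) S K = scomp (fst ?v) T H" by (simp add: S(1) K(1) T(1) R(1) H(1))
  \<comment> \<open>\<open>J_culf\<close> is known on images under structure isomorphisms. Every
    \<open>u\<close> is such an image, as the composite of \<open>H\<close> and \<open>T\<close> is
    an isomorphism.\<close>
  obtain v where v1: "v \<in> cells (fst ?v) k" "scomp (fst ?v) T H k v = u"
    by (rule bij_betw_surjE[OF siso_bij[OF U_arD(3)[OF U_ar_comp[OF H(2) T(2)]]] u])
  then have v: "v \<in> cells (fst ?v) k" "u = T k (H k v)" by simp_all
  have Kv: "K k v \<in> cells (fst (fst (ch (q \<odot> p) ?Jx))) k" using smap_in[OF U_arD(4)[OF K(2)] v(1)] .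
  have Hv: "H k v \<in> cells (fst (fst (ch p ?Jy))) k" using smap_in[OF U_arD(4)[OF H(2)] v(1)] .
  have iv: "snd (ch p (fst (ch q ?Jx))) k v \<in> cells (fst (fst (ch q ?Jx))) k"
    by (rule smap_in[OF culfD[OF ch_props(2)[OF ch U_arD(1)[OF R']]] v(1)])
  have uS: "u = S k (K k v)" using scomp_cong_app[OF e v(1)] v(2) by simp
  have "J_culf (q \<odot> p) x k u = snd (ch (q \<odot> p) ?Jx) k (K k v)"
    unfolding uS using J_culf_props(2)[OF x', unfolded dcomp_simps(1,2)[OF pq], OF S(1) Kv] .
  also have "\<dots> = J_culf q x k (R k (snd (ch p (fst (ch q ?Jx))) k v))"
    using K(3)[OF v(1)] J_culf_props(2)[OF x R(1) iv] by simp
  also have "\<dots> = J_culf q x k (J_culf p ?y k (T k (H k v)))"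
    using H(3)[OF v(1)] J_culf_props(2)[OF y, unfolded z, unfolded pq, OF T(1) Hv] by simp
  finally show ?thesis using v(2) by simp
qed

text \<open>The map \<open>J_culf p x\<close> only depends on the edge \<open>p \<odot> dlong m\<close> of \<open>x\<close>, which is also the edge
  of \<open>w\<close> under the inert map \<open>iota (k + 2)\<close>.  So \<open>J_culf p x = J_culf (iota (k + 2)) w\<close>, and the latter is
  determined on \<open>y\<close>, since \<open>y\<close> is the restriction of \<open>w\<close> along \<open>iota (k + 2)\<close>.\<close>

lemma J_culf_gam:
  assumes x: "x \<in> XO n" and p: "dtgt p = n" "dsrc p = m"
    and y: "y \<in> cells (Ivl m (res p x)) k"
  shows "J_culf p x k (gam (lng m (res p x)) k y) = gam (lng n x) k (I_culf X p x k y)"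
proof -
  let ?x' = "res p x"
  let ?f' = "lng m ?x'" and ?f = "lng n x"
  have x'A: "?x' \<in> XO m" by (rule obs_in[OF x p])
  note f' = lng_in[OF x'A] and f = lng_in[OF x]
  obtain w where w: "w \<in> XO (k + 4)"
    "res (shift (dlong (k + 2))) w = res (extend (p \<odot> dlong m)) x"
    "res (iota (k + 2)) w = y"
    using fib_pull_ex[OF decomp_obs x p y] by blast
  have c: "I_culf X p x k y = res (shift (iota k)) w"
    using I_culf_char[of x p y k w] x p y w by simp
  have cy: "I_culf X p x k y \<in> cells (Ivl n x) k"
    using smap_in[OF I_culf_props(1)[of x p]] x p y by simp
  have lw: "lng (k + 4) w = ?f"
  proof -
    have "lng (k + 4) w = lng 3 (res (shift (dlong (k + 2))) w)"
      by (rule long_act[OF w(1), symmetric]) auto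
    also have "\<dots> = ?f" unfolding w(2) by (rule long_act[OF x]) (use p in auto)
    finally show ?thesis .
  qed
  have A: "Ji (k + 4) w = Ji 1 ?f" using Ji_long[OF w(1)] lw by simp
  have si: "shift (iota k) \<odot> iota k = iota (k + 2) \<odot> iota k" using shift_iota[of "iota k"] by simp
  have "pt (k + 2) (I_culf X p x k y) = sact (Ji 1 ?f) (shift (iota k)) (pt (k + 4) w)"
    unfolding c A[symmetric] by (rule pt_active[OF w(1)]) auto
  then have gc: "gam ?f k (I_culf X p x k y) = sact (Ji 1 ?f) (iota (k + 2) \<odot> iota k) (pt (k + 4) w)"
    using gam_app[OF cy] pt_in[OF w(1)] sset_Ji[OF f] A si by (simp add: sact_sact add.assoc)
  have yA: "y \<in> XO (k + 2)" and yl: "lng (k + 2) y = ?f'" and yJ: "Ji (k + 2) y = Ji 1 ?f'"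
    using fib_Ji[OF y] by auto
  have iw: "dtgt (iota (k + 2)) = k + 4" "dsrc (iota (k + 2)) = k + 2" by simp_all
  have w': "w \<in> XO (dtgt (iota (k + 2)))" unfolding iw(1) by (rule w(1))
  obtain T where "str J (iota (k + 2)) w = (fst (ch (iota (k + 2)) (Jo (k + 4) w)), Jo (k + 2) y, T)"
    by (rule J_str[OF w', unfolded iw w(3)])
  from J_culf_props(1)[OF w', unfolded iw w(3), OF this]
  have sm: "smap (Ji 1 ?f') (Ji 1 ?f) (J_culf (iota (k + 2)) w)" unfolding yJ A by (rule culfD)
  have "J_culf (iota (k + 2)) w k (gam ?f' k y) =
      sact (Ji 1 ?f) (iota k) (J_culf (iota (k + 2)) w (k + 2) (pt (k + 2) y))"
    unfolding gam_app[OF y] by (rule smap_sact[OF sm]) (use fib_Ji[OF y] in auto)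
  also have "J_culf (iota (k + 2)) w (k + 2) (pt (k + 2) y) = sact (Ji 1 ?f) (iota (k + 2)) (pt (k + 4) w)"
    using J_culf_pt[OF w(1) iw] w(3) A by simp
  also have "sact (Ji 1 ?f) (iota k) \<dots> = gam ?f k (I_culf X p x k y)"
    unfolding gc using pt_in[OF w(1)] sset_Ji[OF f] A by (simp add: sact_sact add.assoc)
  finally have 1: "J_culf (iota (k + 2)) w k (gam ?f' k y) = gam ?f k (I_culf X p x k y)" .
  let ?u = "gam ?f' k y"
  have u: "?u \<in> cells (Ji 1 ?f') k" by (rule smap_in[OF smap_gam[OF f'] y])
  \<comment> \<open>The passage from \<open>x\<close> to \<open>w\<close> goes through the 3-simplex
    \<open>?v\<close>, which is the restriction of \<open>x\<close> along \<open>?r\<close> and of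
    \<open>w\<close> along \<open>?s\<close>. Both maps are active, and \<open>?f'\<close> is the
    middle edge of \<open>?v\<close>.\<close>
  let ?r = "extend (p \<odot> dlong m)" and ?s = "shift (dlong (k + 2))"
  let ?v = "res ?r x"
  have v: "?v \<in> XO 3" by (rule obs_in[OF x]) (use p in auto)
  have vi: "res (iota 1) ?v = ?f'"
    using x p ext_iota[of "p \<odot> dlong m"] by (simp add: sact_sact[OF sset_obs])
  have u3: "J_culf (iota 1) ?v k ?u \<in> cells (Ji 3 ?v) k"
  proof -
    have d: "dtgt (iota 1) = 3" "dsrc (iota 1) = 1" by simp_all
    have v': "?v \<in> XO (dtgt (iota 1))" using v by simp
    obtain T where "str J (iota 1) ?v = (fst (ch (iota 1) (Jo 3 ?v)), Jo 1 ?f', T)"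
      by (rule J_str[OF v', unfolded d vi])
    from smap_in[OF culfD[OF J_culf_props(1)[OF v', unfolded d vi, OF this]] u] show ?thesis .
  qed
  have Jr: "Ji 3 ?v = Ji n x" by (rule Ji_active[OF x]) (use p in auto)
  have Js: "Ji 3 ?v = Ji (k + 4) w" unfolding w(2)[symmetric] by (rule Ji_active[OF w(1)]) auto
  have "J_culf p x k ?u = J_culf (p \<odot> dlong m) x k ?u"
  proof -
    have "res (p \<odot> dlong m) x = ?f'" using x p by (simp add: sact_sact[OF sset_obs])
    then have "J_culf (p \<odot> dlong m) x k ?u = J_culf p x k (J_culf (dlong m) ?x' k ?u)"
      using J_culf_dcomp[of x p "dlong m" ?u k] x p u by simp
    also have "J_culf (dlong m) ?x' k ?u = ?u"
      by (rule J_culf_active[OF x'A]) (use u Ji_long[OF x'A] in auto)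
    finally show ?thesis by simp
  qed
  also have "\<dots> = J_culf (?r \<odot> iota 1) x k ?u" using ext_iota[of "p \<odot> dlong m"] p by simp
  also have "\<dots> = J_culf ?r x k (J_culf (iota 1) ?v k ?u)"
  proof (rule J_culf_dcomp)
    have "res (?r \<odot> iota 1) x = ?f'" using vi x p by (simp add: sact_sact[OF sset_obs])
    then show "?u \<in> cells (Ji (dsrc (iota 1)) (res (?r \<odot> iota 1) x)) k" using u by simp
  qed (use x p in auto)
  also have "\<dots> = J_culf (iota 1) ?v k ?u"
    by (rule J_culf_active[OF x, of ?r 3]) (use p u3 Jr in auto)
  also have "\<dots> = J_culf ?s w k (J_culf (iota 1) (res ?s w) k ?u)"
    unfolding w(2) by (rule J_culf_active[OF w(1), of ?s 3, symmetric]) (use u3 Js in auto)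
  also have "\<dots> = J_culf (?s \<odot> iota 1) w k ?u"
  proof (rule J_culf_dcomp[symmetric])
    have "res (?s \<odot> iota 1) w = ?f'"
      using vi w(1) by (simp add: sact_sact[OF sset_obs] add.assoc flip: w(2))
    then show "?u \<in> cells (Ji (dsrc (iota 1)) (res (?s \<odot> iota 1) w)) k" using u by simp
  qed (use w(1) in \<open>auto simp: add.commute\<close>)
  also have "?s \<odot> iota 1 = iota (k + 2) \<odot> dlong (k + 2)" using shift_iota[of "dlong (k + 2)"] by simp
  also have "J_culf \<dots> w k ?u = J_culf (iota (k + 2)) w k (J_culf (dlong (k + 2)) y k ?u)"
    unfolding w(3)[symmetric]
  proof (rule J_culf_dcomp)
    have "res (iota (k + 2) \<odot> dlong (k + 2)) w = ?f'"
      using sact_sact[OF sset_obs w', of "dlong (k + 2)"] w(3) yl by simp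
    then show "gam ?f' k (res (iota (k + 2)) w) \<in>
      cells (Ji (dsrc (dlong (k + 2))) (res (iota (k + 2) \<odot> dlong (k + 2)) w)) k" using u w(3) by simp
  qed (use w' in auto)
  also have "J_culf (dlong (k + 2)) y k ?u = ?u"
    by (rule J_culf_active[OF yA]) (use u yJ in auto)
  finally show ?thesis using 1 by simp
qed

text \<open>The squares with the structure isomorphisms are compared after the culf map
  \<open>J_culf p x\<close>, which turns them into \<open>J_culf_gam\<close>.\<close>

lemma modification_Theta: "modification X (UU ch) IC J Theta"
  unfolding modification_def UU_simps obs_ars_simps
proof (intro conjI allI ballI)
  fix n show "Theta n \<in> extensional (XO n)" by (simp add: Theta_def)
next
  fix n x assume "x \<in> XO n"
  then show "arrow (U_lev n) (Theta n x) (fob (cpt IC n) x) (Jo n x)"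
    using gam_in_U by (simp add: arrow_U IC_ob Theta_def)
next
  fix n \<alpha> assume a: "\<alpha> \<in> XA n"
  note x = src_in[OF a] and y = tgt_in[OF a]
  let ?x = "src (lev X n) \<alpha>" and ?y = "tgt (lev X n) \<alpha>"
  obtain F where F: "far (cpt J n) \<alpha> = (Jo n ?x, Jo n ?y, F)" "(Jo n ?x, Jo n ?y, F) \<in> U_ar n"
    by (rule J_arrow[OF a])
  have "scomp (Ivl n ?x) F (gam (lng n ?x)) = scomp (Ivl n ?x) (gam (lng n ?y)) (transport X (lngA n \<alpha>))"
    by (rule ext, rule extensionalityI[OF scomp_ext scomp_ext]) (simp add: gam_natural[OF a F(1)])
  then show "cmp (U_lev n) (far (cpt J n) \<alpha>) (Theta n ?x) = cmp (U_lev n) (Theta n ?y) (far (cpt IC n) \<alpha>)"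
    using x y by (simp add: F(1) Theta_def IC_ar[OF a] fst_I_ob)
next
  fix p x assume x: "x \<in> XO (dtgt p)"
  let ?n = "dtgt p" and ?m = "dsrc p"
  let ?x' = "res p x"
  have px: "?x' \<in> XO ?m" by (rule obs_in[OF x refl refl])
  let ?I = "I_ob X ?n x" and ?I' = "I_ob X ?m ?x'" and ?c = "ch p (I_ob X ?n x)"
  obtain S where S: "str IC p x = (fst ?c, ?I', S)" "(fst ?c, ?I', S) \<in> U_ar ?m"
    "\<And>k u. u \<in> cells (fst (fst ?c)) k \<Longrightarrow> I_culf X p x k (S k u) = snd ?c k u"
    using IC_str[OF x] by metis
  obtain T where T: "str J p x = (fst (ch p (Jo ?n x)), Jo ?m ?x', T)"
    "(fst (ch p (Jo ?n x)), Jo ?m ?x', T) \<in> U_ar ?m" by (rule J_str[OF x])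
  obtain H where H: "far (U_act ch p) (?I, Jo ?n x, gam (lng ?n x)) = (fst ?c, fst (ch p (Jo ?n x)), H)"
    "(fst ?c, fst (ch p (Jo ?n x)), H) \<in> U_ar ?m"
    "\<And>k u. u \<in> cells (fst (fst ?c)) k \<Longrightarrow> snd (ch p (Jo ?n x)) k (H k u) = gam (lng ?n x) k (snd ?c k u)"
    by (rule U_act_ar[OF ch gam_in_U[OF x]], rule that)
  have "scomp (fst (fst ?c)) (gam (lng ?m ?x')) S = scomp (fst (fst ?c)) T H"
  proof (rule U_ar_eqI[OF U_ar_comp[OF S(2) gam_in_U[OF px]] U_ar_comp[OF H(2) T(2)] J_culf_props(1)[OF x T(1)]])
    fix k u assume u: "u \<in> cells (fst (fst ?c)) k"
    have Su: "S k u \<in> cells (Ivl ?m ?x') k"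
      using smap_in[OF U_arD(4)[OF S(2)] u] by (simp add: fst_I_ob[OF px])
    have Hu: "H k u \<in> cells (fst (fst (ch p (Jo ?n x)))) k" using smap_in[OF U_arD(4)[OF H(2)] u] .
    show "J_culf p x k (scomp (fst (fst ?c)) (gam (lng ?m ?x')) S k u) = J_culf p x k (scomp (fst (fst ?c)) T H k u)"
      using u J_culf_gam[OF x refl refl Su] S(3)[OF u] J_culf_props(2)[OF x T(1) Hu] H(3)[OF u] by simp
  qed
  then show "cmp (U_lev ?m) (Theta ?m ?x') (str IC p x) = cmp (U_lev ?m) (str J p x) (far (U_act ch p) (Theta ?n x))"
    using x px by (simp add: Theta_def S(1) T(1) H(1))
qed

end

theorem theorem6p1:
  fixes X :: "('u, 'a) sgpd" and ch :: "'u factorisations"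
  assumes "rigid_decomposition_groupoid X"
    and "factorisation_choice ch"
  shows "connected_groupoid (map_gpd X (UU ch)) \<and>
    strict_culf_map X (UU ch) (interval_construction ch X) \<and>
    (\<forall>J. strict_culf_map X (UU ch) J \<longrightarrow>
       (\<exists>\<Gamma>. invertible_modification X (UU ch) J (interval_construction ch X) \<Gamma>))"
proof -
  interpret rdg_choice X ch using assms by unfold_locales
  interpret modification_setting X "UU ch"
    by unfold_locales (simp_all add: groupoid_U gfunctor_U_act[OF ch] rdg.X[OF rdg_axioms])
  have mod: "\<exists>\<Gamma>. modification X (UU ch) J IC \<Gamma>" if J: "strict_culf_map X (UU ch) J" for J
  proof -
    interpret rdg_culf X ch J using J by unfold_locales
    show ?thesis using modification_invertible[OF pseudonatural_IC J_pn modification_Theta] by metis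
  qed
  moreover have "invertible_modification X (UU ch) J IC \<Gamma>"
    if "strict_culf_map X (UU ch) J" "modification X (UU ch) J IC \<Gamma>" for J \<Gamma>
    using that invertible_modification_iff[OF strict_culf_map_pseudonatural pseudonatural_IC] by blast
  ultimately show ?thesis
    using connected_map_gpd[OF strict_culf_IC mod] strict_culf_IC by blast
qed

end
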